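(* Let $n$ be a positive integer, let $A \in C^\infty(\overline{D})$, and for each $k$ with $1 \le k \le n$ let $h_{k-1} \in H_b$ and $c_{k-1} \in \mathbb{R}$. Put $f_0 \equiv 0$ and, for $1 \le k \le n$ and $z = re^{i\theta} \in D$, \[ f_k(z) = ic_{k-1} - I_{k-1} + \frac{1}{2\pi} \langle (h_{k-1})_b, P_r(\theta - \cdot) \rangle - \sum_{\ell = 1}^{k-1} \frac{(-1)^\ell}{\ell!} \bar z^\ell f_{k-\ell}(z), \qquad I_{k-1} := \frac{i}{2\pi} \langle \operatorname{Im}\{(h_{k-1})_b\}, 1\rangle . \] Then for each $k$ with $1 \le k \le n$, $f_k$ solves the Schwarz problem \[ \begin{cases} \dfrac{\partial f_k}{\partial\bar z} = f_{k-1},\\[2mm] \operatorname{Re}\left\{ (f_k)_b\right\} = \operatorname{Re}\left\{ (h_{k-1})_b - \sum_{\ell = 1}^{k-1} \frac{(-1)^\ell}{\ell!} e^{-i\ell(\cdot)} (f_{k-\ell})_b \right\},\\[2mm] \operatorname{Im}\left\{ f_k(0)\right\} = c_{k-1}, \end{cases} \] and, with \[ \psi(z) = -\frac{1}{2\pi} \iint_D \left( \frac{A(\zeta)}{\zeta}\frac{\zeta + z}{\zeta - z} + \frac{\overline{A(\zeta)}}{\overline{\zeta} }\frac{1+z\overline{\zeta}}{1-z\overline{\zeta}} \right)\,d\xi\,d\eta \qquad (\zeta=\xi+i\eta), \] the function \[ w(z) = e^{\psi(z)}\left[ic_{n-1} - I_{n-1} + \frac{1}{2\pi} \langle (h_{n-1})_b,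 P_r(\theta - \cdot) \rangle - \sum_{\ell = 1}^{n-1} \frac{(-1)^\ell}{\ell!} \bar z^\ell f_{n-\ell}(z)\right] \] solves the Schwarz problem consisting of the equation \[ \left(\frac{\partial}{\partial\bar z} - A\right)^n w = 0 \] and, for every $k$ with $0 \le k \le n-1$, the conditions \[ \operatorname{Re}\left\{ \left( \left(\frac{\partial}{\partial\bar z}-A\right)^k w \right)_b \right\} = \operatorname{Re}\left\{ e^{\psi(e^{i(\cdot)})}\left(ic_{n-1-k} - I_{n-1-k}+(h_{n-1-k})_b - \sum_{\ell = 1}^{n-k-1} \frac{(-1)^\ell}{\ell!} e^{-i\ell(\cdot)} (f_{n-k-\ell})_b\right)\right\} \] and \[ \operatorname{Im}\left\{ \left(\left(\frac{\partial}{\partial\bar z}-A\right)^k w\right)(0) \right\} = e^{\psi(0)}c_{n-1-k}. \]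
   Context: $D$ is the open unit disk in $\mathbb{C}$ and $\partial D$ its boundary circle; $\mathcal{D}'(\partial D)$ is the space of distributions on $\partial D$. Functions are complex-valued. A function $f$ on $D$ has a boundary value in the sense of distributions, denoted $f_b \in \mathcal{D}'(\partial D)$, if for every $\varphi \in C^\infty(\partial D)$ (regarded as a function of the angle $\theta$) the limit $\langle f_b,\varphi\rangle := \lim_{r\nearrow 1}\int_0^{2\pi} f(re^{i\theta})\varphi(\theta)\,d\theta$ exists. $H_b$ is the set of holomorphic functions on $D$ that have boundary values in the sense of distributions. $P_r(\theta) = \frac{1-r^2}{1-2r\cos\theta + r^2}$ is the Poisson kernel on $D$, and in formulas involving $P_r(\theta-\cdot)$ one has $z = re^{i\theta}$. For a distribution $u$, $\operatorname{Re}\{u\}$ and $\operatorname{Im}\{u\}$ are its real and imaginary parts, i.e. $\langle \operatorname{Re}\{u\},\varphi\rangle = \operatorname{Re}\langle u,\varphi\rangle$ and $\langle \operatorname{Im}\{u\},\varphi\rangle = \operatorname{Im}\langle u,\varphi\rangle$ for real-valued $\varphi$. $e^{-i\ell(\cdot)}u$ denotes the product of $u$ with the smooth function $\theta\mapsto e^{-i\ell\theta}$, and $e^{\psi(e^{i(\cdot)})}$ denotes the function $\theta \mapsto e^{\psi(e^{i\theta})}$ on the circle, given by the continuous extension of $\psi$ to $\overline{D}$, acting by multiplication on distributions. $\left(\frac{\partial}{\partial\bar z} - A\right)^k$ is the $k$-fold composition of the operator $w \mapsto \frac{\partial w}{\partial \bar z} - A w$ (the identity for $k=0$). *)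

theory Defs
  imports "HOL-Complex_Analysis.Complex_Analysis"
begin

section \<open>Distributions on the unit circle\<close>

text \<open>
  Functions on the circle are written as \<open>2\<pi>\<close>-periodic functions of the angle.
  \<open>test_fun \<phi>\<close> says that \<open>\<phi>\<close> is a complex-valued smooth function on the circle.
\<close>

definition test_fun :: "(real \<Rightarrow> complex) \<Rightarrow> bool" where
  "test_fun \<phi> \<longleftrightarrow>
     (\<forall>\<theta>. \<phi> (\<theta> + 2 * pi) = \<phi> \<theta>) \<and>
     (\<forall>k \<theta>. ((\<lambda>g t. vector_derivative g (at t)) ^^ k) \<phi> differentiable (at \<theta>))"

text \<open>
  A distribution is represented by a functional of which only the values on test
  functions matter; accordingly, equality of distributions is \<open>dist_eq\<close>.
  The only distributions that occur are boundary values, constants, and combinations of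
  these with smooth multipliers. No continuity clause is needed for boundary
  values: a pointwise limit of the distributions \<open>f(r e\<^sup>i\<^sup>\<theta>)\<close> is linear, and it is
  continuous by the Banach--Steinhaus theorem.
\<close>

type_synonym circle_dist = "(real \<Rightarrow> complex) \<Rightarrow> complex"

definition dist_eq :: "circle_dist \<Rightarrow> circle_dist \<Rightarrow> bool" where
  "dist_eq u v \<longleftrightarrow> (\<forall>\<phi>. test_fun \<phi> \<longrightarrow> u \<phi> = v \<phi>)"

definition dist_const :: "complex \<Rightarrow> circle_dist" where
  "dist_const a = (\<lambda>\<phi>. a * integral {0..2*pi} \<phi>)"

definition dist_mult :: "(real \<Rightarrow> complex) \<Rightarrow> circle_dist \<Rightarrow> circle_dist" where
  "dist_mult g u = (\<lambda>\<phi>. u (\<lambda>\<theta>. g \<theta> * \<phi> \<theta>))"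

text \<open>
  \<open>Re u\<close> and \<open>Im u\<close> are given by \<open>\<langle>Re u, \<phi>\<rangle> = Re \<langle>u, \<phi>\<rangle>\<close> and \<open>\<langle>Im u, \<phi>\<rangle> = Im \<langle>u, \<phi>\<rangle>\<close>
  for real-valued \<open>\<phi>\<close>, and extended complex linearly to all test functions.
\<close>

definition dist_Re :: "circle_dist \<Rightarrow> circle_dist" where
  "dist_Re u = (\<lambda>\<phi>. of_real (Re (u (\<lambda>\<theta>. of_real (Re (\<phi> \<theta>)))))
                  + \<i> * of_real (Re (u (\<lambda>\<theta>. of_real (Im (\<phi> \<theta>))))))"

definition dist_Im :: "circle_dist \<Rightarrow> circle_dist" where
  "dist_Im u = (\<lambda>\<phi>. of_real (Im (u (\<lambda>\<theta>. of_real (Re (\<phi> \<theta>)))))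
                  + \<i> * of_real (Im (u (\<lambda>\<theta>. of_real (Im (\<phi> \<theta>))))))"

section \<open>Boundary values in the sense of distributions\<close>

definition circle_pairing :: "(complex \<Rightarrow> complex) \<Rightarrow> (real \<Rightarrow> complex) \<Rightarrow> real \<Rightarrow> complex" where
  "circle_pairing f \<phi> r = integral {0..2*pi} (\<lambda>\<theta>. f (of_real r * cis \<theta>) * \<phi> \<theta>)"

text \<open>
  The integrability clause (automatic for \<open>f\<close> continuous on the disk) excludes
  the default value \<open>0\<close> of \<open>integral\<close>.
\<close>

definition has_bv :: "(complex \<Rightarrow> complex) \<Rightarrow> bool" where
  "has_bv f \<longleftrightarrow> (\<forall>\<phi>. test_fun \<phi> \<longrightarrow>
     (\<forall>\<^sub>F r in at_left 1.
        (\<lambda>\<theta>. f (of_real r * cis \<theta>) * \<phi> \<theta>) absolutely_integrable_on {0..2*pi}) \<and>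
     (\<exists>L. (circle_pairing f \<phi> \<longlongrightarrow> L) (at_left 1)))"

definition bv :: "(complex \<Rightarrow> complex) \<Rightarrow> circle_dist" where
  "bv f = (\<lambda>\<phi>. Lim (at_left 1) (circle_pairing f \<phi>))"

definition Hb :: "(complex \<Rightarrow> complex) set" where
  "Hb = {f. f holomorphic_on ball 0 1 \<and> has_bv f}"

definition poisson :: "real \<Rightarrow> real \<Rightarrow> real" where
  "poisson r t = (1 - r\<^sup>2) / (1 - 2 * r * cos t + r\<^sup>2)"

text \<open>\<open>poisson_pairing u z\<close> is \<open>\<langle>u, P\<^sub>r(\<theta> - \<cdot>)\<rangle>\<close> for \<open>z = r e\<^sup>i\<^sup>\<theta>\<close>.\<close>

definition poisson_pairing :: "circle_dist \<Rightarrow> complex \<Rightarrow> complex" where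
  "poisson_pairing u z = u (\<lambda>t. of_real (poisson (cmod z) (Arg z - t)))"

definition I_const :: "circle_dist \<Rightarrow> complex" where
  "I_const u = \<i> / (2 * of_real pi) * dist_Im u (\<lambda>_. 1)"

section \<open>The operator \<open>\<partial>/\<partial>z\<^sup>* - A\<close> and smoothness up to the boundary\<close>

text \<open>\<open>\<partial>w/\<partial>z\<^sup>* = (w\<^sub>x + \<i> w\<^sub>y) / 2\<close>, with real partial derivatives.\<close>

definition dbar :: "(complex \<Rightarrow> complex) \<Rightarrow> complex \<Rightarrow> complex" where
  "dbar w z = (frechet_derivative w (at z) 1 + \<i> * frechet_derivative w (at z) \<i>) / 2"

definition dbar_minus :: "(complex \<Rightarrow> complex) \<Rightarrow> (complex \<Rightarrow> complex) \<Rightarrow> complex \<Rightarrow> complex" where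
  "dbar_minus A w = (\<lambda>z. dbar w z - A z * w z)"

text \<open>Iterated real derivatives; the directions \<open>1\<close> and \<open>\<i>\<close> give \<open>\<partial>/\<partial>x\<close> and \<open>\<partial>/\<partial>y\<close>.\<close>

primrec dir_derivs :: "complex list \<Rightarrow> (complex \<Rightarrow> complex) \<Rightarrow> complex \<Rightarrow> complex" where
  "dir_derivs [] f = f"
| "dir_derivs (v # vs) f = (\<lambda>z. frechet_derivative (dir_derivs vs f) (at z) v)"

text \<open>
  \<open>C\<^sup>\<infinity>\<close> on the closed unit disk: smooth inside, with all partial derivatives extending
  continuously to the closed disk.
\<close>

definition smooth_closed_disk :: "(complex \<Rightarrow> complex) \<Rightarrow> bool" where
  "smooth_closed_disk A \<longleftrightarrow> continuous_on (cball 0 1) A \<and>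
     (\<forall>vs. set vs \<subseteq> {1, \<i>} \<longrightarrow>
        (\<forall>z\<in>ball 0 1. dir_derivs vs A differentiable (at z)) \<and>
        (\<exists>g. continuous_on (cball 0 1) g \<and> (\<forall>z\<in>ball 0 1. g z = dir_derivs vs A z)))"

section \<open>The function \<open>\<psi>\<close>\<close>

definition psi :: "(complex \<Rightarrow> complex) \<Rightarrow> complex \<Rightarrow> complex" where
  "psi A z = - (1 / (2 * of_real pi)) *
     (LINT \<zeta>:ball 0 1|lborel.
        A \<zeta> / \<zeta> * ((\<zeta> + z) / (\<zeta> - z)) +
        cnj (A \<zeta>) / cnj \<zeta> * ((1 + z * cnj \<zeta>) / (1 - z * cnj \<zeta>)))"

text \<open>Extension of a function on the disk by its limits at the boundary points.\<close>

definition disk_ext :: "(complex \<Rightarrow> complex) \<Rightarrow> complex \<Rightarrow> complex" where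
  "disk_ext f z = (if z \<in> ball 0 1 then f z else Lim (at z within ball 0 1) f)"

end

theory Submission
  imports Defs
begin

text \<open>
  The Poisson integral of \<open>bv h\<close> is \<open>2 \<pi> h\<close>, so each \<open>f k\<close> is a polynomial in \<open>z\<^sup>*\<close> with
  holomorphic coefficients, and the interior equations follow from the product rule. The
  kernel of \<open>\<psi>\<close> splits into a Cauchy kernel and its reflection at the circle, whence
  \<open>\<partial>\<psi>/\<partial>z\<^sup>* = A\<close> with \<open>\<psi>\<close> continuous on the closed disk. Since the disk is invariant under rotations,
  angular derivatives of \<open>\<psi>\<close> can be moved onto \<open>A\<close>, so they are all bounded up to the boundary.
  For \<open>h\<close> in \<open>Hb\<close> the Taylor coefficients grow at most polynomially; together with
  the rapid decay of Fourier coefficients, Tannery's theorem allows \<open>h\<close> to be paired with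
  test functions that depend smoothly on the radius, in particular with \<open>exp \<psi>\<close> times a test function.
\<close>

section \<open>Rotations and planar Lebesgue measure\<close>

text \<open>On the circle of radius r, pairing \<open>exp (psi A) * f\<close> with a fixed test
  function means pairing \<open>f\<close> with a test function that moves with r, and convergence
  against each fixed test function does not by itself give such a limit. Boundary values are
  therefore carried in the stronger form \<open>has_bv_dist\<close>, tested against whole families;
  the uniformity this needs is supplied once, for \<open>Hb\<close>, by the growth bound on Taylor
  coefficients. Only angular derivatives have to be bounded, since the integrals run over circles;
  in the radius pointwise convergence is enough. So \<open>psi A\<close> is differentiated along
  circles only, and in the radius just its continuity up to the circle is used.

  The problem for \<open>w\<close> reduces to the one for \<open>f\<close>:
  \<open>exp (psi A)\<close> is annihilated by \<open>dbar_minus A\<close>, so each application of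
  that operator to \<open>exp (psi A) * f k\<close> merely replaces \<open>f k\<close> by
  \<open>f (k - 1)\<close>. The constants are arranged around the origin: \<open>I_const\<close>
  removes the imaginary part of the data there, the powers of \<open>cnj z\<close> vanish there, and
  the reflected part of the kernel makes \<open>psi A 0\<close> real.\<close>

no_notation fps_nth (infixl "$" 75)

text \<open>Lebesgue measure is determined by its values on boxes, and identifying a pair of
  coordinates with a complex number turns boxes into boxes. This carries the invariance under
  orthogonal maps from coordinate vectors to the complex plane.\<close>

lemma lborel_distr_vec_to_complex:
  "distr (lborel :: (real^2) measure) borel (\<lambda>v. Complex (v$1) (v$2)) = (lborel :: complex measure)"
proof (rule lborel_eqI[symmetric])
  have [measurable]: "(\<lambda>v::real^2. Complex (v$1) (v$2)) \<in> borel_measurable borel"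
    by (intro borel_measurable_continuous_onI continuous_on_Complex continuous_intros)
  fix l u :: complex assume le: "\<And>b. b \<in> Basis \<Longrightarrow> l \<bullet> b \<le> u \<bullet> b"
  have "(\<lambda>v::real^2. Complex (v$1) (v$2)) -` box l u
      = box (vector [Re l, Im l]) (vector [Re u, Im u])"
    by (auto simp: in_box_complex_iff mem_box_cart forall_2)
  moreover have B: "(Basis :: (real^2) set) = {axis 1 1, axis 2 1}"
    by (auto simp: Basis_vec_def UNIV_2)
  moreover have "(axis 1 1 :: real^2) \<noteq> axis 2 1"
    by (simp add: axis_eq_axis)
  moreover have "Re l \<le> Re u" "Im l \<le> Im u"
    using le[of 1] le[of \<i>] by (auto simp: Basis_complex_def)
  ultimately show "emeasure (distr lborel borel (\<lambda>v::real^2. Complex (v$1) (v$2))) (box l u)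
      = ennreal (\<Prod>b\<in>Basis. (u - l) \<bullet> b)"
    by (simp add: emeasure_distr emeasure_lborel_box_eq inner_axis Basis_complex_def B)
qed simp

text \<open>The preimage of a box is its image under the inverse map, which is again orthogonal and
  so preserves Lebesgue measure.\<close>

lemma lborel_distr_orthogonal:
  fixes f :: "real^'n::{finite,wellorder} \<Rightarrow> real^'n::_"
  assumes f: "orthogonal_transformation f"
  shows "distr lborel borel f = lborel"
proof (rule lborel_eqI[symmetric])
  have [measurable]: "f \<in> borel_measurable borel"
    by (intro borel_measurable_continuous_onI linear_continuous_on linear_conv_bounded_linear[THEN iffD1]
        orthogonal_transformation_linear f)
  fix l u :: "real^'n::_" assume le: "\<And>b. b \<in> Basis \<Longrightarrow> l \<bullet> b \<le> u \<bullet> b"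
  have bij: "bij f" by (rule orthogonal_transformation_bij[OF f])
  have inv: "orthogonal_transformation (inv f)"
    using f by (rule orthogonal_transformation_inv)
  have eq: "f -` box l u = inv f ` box l u"
    using bij by (simp add: bij_vimage_eq_inv_image)
  have lm: "box l u \<in> lmeasurable" by simp
  have m: "f -` box l u \<in> sets borel" using measurable_sets[of f borel borel "box l u"] by simp
  have "emeasure lborel (f -` box l u) = emeasure lebesgue (f -` box l u)"
    using m by simp
  also have "\<dots> = ennreal (measure lebesgue (box l u))"
    using measurable_orthogonal_image[OF inv lm] measure_orthogonal_image[OF inv lm] eq
    by (simp add: emeasure_eq_measure2)
  also have "\<dots> = ennreal (\<Prod>b\<in>Basis. (u - l) \<bullet> b)"
    using le by (simp add: measure_lborel_box_eq)
  finally show "emeasure (distr lborel borel f) (box l u) = ennreal (\<Prod>b\<in>Basis. (u - l) \<bullet> b)"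
    by (simp add: emeasure_distr)
qed simp

lemma lborel_distr_rotation:
  "distr lborel borel ((*) (cis t)) = (lborel :: complex measure)"
proof -
  define C where "C = (\<lambda>v::real^2. Complex (v$1) (v$2))"
  define R where "R = (\<lambda>v::real^2. vector [cos t * v$1 - sin t * v$2, sin t * v$1 + cos t * v$2] :: real^2)"
  have [measurable]: "C \<in> borel_measurable borel" unfolding C_def
    by (intro borel_measurable_continuous_onI continuous_on_Complex continuous_intros)
  have lin: "linear R"
    by (rule linearI) (auto simp: R_def vec_eq_iff forall_2 algebra_simps)
  have "R v \<bullet> R w = v \<bullet> w" for v w
  proof -
    have "R v \<bullet> R w = ((cos t)\<^sup>2 + (sin t)\<^sup>2) * (v \<bullet> w)"
      unfolding R_def inner_vec_def sum_2 by (simp only: vector_2) (simp add: algebra_simps power2_eq_square del: sin_cos_squared_add sin_cos_squared_add2 sin_cos_squared_add3)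
    then show ?thesis by simp
  qed
  then have "orthogonal_transformation R"
    using lin by (simp add: orthogonal_transformation_def)
  then have R: "distr lborel borel R = lborel" by (rule lborel_distr_orthogonal)
  have [measurable]: "R \<in> borel_measurable borel"
    using lin by (intro borel_measurable_continuous_onI linear_continuous_on linear_conv_bounded_linear[THEN iffD1])
  have CR: "((*) (cis t)) \<circ> C = C \<circ> R"
    by (auto simp: C_def R_def complex_eq_iff)
  have "distr lborel borel ((*) (cis t)) = distr (distr lborel borel C) borel ((*) (cis t))"
    unfolding C_def lborel_distr_vec_to_complex ..
  also have "\<dots> = distr (distr lborel borel R) borel C"
    by (simp add: distr_distr CR)
  also have "\<dots> = lborel" by (simp only: R) (simp add: C_def lborel_distr_vec_to_complex)
  finally show ?thesis .
qed

lemma integral_rotation: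
  fixes F :: "complex \<Rightarrow> 'a::{banach, second_countable_topology}"
  assumes [measurable]: "F \<in> borel_measurable borel"
  shows "(LINT x|lborel. F (cis t * x)) = (LINT x|lborel. F x)"
proof -
  have "(LINT x|lborel. F x) = integral\<^sup>L (distr lborel borel ((*) (cis t))) F"
    by (simp add: lborel_distr_rotation)
  then show ?thesis by (simp add: integral_distr)
qed

section \<open>Weakly singular area integrals\<close>

lemma emeasure_ball_complex:
  "r \<ge> 0 \<Longrightarrow> emeasure lborel (ball (z::complex) r) = ennreal (pi * r\<^sup>2)"
  by (simp add: emeasure_ball unit_ball_vol_2)

lemma ball_indicator_measurable [measurable]:
  fixes z :: "'a::metric_space"
  shows "indicator (ball z R) \<in> borel_measurable borel"
  by (intro borel_measurable_indicator) simp

lemma inverse_dist_measurable [measurable]: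
  fixes z :: complex
  shows "(\<lambda>\<zeta>. ennreal (1 / cmod (\<zeta> - z))) \<in> borel_measurable borel"
proof -
  have [measurable]: "(\<lambda>\<zeta>. cmod (\<zeta> - z)) \<in> borel_measurable borel"
    by (intro borel_measurable_continuous_onI continuous_intros)
  show ?thesis by measurable
qed

text \<open>Dyadic rings: where the distance to \<open>z\<close> lies between
  \<open>R / 2 ^ Suc n\<close> and \<open>R / 2 ^ n\<close>, the integrand is at most
  \<open>2 ^ Suc n / R\<close>, while the enclosing disk has area
  \<open>pi * (R / 2 ^ n)\<^sup>2\<close>. The products form a geometric series. That the bound
  shrinks with \<open>R\<close>, uniformly in \<open>z\<close>, later controls the diagonal.\<close>

lemma nn_integral_inverse_dist_le:
  assumes "R > 0"
  shows "(\<integral>\<^sup>+\<zeta>. indicator (ball z R) \<zeta> * ennreal (1 / cmod (\<zeta> - z)) \<partial>lborel) \<le> ennreal (4 * pi * R)"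
proof -
  have *: "indicator (ball z R) \<zeta> * ennreal (1 / cmod (\<zeta> - z))
      \<le> (\<Sum>n. ennreal (2 ^ Suc n / R) * indicator (ball z (R / 2 ^ n)) \<zeta>)" for \<zeta>
  proof (cases "\<zeta> \<in> ball z R \<and> \<zeta> \<noteq> z")
    case True
    define d where "d = cmod (\<zeta> - z)"
    have d: "0 < d" "d < R" using True by (auto simp: d_def dist_norm norm_minus_commute)
    obtain m where "R / d < 2 ^ m" using real_arch_pow[of 2 "R / d"] by auto
    then have "R / 2 ^ Suc m \<le> d"
      using d assms by (simp add: field_simps)
    then have ex: "\<exists>m. R / 2 ^ Suc m \<le> d" by blast
    define n where "n = (LEAST m. R / 2 ^ Suc m \<le> d)"
    have n1: "R / 2 ^ Suc n \<le> d" unfolding n_def by (rule LeastI_ex[OF ex])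
    have n2: "d < R / 2 ^ n"
    proof (cases n)
      case 0 then show ?thesis using d by simp
    next
      case (Suc k)
      then have "\<not> R / 2 ^ Suc k \<le> d" using not_less_Least[of k "\<lambda>m. R / 2 ^ Suc m \<le> d"] n_def by simp
      then show ?thesis using Suc by simp
    qed
    have "indicator (ball z R) \<zeta> * ennreal (1 / cmod (\<zeta> - z)) = ennreal (1 / d)"
      using True by (simp add: d_def)
    also have "\<dots> \<le> ennreal (2 ^ Suc n / R)"
      using n1 d assms by (intro ennreal_leI) (simp add: field_simps)
    also have "\<dots> = (\<Sum>n\<in>{n}. ennreal (2 ^ Suc n / R) * indicator (ball z (R / 2 ^ n)) \<zeta>)"
      using n2 by (simp add: d_def dist_norm norm_minus_commute)
    also have "\<dots> \<le> (\<Sum>n. ennreal (2 ^ Suc n / R) * indicator (ball z (R / 2 ^ n)) \<zeta>)"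
      by (intro sum_le_suminf) auto
    finally show ?thesis .
  qed auto
  have "(\<integral>\<^sup>+\<zeta>. indicator (ball z R) \<zeta> * ennreal (1 / cmod (\<zeta> - z)) \<partial>lborel)
      \<le> (\<integral>\<^sup>+\<zeta>. (\<Sum>n. ennreal (2 ^ Suc n / R) * indicator (ball z (R / 2 ^ n)) \<zeta>) \<partial>lborel)"
    by (intro nn_integral_mono *)
  also have "\<dots> = (\<Sum>n. \<integral>\<^sup>+\<zeta>. ennreal (2 ^ Suc n / R) * indicator (ball z (R / 2 ^ n)) \<zeta> \<partial>lborel)"
    by (intro nn_integral_suminf) simp
  also have "\<dots> = (\<Sum>n. ennreal (2 * pi * R * (1 / 2) ^ n))"
  proof (intro suminf_cong)
    fix n
    have "(\<integral>\<^sup>+\<zeta>. ennreal (2 ^ Suc n / R) * indicator (ball z (R / 2 ^ n)) \<zeta> \<partial>lborel)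
       = ennreal (2 ^ Suc n / R) * ennreal (pi * (R / 2 ^ n)\<^sup>2)"
      using assms by (subst nn_integral_cmult_indicator) (auto simp: emeasure_ball_complex)
    also have "\<dots> = ennreal (2 ^ Suc n / R * (pi * (R / 2 ^ n)\<^sup>2))"
      using assms by (intro ennreal_mult[symmetric]) auto
    also have "2 ^ Suc n / R * (pi * (R / 2 ^ n)\<^sup>2) = 2 * pi * R * (1 / 2) ^ n"
      using assms by (simp add: field_simps power2_eq_square)
    finally show "(\<integral>\<^sup>+\<zeta>. ennreal (2 ^ Suc n / R) * indicator (ball z (R / 2 ^ n)) \<zeta> \<partial>lborel)
       = ennreal (2 * pi * R * (1 / 2) ^ n)" .
  qed
  also have "\<dots> = ennreal (4 * pi * R)"
  proof (rule suminf_ennreal_eq)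
    have "(\<lambda>n. 2 * pi * R * (1 / 2) ^ n) sums (2 * pi * R * (1 / (1 - 1 / 2)))"
      by (intro sums_mult geometric_sums) simp
    then show "(\<lambda>n. 2 * pi * R * (1 / 2) ^ n) sums (4 * pi * R)" by (simp add: mult.assoc)
  qed (use assms in auto)
  finally show ?thesis .
qed

lemma integrable_weakly_singular:
  assumes [measurable]: "p \<in> borel_measurable borel"
    and p: "\<And>\<zeta>. \<zeta> \<noteq> z \<Longrightarrow> cmod (p \<zeta>) \<le> C * indicator (ball 0 1) \<zeta> / cmod (\<zeta> - z)" and "C \<ge> 0"
  shows "integrable lborel p"
proof (rule integrableI_bounded)
  \<comment> \<open>The unit disk lies in the disk of this radius about \<open>z\<close>.\<close>
  define R where "R = 1 + cmod z"
  have R: "R > 0" by (simp add: R_def add_pos_nonneg)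
  have "(\<integral>\<^sup>+\<zeta>. ennreal (norm (p \<zeta>)) \<partial>lborel)
      \<le> (\<integral>\<^sup>+\<zeta>. ennreal C * (indicator (ball z R) \<zeta> * ennreal (1 / cmod (\<zeta> - z))) \<partial>lborel)"
  proof (rule nn_integral_mono_AE)
    show "AE \<zeta> in lborel. ennreal (norm (p \<zeta>))
      \<le> ennreal C * (indicator (ball z R) \<zeta> * ennreal (1 / cmod (\<zeta> - z)))"
      using AE_lborel_singleton[of z]
    proof eventually_elim
      fix \<zeta> assume \<zeta>: "\<zeta> \<noteq> z"
      have "\<zeta> \<in> ball z R" if "\<zeta> \<in> ball 0 1"
        using that norm_triangle_ineq4[of z \<zeta>] by (simp add: R_def dist_norm)
      then show "ennreal (norm (p \<zeta>)) \<le> ennreal C * (indicator (ball z R) \<zeta> * ennreal (1 / cmod (\<zeta> - z)))"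
        using p[OF \<zeta>] \<open>C \<ge> 0\<close>
        by (cases "\<zeta> \<in> ball 0 1") (auto simp: ennreal_mult[symmetric] intro!: ennreal_leI)
    qed
  qed
  also have "\<dots> = ennreal C * (\<integral>\<^sup>+\<zeta>. indicator (ball z R) \<zeta> * ennreal (1 / cmod (\<zeta> - z)) \<partial>lborel)"
    by (intro nn_integral_cmult) simp
  also have "\<dots> \<le> ennreal C * ennreal (4 * pi * R)"
    by (intro mult_left_mono nn_integral_inverse_dist_le R) auto
  also have "\<dots> < \<infinity>" by (simp add: ennreal_mult_less_top)
  finally show "(\<integral>\<^sup>+\<zeta>. ennreal (norm (p \<zeta>)) \<partial>lborel) < \<infinity>" .
qed simp

text \<open>The kernel is damped near the diagonal; the damped integrals are continuous by dominated
  convergence and converge uniformly.\<close>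

lemma continuous_on_weakly_singular:
  fixes p :: "complex \<Rightarrow> complex \<Rightarrow> complex"
  assumes meas: "\<And>z. z \<in> Z \<Longrightarrow> p z \<in> borel_measurable borel"
    and p: "\<And>z \<zeta>. z \<in> Z \<Longrightarrow> \<zeta> \<noteq> z \<Longrightarrow> cmod (p z \<zeta>) \<le> C * indicator (ball 0 1) \<zeta> / cmod (\<zeta> - z)"
    and cont: "\<And>z \<zeta>. z \<in> Z \<Longrightarrow> \<zeta> \<noteq> z \<Longrightarrow> ((\<lambda>z'. p z' \<zeta>) \<longlongrightarrow> p z \<zeta>) (at z within Z)"
    and C: "C \<ge> 0"
  shows "continuous_on Z (\<lambda>z. LINT \<zeta>|lborel. p z \<zeta>)"
proof -
  define d where "d = (\<lambda>n. 1 / real (Suc n))"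
  define s where "s = (\<lambda>n z \<zeta>. p z \<zeta> * of_real (min 1 (cmod (\<zeta> - z) / d n)))"
  have d: "d n > 0" for n by (simp add: d_def)
  have smeas: "s n z \<in> borel_measurable borel" if "z \<in> Z" for n z
    using meas[OF that] unfolding s_def by measurable
  have sp: "cmod (s n z \<zeta>) \<le> C * indicator (ball 0 1) \<zeta> / cmod (\<zeta> - z)" if "z \<in> Z" "\<zeta> \<noteq> z" for n z \<zeta>
  proof -
    have "cmod (s n z \<zeta>) \<le> cmod (p z \<zeta>) * 1"
      unfolding s_def norm_mult using d[of n] by (intro mult_left_mono) auto
    then show ?thesis using p[OF that] by simp
  qed
  \<comment> \<open>The factor \<open>cmod (\<zeta> - z) / d n\<close> cancels the singularity, so
    for fixed \<open>n\<close> there is a bound independent of \<open>z\<close>, as dominated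
    convergence along a sequence of points requires.\<close>
  have sb: "cmod (s n z \<zeta>) \<le> C / d n * indicator (ball 0 1) \<zeta>" if "z \<in> Z" for n z \<zeta>
  proof (cases "\<zeta> = z")
    case False
    have "cmod (s n z \<zeta>) \<le> (C * indicator (ball 0 1) \<zeta> / cmod (\<zeta> - z)) * (cmod (\<zeta> - z) / d n)"
      unfolding s_def norm_mult using d[of n] C by (intro mult_mono p that False) auto
    then show ?thesis using False by simp
  qed (use d[of n] C in \<open>simp add: s_def\<close>)
  have intp: "integrable lborel (p z)" if "z \<in> Z" for z
    by (rule integrable_weakly_singular[OF meas[OF that] p C]) (use that in auto)
  have ints: "integrable lborel (s n z)" if "z \<in> Z" for n z
    by (rule integrable_weakly_singular[OF smeas[OF that] sp C]) (use that in auto)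
  have cs: "continuous_on Z (\<lambda>z. LINT \<zeta>|lborel. s n z \<zeta>)" for n
    unfolding continuous_on_sequentially comp_def
  proof (intro allI ballI impI)
    fix x a assume a: "a \<in> Z" and x: "(\<forall>i. x i \<in> Z) \<and> x \<longlonglongrightarrow> a"
    show "(\<lambda>i. LINT \<zeta>|lborel. s n (x i) \<zeta>) \<longlonglongrightarrow> (LINT \<zeta>|lborel. s n a \<zeta>)"
    proof (rule integral_dominated_convergence)
      show "integrable lborel (\<lambda>\<zeta>. C / d n * indicator (ball (0::complex) 1) \<zeta>)"
        by (intro integrable_mult_right integrable_real_indicator) (auto simp: emeasure_ball_complex)
      show "AE \<zeta> in lborel. (\<lambda>i. s n (x i) \<zeta>) \<longlonglongrightarrow> s n a \<zeta>"
        using AE_lborel_singleton[of a]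
      proof eventually_elim
        fix \<zeta> assume \<zeta>: "\<zeta> \<noteq> a"
        have "continuous (at a within Z) (\<lambda>z'. p z' \<zeta>)"
          using cont[OF a \<zeta>] by (simp add: continuous_within)
        then have "(\<lambda>i. p (x i) \<zeta>) \<longlonglongrightarrow> p a \<zeta>"
          using x by (auto simp: continuous_within_sequentially comp_def)
        then show "(\<lambda>i. s n (x i) \<zeta>) \<longlonglongrightarrow> s n a \<zeta>"
          unfolding s_def using x d[of n] by (intro tendsto_intros) auto
      qed
    qed (use smeas a x sb in auto)
  qed
  \<comment> \<open>Damping changes the integrand only inside the disk of radius \<open>d n\<close>
    about \<open>z\<close>, where the kernel has mass of order \<open>d n\<close>, whatever
    \<open>z\<close> is.\<close>
  have bound: "cmod ((LINT \<zeta>|lborel. s n z \<zeta>) - (LINT \<zeta>|lborel. p z \<zeta>)) \<le> C * (4 * pi * d n)"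
    if z: "z \<in> Z" for n z
  proof -
    have "ennreal (cmod ((LINT \<zeta>|lborel. s n z \<zeta>) - (LINT \<zeta>|lborel. p z \<zeta>)))
        = ennreal (cmod (LINT \<zeta>|lborel. s n z \<zeta> - p z \<zeta>))"
      using ints[OF z] intp[OF z] by simp
    also have "\<dots> \<le> (\<integral>\<^sup>+\<zeta>. ennreal (norm (s n z \<zeta> - p z \<zeta>)) \<partial>lborel)"
      using ints[OF z] intp[OF z] by (intro integral_norm_bound_ennreal) auto
    also have "\<dots> \<le> (\<integral>\<^sup>+\<zeta>. ennreal C * (indicator (ball z (d n)) \<zeta> * ennreal (1 / cmod (\<zeta> - z))) \<partial>lborel)"
    proof (rule nn_integral_mono_AE)
      show "AE \<zeta> in lborel. ennreal (norm (s n z \<zeta> - p z \<zeta>))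
        \<le> ennreal C * (indicator (ball z (d n)) \<zeta> * ennreal (1 / cmod (\<zeta> - z)))"
        using AE_lborel_singleton[of z]
      proof eventually_elim
        fix \<zeta> assume \<zeta>: "\<zeta> \<noteq> z"
        define m where "m = min 1 (cmod (\<zeta> - z) / d n)"
        have "s n z \<zeta> - p z \<zeta> = - (p z \<zeta> * of_real (1 - m))" by (simp add: s_def m_def algebra_simps)
        then have eq: "norm (s n z \<zeta> - p z \<zeta>) = cmod (p z \<zeta>) * \<bar>1 - m\<bar>"
          by (simp only: norm_minus_cancel norm_mult norm_of_real)
        have m: "0 \<le> m" "m \<le> 1" using d[of n] by (auto simp: m_def)
        have "norm (s n z \<zeta> - p z \<zeta>) \<le> C / cmod (\<zeta> - z)"
        proof -
          have "norm (s n z \<zeta> - p z \<zeta>) \<le> (C * indicator (ball 0 1) \<zeta> / cmod (\<zeta> - z)) * 1"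
            unfolding eq using m C by (intro mult_mono p z \<zeta>) auto
          also have "\<dots> \<le> C / cmod (\<zeta> - z)"
            using C by (auto simp: indicator_def)
          finally show ?thesis .
        qed
        moreover have "s n z \<zeta> - p z \<zeta> = 0" if "\<zeta> \<notin> ball z (d n)"
          using that d[of n] by (simp add: s_def dist_norm norm_minus_commute field_simps min_def)
        ultimately show "ennreal (norm (s n z \<zeta> - p z \<zeta>))
            \<le> ennreal C * (indicator (ball z (d n)) \<zeta> * ennreal (1 / cmod (\<zeta> - z)))"
          using C by (cases "\<zeta> \<in> ball z (d n)") (auto simp: ennreal_mult[symmetric] intro!: ennreal_leI)
      qed
    qed
    also have "\<dots> = ennreal C * (\<integral>\<^sup>+\<zeta>. indicator (ball z (d n)) \<zeta> * ennreal (1 / cmod (\<zeta> - z)) \<partial>lborel)"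
      by (intro nn_integral_cmult) simp
    also have "\<dots> \<le> ennreal C * ennreal (4 * pi * d n)"
      by (intro mult_left_mono nn_integral_inverse_dist_le d) auto
    also have "\<dots> = ennreal (C * (4 * pi * d n))"
      using C d[of n] by (intro ennreal_mult[symmetric]) auto
    finally show ?thesis using C d[of n] by (subst (asm) ennreal_le_iff) auto
  qed
  have "uniform_limit Z (\<lambda>n z. LINT \<zeta>|lborel. s n z \<zeta>) (\<lambda>z. LINT \<zeta>|lborel. p z \<zeta>) sequentially"
  proof (rule uniform_limitI)
    fix e :: real assume e: "e > 0"
    have "(\<lambda>n. C * (4 * pi * d n)) \<longlonglongrightarrow> C * (4 * pi * 0)"
      unfolding d_def by (intro tendsto_intros LIMSEQ_inverse_real_of_nat[unfolded inverse_eq_divide])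
    then have "\<forall>\<^sub>F n in sequentially. C * (4 * pi * d n) < e"
      using e by (intro order_tendstoD(2)[where y = "C * (4 * pi * 0)"]) auto
    then show "\<forall>\<^sub>F n in sequentially. \<forall>z\<in>Z. dist (LINT \<zeta>|lborel. s n z \<zeta>) (LINT \<zeta>|lborel. p z \<zeta>) < e"
      by eventually_elim (auto simp: dist_norm intro: le_less_trans[OF bound])
  qed
  then show ?thesis
    by (rule uniform_limit_theorem[rotated]) (auto simp: cs)
qed

section \<open>The Cauchy transform\<close>

text \<open>The cut-off to the disk belongs to the density, so that the transforms below integrate
  over the whole plane and a rotation does not change the domain.\<close>

definition disk_bdd :: "(complex \<Rightarrow> complex) \<Rightarrow> bool" where
  "disk_bdd q \<longleftrightarrow> q \<in> borel_measurable borel \<and> (\<exists>M\<ge>0. \<forall>\<zeta>. cmod (q \<zeta>) \<le> M * indicator (ball 0 1) \<zeta>)"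

definition cauchy_T :: "(complex \<Rightarrow> complex) \<Rightarrow> complex \<Rightarrow> complex" where
  "cauchy_T q z = (LINT \<zeta>|lborel. q \<zeta> / (\<zeta> - z))"

text \<open>For \<open>\<zeta> \<noteq> 0\<close> this is, up to a factor free of \<open>z\<close>,
  the Cauchy kernel with its pole at \<open>1 / cnj \<zeta>\<close>, the mirror image of
  \<open>\<zeta>\<close> in the unit circle. For \<open>\<zeta>\<close> in the open disk that pole
  lies outside the closed disk.\<close>

definition cauchy_S :: "(complex \<Rightarrow> complex) \<Rightarrow> complex \<Rightarrow> complex" where
  "cauchy_S q z = (LINT \<zeta>|lborel. q \<zeta> / (1 - z * cnj \<zeta>))"

lemma disk_bdd_measurable: "disk_bdd q \<Longrightarrow> q \<in> borel_measurable borel"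
  by (simp add: disk_bdd_def)

lemma disk_bddE:
  assumes "disk_bdd q"
  obtains M where "M \<ge> 0" "\<And>\<zeta>. cmod (q \<zeta>) \<le> M * indicator (ball 0 1) \<zeta>"
  using assms by (auto simp: disk_bdd_def)

lemma disk_bddI:
  assumes "q \<in> borel_measurable borel" "\<And>\<zeta>. \<zeta> \<in> ball 0 1 \<Longrightarrow> cmod (q \<zeta>) \<le> M"
    "\<And>\<zeta>. \<zeta> \<notin> ball 0 1 \<Longrightarrow> q \<zeta> = 0"
  shows "disk_bdd q"
  unfolding disk_bdd_def
proof (intro conjI assms(1) exI[of _ "\<bar>M\<bar>"] allI)
  fix \<zeta> show "cmod (q \<zeta>) \<le> \<bar>M\<bar> * indicator (ball 0 1) \<zeta>"
    using assms(2,3)[of \<zeta>] by (cases "\<zeta> \<in> ball 0 1") auto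
qed simp

lemma disk_bdd_eq_0: "disk_bdd q \<Longrightarrow> \<zeta> \<notin> ball 0 1 \<Longrightarrow> q \<zeta> = 0"
  by (erule disk_bddE) (metis indicator_simps(2) mult_zero_right norm_le_zero_iff)

text \<open>The difference of the squares factors as
  \<open>(1 - (cmod z)\<^sup>2) * (1 - (cmod \<zeta>)\<^sup>2)\<close>. So the reflected kernel is
  dominated by the Cauchy kernel even for \<open>z\<close> on the circle, and one theory of weak
  singularities covers both.\<close>

lemma cmod_diff_le_cmod_one_minus:
  assumes "cmod z \<le> 1" "cmod \<zeta> \<le> 1"
  shows "cmod (\<zeta> - z) \<le> cmod (1 - z * cnj \<zeta>)"
proof -
  have "(cmod (1 - z * cnj \<zeta>))\<^sup>2 - (cmod (\<zeta> - z))\<^sup>2 = (1 - (cmod z)\<^sup>2) * (1 - (cmod \<zeta>)\<^sup>2)"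
    unfolding cmod_power2 by (simp add: power2_eq_square algebra_simps)
  moreover have "0 \<le> (1 - (cmod z)\<^sup>2) * (1 - (cmod \<zeta>)\<^sup>2)"
    using assms by (intro mult_nonneg_nonneg) (auto simp: power_le_one)
  ultimately have "(cmod (\<zeta> - z))\<^sup>2 \<le> (cmod (1 - z * cnj \<zeta>))\<^sup>2" by linarith
  then show ?thesis by (rule power2_le_imp_le) simp
qed

lemma cauchy_T_bound:
  assumes "\<And>\<zeta>. cmod (q \<zeta>) \<le> M * indicator (ball 0 1) \<zeta>"
  shows "cmod (q \<zeta> / (\<zeta> - z)) \<le> M * indicator (ball 0 1) \<zeta> / cmod (\<zeta> - z)"
  unfolding norm_divide by (intro divide_right_mono assms) simp

lemma cauchy_T_integrable:
  assumes "disk_bdd q"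
  shows "integrable lborel (\<lambda>\<zeta>. q \<zeta> / (\<zeta> - z))"
proof -
  note [measurable] = disk_bdd_measurable[OF assms]
  obtain M where M: "M \<ge> 0" "\<And>\<zeta>. cmod (q \<zeta>) \<le> M * indicator (ball 0 1) \<zeta>"
    using assms by (rule disk_bddE) blast
  show ?thesis
    by (rule integrable_weakly_singular[OF _ cauchy_T_bound[OF M(2)] M(1)]) measurable
qed

lemma continuous_on_cauchy_T:
  assumes "disk_bdd q"
  shows "continuous_on A (cauchy_T q)"
proof -
  note [measurable] = disk_bdd_measurable[OF assms]
  obtain M where M: "M \<ge> 0" "\<And>\<zeta>. cmod (q \<zeta>) \<le> M * indicator (ball 0 1) \<zeta>"
    using assms by (rule disk_bddE) blast
  show ?thesis unfolding cauchy_T_def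
    by (rule continuous_on_weakly_singular[OF _ cauchy_T_bound[OF M(2)] _ M(1)])
       (auto intro!: tendsto_intros)
qed

lemma cauchy_S_bound:
  assumes "\<And>\<zeta>. cmod (q \<zeta>) \<le> M * indicator (ball 0 1) \<zeta>" "M \<ge> 0" "cmod z \<le> 1" "\<zeta> \<noteq> z"
  shows "cmod (q \<zeta> / (1 - z * cnj \<zeta>)) \<le> M * indicator (ball 0 1) \<zeta> / cmod (\<zeta> - z)"
proof (cases "\<zeta> \<in> ball 0 1")
  case True
  then have le: "cmod (\<zeta> - z) \<le> cmod (1 - z * cnj \<zeta>)"
    using assms by (intro cmod_diff_le_cmod_one_minus) auto
  have pos: "0 < cmod (\<zeta> - z)" using assms by simp
  have "cmod (q \<zeta> / (1 - z * cnj \<zeta>)) \<le> M / cmod (1 - z * cnj \<zeta>)"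
    using assms(1)[of \<zeta>] True by (simp add: norm_divide divide_right_mono)
  also have "\<dots> \<le> M / cmod (\<zeta> - z)"
    using le pos assms(2) by (intro divide_left_mono) (auto intro!: mult_pos_pos less_le_trans[OF pos le])
  finally show ?thesis using True by simp
next
  case False
  then show ?thesis using assms(1)[of \<zeta>] by simp
qed

lemma cauchy_S_integrand_measurable:
  assumes [measurable]: "q \<in> borel_measurable borel"
  shows "(\<lambda>\<zeta>. q \<zeta> / (1 - z * cnj \<zeta>)) \<in> borel_measurable borel"
proof -
  have [measurable]: "(\<lambda>\<zeta>. 1 - z * cnj \<zeta>) \<in> borel_measurable borel"
    by (intro borel_measurable_continuous_onI continuous_intros)
  show ?thesis by measurable
qed

lemma cauchy_S_integrable:
  assumes "disk_bdd q" "cmod z \<le> 1"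
  shows "integrable lborel (\<lambda>\<zeta>. q \<zeta> / (1 - z * cnj \<zeta>))"
proof -
  obtain M where M: "M \<ge> 0" "\<And>\<zeta>. cmod (q \<zeta>) \<le> M * indicator (ball 0 1) \<zeta>"
    using assms(1) by (rule disk_bddE) blast
  show ?thesis
    by (rule integrable_weakly_singular[OF _ cauchy_S_bound[OF M(2) M(1) assms(2)] M(1)])
       (use assms(1) in \<open>auto intro!: cauchy_S_integrand_measurable[OF disk_bdd_measurable]\<close>)
qed

lemma one_minus_mult_cnj_neq_0:
  assumes "cmod z \<le> 1" "cmod \<zeta> < 1"
  shows "1 - z * cnj \<zeta> \<noteq> 0"
proof
  assume "1 - z * cnj \<zeta> = 0"
  then have "z * cnj \<zeta> = 1" by simp
  then have "cmod z * cmod \<zeta> = 1" by (metis complex_mod_cnj norm_mult norm_one)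
  moreover have "cmod z * cmod \<zeta> \<le> 1 * cmod \<zeta>" using assms by (intro mult_right_mono) auto
  ultimately show False using assms by simp
qed

lemma continuous_on_cauchy_S:
  assumes "disk_bdd q"
  shows "continuous_on (cball 0 1) (cauchy_S q)"
proof -
  obtain M where M: "M \<ge> 0" "\<And>\<zeta>. cmod (q \<zeta>) \<le> M * indicator (ball 0 1) \<zeta>"
    using assms by (rule disk_bddE) blast
  show ?thesis unfolding cauchy_S_def
  proof (rule continuous_on_weakly_singular[OF _ cauchy_S_bound[OF M(2) M(1)] _ M(1)])
    fix z \<zeta> :: complex assume z: "z \<in> cball 0 1" "\<zeta> \<noteq> z"
    show "((\<lambda>z'. q \<zeta> / (1 - z' * cnj \<zeta>)) \<longlongrightarrow> q \<zeta> / (1 - z * cnj \<zeta>)) (at z within cball 0 1)"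
    proof (cases "\<zeta> \<in> ball 0 1")
      case True
      then show ?thesis using one_minus_mult_cnj_neq_0[of z \<zeta>] z by (auto intro!: tendsto_intros)
    next
      case False
      then show ?thesis by (simp add: disk_bdd_eq_0[OF assms])
    qed
  qed (use assms in \<open>auto intro!: cauchy_S_integrand_measurable[OF disk_bdd_measurable]\<close>)
qed

lemma kernel_difference:
  fixes a b q :: complex
  assumes "a \<noteq> 0" "b \<noteq> 0"
  shows "(b - a) * (q / b / a) = q / a - q / b"
  using assms by (simp add: field_simps)

text \<open>Subtracting two Cauchy kernels produces the product of two kernels, one of which
  is absorbed into the density.\<close>

lemma cauchy_T_has_field_derivative:
  assumes q: "disk_bdd q" and qz: "disk_bdd (\<lambda>\<zeta>. q \<zeta> / (\<zeta> - z))"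
  shows "(cauchy_T q has_field_derivative cauchy_T (\<lambda>\<zeta>. q \<zeta> / (\<zeta> - z)) z) (at z)"
  unfolding has_field_derivative_iff
proof -
  let ?p = "\<lambda>\<zeta>. q \<zeta> / (\<zeta> - z)"
  have eq: "(cauchy_T q y - cauchy_T q z) / (y - z) = cauchy_T ?p y" if "y \<noteq> z" for y
  proof -
    have "(y - z) * cauchy_T ?p y = (LINT \<zeta>|lborel. (y - z) * (?p \<zeta> / (\<zeta> - y)))"
      unfolding cauchy_T_def by (rule integral_mult_right_zero[symmetric])
    also have "\<dots> = (LINT \<zeta>|lborel. q \<zeta> / (\<zeta> - y) - q \<zeta> / (\<zeta> - z))"
    proof (rule integral_cong_AE)
      show "AE \<zeta> in lborel. (y - z) * (?p \<zeta> / (\<zeta> - y)) = q \<zeta> / (\<zeta> - y) - q \<zeta> / (\<zeta> - z)"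
        using AE_lborel_singleton[of y] AE_lborel_singleton[of z]
      proof eventually_elim
        fix \<zeta> assume "\<zeta> \<noteq> y" "\<zeta> \<noteq> z"
        then show "(y - z) * (?p \<zeta> / (\<zeta> - y)) = q \<zeta> / (\<zeta> - y) - q \<zeta> / (\<zeta> - z)"
          using kernel_difference[of "\<zeta> - y" "\<zeta> - z" "q \<zeta>"] by simp
      qed
    qed (use disk_bdd_measurable[OF q] in measurable)
    also have "\<dots> = cauchy_T q y - cauchy_T q z"
      unfolding cauchy_T_def by (intro Bochner_Integration.integral_diff cauchy_T_integrable q)
    finally show ?thesis using that by (simp add: field_simps)
  qed
  \<comment> \<open>The difference quotient is exactly the transform of the density
    \<open>?p\<close>, so the derivative exists by continuity of that transform.\<close>
  have "isCont (cauchy_T ?p) z"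
    using continuous_on_cauchy_T[OF qz, of UNIV] by (simp add: continuous_on_eq_continuous_at)
  then have "(cauchy_T ?p \<longlongrightarrow> cauchy_T ?p z) (at z)" by (simp add: isCont_def)
  then show "((\<lambda>y. (cauchy_T q y - cauchy_T q z) / (y - z)) \<longlongrightarrow> cauchy_T ?p z) (at z)"
    by (rule Lim_transform_eventually) (auto simp: eq eventually_at_filter)
qed

text \<open>Inside the open disk the reflected kernel is bounded by \<open>1 / (1 - cmod z)\<close>.
  Hence, unlike for the Cauchy kernel, the density that arises from the difference quotient is
  bounded for every bounded \<open>q\<close>.\<close>

lemma disk_bdd_div_one_minus:
  assumes q: "disk_bdd q" and z: "cmod z < 1"
  shows "disk_bdd (\<lambda>\<zeta>. q \<zeta> * cnj \<zeta> / (1 - z * cnj \<zeta>))"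
proof -
  obtain M where M: "M \<ge> 0" "\<And>\<zeta>. cmod (q \<zeta>) \<le> M * indicator (ball 0 1) \<zeta>"
    using q by (rule disk_bddE) blast
  note [measurable] = disk_bdd_measurable[OF q]
  show ?thesis
  proof (rule disk_bddI)
    have [measurable]: "cnj \<in> borel_measurable borel"
      by (intro borel_measurable_continuous_onI continuous_intros)
    show "(\<lambda>\<zeta>. q \<zeta> * cnj \<zeta> / (1 - z * cnj \<zeta>)) \<in> borel_measurable borel"
      by (rule cauchy_S_integrand_measurable) measurable
  next
    fix \<zeta> :: complex assume \<zeta>: "\<zeta> \<in> ball 0 1"
    have "1 - cmod z * 1 \<le> cmod 1 - cmod (z * cnj \<zeta>)"
      unfolding norm_mult using \<zeta> by (auto intro!: mult_left_le)
    also have "\<dots> \<le> cmod (1 - z * cnj \<zeta>)" by (rule norm_triangle_ineq2)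
    finally have le: "1 - cmod z \<le> cmod (1 - z * cnj \<zeta>)" by simp
    have "cmod (q \<zeta> * cnj \<zeta> / (1 - z * cnj \<zeta>)) = cmod (q \<zeta>) * cmod \<zeta> / cmod (1 - z * cnj \<zeta>)"
      by (simp add: norm_divide norm_mult)
    also have "\<dots> \<le> M * 1 / (1 - cmod z)"
      using M(2)[of \<zeta>] \<zeta> z le M(1) by (intro frac_le mult_mono) auto
    finally show "cmod (q \<zeta> * cnj \<zeta> / (1 - z * cnj \<zeta>)) \<le> M * 1 / (1 - cmod z)" .
  qed (simp add: disk_bdd_eq_0[OF q])
qed

lemma cauchy_S_has_field_derivative:
  assumes q: "disk_bdd q" and z: "cmod z < 1"
  shows "(cauchy_S q has_field_derivative cauchy_S (\<lambda>\<zeta>. q \<zeta> * cnj \<zeta> / (1 - z * cnj \<zeta>)) z) (at z)"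
  unfolding has_field_derivative_iff
proof -
  let ?p = "\<lambda>\<zeta>. q \<zeta> * cnj \<zeta> / (1 - z * cnj \<zeta>)"
  note p = disk_bdd_div_one_minus[OF q z]
  have eq: "(cauchy_S q y - cauchy_S q z) / (y - z) = cauchy_S ?p y" if "y \<noteq> z" "cmod y < 1" for y
  proof -
    have "(y - z) * cauchy_S ?p y = (LINT \<zeta>|lborel. (y - z) * (?p \<zeta> / (1 - y * cnj \<zeta>)))"
      unfolding cauchy_S_def by (rule integral_mult_right_zero[symmetric])
    also have "\<dots> = (LINT \<zeta>|lborel. q \<zeta> / (1 - y * cnj \<zeta>) - q \<zeta> / (1 - z * cnj \<zeta>))"
    proof (rule Bochner_Integration.integral_cong[OF refl])
      fix \<zeta>
      show "(y - z) * (?p \<zeta> / (1 - y * cnj \<zeta>)) = q \<zeta> / (1 - y * cnj \<zeta>) - q \<zeta> / (1 - z * cnj \<zeta>)"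
      proof (cases "\<zeta> \<in> ball 0 1")
        case True
        then have "1 - y * cnj \<zeta> \<noteq> 0" "1 - z * cnj \<zeta> \<noteq> 0"
          using that z one_minus_mult_cnj_neq_0[of y \<zeta>] one_minus_mult_cnj_neq_0[of z \<zeta>] by auto
        then show ?thesis
          using kernel_difference[of "1 - y * cnj \<zeta>" "1 - z * cnj \<zeta>" "q \<zeta>"]
          by (simp add: algebra_simps)
      qed (simp add: disk_bdd_eq_0[OF q])
    qed
    also have "\<dots> = cauchy_S q y - cauchy_S q z"
      unfolding cauchy_S_def using that z
      by (intro Bochner_Integration.integral_diff cauchy_S_integrable q) auto
    finally show ?thesis using that by (simp add: field_simps)
  qed
  have "continuous_on (ball 0 1) (cauchy_S ?p)"
    using continuous_on_cauchy_S[OF p] by (rule continuous_on_subset) auto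
  then have "isCont (cauchy_S ?p) z"
    using z by (simp add: continuous_on_eq_continuous_at)
  then have lim: "(cauchy_S ?p \<longlongrightarrow> cauchy_S ?p z) (at z)" by (simp add: isCont_def)
  have "\<forall>\<^sub>F y in at z. y \<in> ball 0 1"
    using z by (intro eventually_at_in_open') auto
  then have "\<forall>\<^sub>F y in at z. cauchy_S ?p y = (cauchy_S q y - cauchy_S q z) / (y - z)"
    using eventually_neq_at_within[of z z UNIV] by eventually_elim (auto simp: eq)
  with lim show "((\<lambda>y. (cauchy_S q y - cauchy_S q z) / (y - z)) \<longlongrightarrow> cauchy_S ?p z) (at z)"
    by (rule Lim_transform_eventually)
qed

section \<open>Radial densities and the Cauchy transform of the unit disk\<close>

lemma has_vector_derivative_cis_mult:
  "((\<lambda>t. cis t * w) has_vector_derivative \<i> * cis t * w) (at t within S)"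
proof -
  have "((\<lambda>z. exp (\<i> * z) * w) has_field_derivative \<i> * exp (\<i> * of_real t) * w) (at (of_real t))"
    by (auto intro!: derivative_eq_intros)
  from has_vector_derivative_real_field[OF this] show ?thesis by (simp add: cis_conv_exp)
qed

lemma cauchy_T_rotate:
  assumes q: "q \<in> borel_measurable borel" and rad: "\<And>\<zeta>. q (cis t * \<zeta>) = q \<zeta>"
  shows "cauchy_T q (cis t * z) = cis (- t) * cauchy_T q z"
proof -
  note [measurable] = q
  have "cauchy_T q (cis t * z) = (LINT \<zeta>|lborel. q (cis t * \<zeta>) / (cis t * \<zeta> - cis t * z))"
    unfolding cauchy_T_def by (rule integral_rotation[symmetric]) measurable
  also have "\<dots> = (LINT \<zeta>|lborel. cis (- t) * (q \<zeta> / (\<zeta> - z)))"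
    unfolding rad right_diff_distrib[symmetric]
    by (simp add: cis_inverse divide_inverse mult_ac)
  also have "\<dots> = cis (- t) * cauchy_T q z"
    unfolding cauchy_T_def by (rule integral_mult_right_zero)
  finally show ?thesis .
qed

text \<open>For a radial density the function \<open>z T(z)\<close> is invariant under rotations; where it is
  holomorphic it is therefore locally constant.\<close>

lemma cauchy_T_radial_const:
  fixes a b :: real
  assumes q: "disk_bdd q" and rad: "\<And>t \<zeta>. q (cis t * \<zeta>) = q \<zeta>"
    and ab: "0 \<le> a" "a < b" and zero: "\<And>\<zeta>. a < cmod \<zeta> \<Longrightarrow> cmod \<zeta> < b \<Longrightarrow> q \<zeta> = 0"
    and u: "cmod u = 1"
  shows "of_real b * u * cauchy_T q (of_real b * u) = of_real a * u * cauchy_T q (of_real a * u)"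
proof -
  define G where "G = (\<lambda>w. w * cauchy_T q w)"
  note [measurable] = disk_bdd_measurable[OF q]
  obtain M where M: "M \<ge> 0" "\<And>\<zeta>. cmod (q \<zeta>) \<le> M * indicator (ball 0 1) \<zeta>"
    using q by (rule disk_bddE) blast
  have contT: "continuous_on UNIV (cauchy_T q)" by (rule continuous_on_cauchy_T[OF q])
  have der: "((\<lambda>r. G (of_real r * u)) has_derivative (\<lambda>h. 0)) (at r within {a..b})" if r: "a < r" "r < b" for r
  proof -
    define w where "w = of_real r * u"
    \<comment> \<open>The distance from \<open>r\<close> to the ends of the ring: \<open>q\<close>
      vanishes within \<open>e\<close> of \<open>w\<close>, so dividing by
      \<open>\<zeta> - w\<close> leaves a bounded density.\<close>
    define e where "e = min (r - a) (b - r)"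
    have e: "e > 0" using r by (simp add: e_def)
    have w: "cmod w = r" "w \<noteq> 0" using r ab u by (auto simp: w_def norm_mult)
    have "disk_bdd (\<lambda>\<zeta>. q \<zeta> / (\<zeta> - w))"
    proof (rule disk_bddI)
      fix \<zeta> :: complex assume \<zeta>: "\<zeta> \<in> ball 0 1"
      show "cmod (q \<zeta> / (\<zeta> - w)) \<le> M / e"
      proof (cases "a < cmod \<zeta> \<and> cmod \<zeta> < b")
        case False
        then have "e \<le> cmod (\<zeta> - w)"
          using norm_triangle_ineq2[of \<zeta> w] norm_triangle_ineq3[of \<zeta> w] w by (auto simp: e_def)
        then show ?thesis unfolding norm_divide using M(2)[of \<zeta>] \<zeta> e M(1) by (intro frac_le) auto
      qed (use zero M(1) e in auto)
    qed (auto simp: disk_bdd_eq_0[OF q])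
    from DERIV_mult[OF DERIV_ident cauchy_T_has_field_derivative[OF q this]]
    obtain D where D: "(G has_field_derivative D) (at w)"
      unfolding G_def by blast
    have rot: "G (cis t * w) = G w" for t
      unfolding G_def cauchy_T_rotate[OF disk_bdd_measurable[OF q] rad]
      by (simp add: mult_ac) (simp add: mult.assoc[symmetric] cis_mult)
    \<comment> \<open>Along the circle through \<open>w\<close> the function \<open>G\<close> is
      constant, and the velocity \<open>\<i> * w\<close> is nonzero, so the complex derivative
      vanishes.\<close>
    have "((\<lambda>t. cis t * w) has_vector_derivative \<i> * w) (at 0)"
      using has_vector_derivative_cis_mult[of w 0 UNIV] by simp
    moreover have "(G has_field_derivative D) (at (cis 0 * w))" using D by simp
    ultimately have "((G \<circ> (\<lambda>t. cis t * w)) has_vector_derivative (\<i> * w) * D) (at 0)"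
      by (rule field_vector_diff_chain_at)
    then have "((\<lambda>t. G w) has_vector_derivative (\<i> * w) * D) (at 0)"
      by (simp add: comp_def rot)
    then have "(\<i> * w) * D = 0"
      by (rule vector_derivative_unique_at) (rule has_vector_derivative_const)
    then have "D = 0" using w by simp
    with D have G0: "(G has_field_derivative 0) (at (of_real r * u))" by (simp add: w_def)
    have "((\<lambda>r. of_real r * u) has_vector_derivative u) (at r)"
      by (auto intro!: derivative_eq_intros)
    from field_vector_diff_chain_at[OF this G0]
    have "((\<lambda>r. G (of_real r * u)) has_vector_derivative 0) (at r)" by (simp add: comp_def)
    then show ?thesis
      by (auto simp: has_vector_derivative_def intro: has_derivative_at_withinI)
  qed
  \<comment> \<open>At the ends of the segment the derivative may fail to exist; there continuity of
    the transform is enough.\<close>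
  have cont: "continuous_on {a..b} (\<lambda>r. G (of_real r * u))"
    unfolding G_def by (intro continuous_intros continuous_on_compose2[OF contT]) auto
  have "G (of_real b * u) = G (of_real a * u)"
    by (rule has_derivative_zero_unique_strong_convex[where S = "{a..b}" and K = "{a, b}" and c = a
          and f = "\<lambda>r. G (of_real r * u)"])
       (use ab cont der in auto)
  then show ?thesis by (simp add: G_def)
qed

lemma disk_bdd_indicator:
  "S \<in> sets borel \<Longrightarrow> S \<subseteq> ball 0 1 \<Longrightarrow> disk_bdd (indicator S)"
  by (rule disk_bddI[where M = 1]) (auto simp: indicator_def)

lemma integrable_indicator_ball: "integrable lborel (indicator (ball (0::complex) r) :: _ \<Rightarrow> real)"
proof (rule integrable_real_indicator)
  show "emeasure lborel (ball (0::complex) r) < \<infinity>"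
  proof (cases "r > 0")
    case False
    then have "ball (0::complex) r = {}" by simp
    then show ?thesis by (simp only: emeasure_empty) simp
  qed (simp add: emeasure_ball_complex)
qed simp

lemma integral_indicator_ball:
  assumes "r \<ge> 0"
  shows "(LINT \<zeta>|lborel. indicator (ball (0::complex) r) \<zeta> :: complex) = of_real (pi * r\<^sup>2)"
proof -
  have "(LINT \<zeta>|lborel. indicator (ball (0::complex) r) \<zeta> :: complex)
      = (LINT \<zeta>|lborel. of_real (indicator (ball (0::complex) r) \<zeta>))"
    by (simp add: of_real_indicator)
  also have "\<dots> = of_real (LINT \<zeta>|lborel. indicator (ball (0::complex) r) \<zeta>)"
    by (rule integral_of_real[OF integrable_indicator_ball])
  also have "(LINT \<zeta>|lborel. indicator (ball (0::complex) r) \<zeta>) = pi * r\<^sup>2"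
    using assms by (simp add: integrable_indicator_ball measure_def emeasure_ball_complex)
  finally show ?thesis .
qed

text \<open>Outside the support the product of \<open>w\<close> and the transform at
  \<open>w\<close> does not depend on the radius, and far away it tends to minus the total
  mass.\<close>

lemma cauchy_T_indicator_ball_outside:
  assumes \<rho>: "0 < \<rho>" "\<rho> < 1" and u: "cmod u = 1"
  shows "of_real \<rho> * u * cauchy_T (indicator (ball 0 \<rho>)) (of_real \<rho> * u) = - of_real (pi * \<rho>\<^sup>2)"
proof -
  let ?q = "indicator (ball 0 \<rho>) :: complex \<Rightarrow> complex"
  define c where "c = of_real \<rho> * u * cauchy_T ?q (of_real \<rho> * u) + of_real (pi * \<rho>\<^sup>2)"
  have q: "disk_bdd ?q" using \<rho> by (intro disk_bdd_indicator) auto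
  note [measurable] = disk_bdd_measurable[OF q]
  \<comment> \<open>On the disk of radius \<open>\<rho>\<close> the integrand equals
    \<open>\<zeta> / (\<zeta> - w)\<close>, of modulus at most \<open>1 / (R - 1)\<close>, and the
    unit disk has area \<open>pi\<close>. As \<open>c\<close> does not involve \<open>R\<close>,
    letting \<open>R\<close> grow forces it to be 0.\<close>
  have bound: "cmod c \<le> pi / (R - 1)" if R: "R > 1" for R
  proof -
    define w where "w = of_real R * u"
    have w: "cmod w = R" using R u by (simp add: w_def norm_mult)
    have int1: "integrable lborel (\<lambda>\<zeta>. ?q \<zeta> / (\<zeta> - w))" by (rule cauchy_T_integrable[OF q])
    have int2: "integrable lborel ?q"
      using integrable_of_real[OF integrable_indicator_ball[of \<rho>], where 'a = complex]
      by (simp add: of_real_indicator)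
    have "of_real \<rho> * u * cauchy_T ?q (of_real \<rho> * u) = w * cauchy_T ?q w"
      unfolding w_def using \<rho> R u
      by (intro cauchy_T_radial_const[symmetric] q) (auto simp: indicator_def norm_mult)
    then have "c = w * cauchy_T ?q w + (LINT \<zeta>|lborel. ?q \<zeta>)"
      using \<rho> by (simp add: c_def integral_indicator_ball)
    also have "\<dots> = (LINT \<zeta>|lborel. w * (?q \<zeta> / (\<zeta> - w)) + ?q \<zeta>)"
      unfolding cauchy_T_def integral_mult_right_zero[symmetric]
      using int1 int2 by (intro Bochner_Integration.integral_add[symmetric] integrable_mult_right) auto
    finally have c: "c = (LINT \<zeta>|lborel. w * (?q \<zeta> / (\<zeta> - w)) + ?q \<zeta>)" .
    have "cmod c \<le> (LINT \<zeta>|lborel. cmod (w * (?q \<zeta> / (\<zeta> - w)) + ?q \<zeta>))"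
      unfolding c by (rule integral_norm_bound)
    also have "\<dots> \<le> (LINT \<zeta>|lborel. 1 / (R - 1) * indicator (ball (0::complex) 1) \<zeta>)"
    proof (rule integral_mono)
      show "integrable lborel (\<lambda>\<zeta>. cmod (w * (?q \<zeta> / (\<zeta> - w)) + ?q \<zeta>))"
        using int1 int2 by (intro integrable_norm Bochner_Integration.integrable_add integrable_mult_right) auto
      show "integrable lborel (\<lambda>\<zeta>. 1 / (R - 1) * indicator (ball (0::complex) 1) \<zeta>)"
        by (intro integrable_mult_right integrable_indicator_ball)
      fix \<zeta> :: complex
      show "cmod (w * (?q \<zeta> / (\<zeta> - w)) + ?q \<zeta>) \<le> 1 / (R - 1) * indicator (ball 0 1) \<zeta>"
      proof (cases "\<zeta> \<in> ball 0 \<rho>")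
        case True
        then have z: "cmod \<zeta> < 1" using \<rho> by simp
        have le: "R - 1 \<le> cmod (\<zeta> - w)"
          using norm_triangle_ineq3[of \<zeta> w] z w by linarith
        then have ne: "\<zeta> - w \<noteq> 0" using R by auto
        then have "w * (?q \<zeta> / (\<zeta> - w)) + ?q \<zeta> = \<zeta> / (\<zeta> - w)"
          using True by (simp add: field_simps)
        then have "cmod (w * (?q \<zeta> / (\<zeta> - w)) + ?q \<zeta>) = cmod \<zeta> / cmod (\<zeta> - w)"
          by (simp add: norm_divide)
        also have "\<dots> \<le> 1 / (R - 1)"
          using z le R by (intro frac_le) auto
        finally show ?thesis using z by simp
      qed (use R in auto)
    qed
    also have "\<dots> = pi / (R - 1)"
      using integrable_indicator_ball[of 1] by (simp add: measure_def emeasure_ball_complex)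
    finally show ?thesis .
  qed
  have "((\<lambda>R. pi / (R - 1)) \<longlongrightarrow> 0) at_top"
    by real_asymp
  then have "cmod c \<le> 0"
    by (rule tendsto_lowerbound) (use bound in \<open>auto intro: eventually_mono[OF eventually_gt_at_top[of 1]]\<close>)
  then have "c = 0" by simp
  then show ?thesis unfolding c_def by (rule eq_neg_iff_add_eq_0[THEN iffD2])
qed

text \<open>Newton's shell theorem, with the disk cut at radius \<open>cmod z\<close>. The outer
  ring contributes nothing, since throughout its hole the product of the point and the transform
  keeps the value 0 it has at the origin. The inner disk acts as its mass
  \<open>pi * \<rho>\<^sup>2\<close> placed at the origin, and \<open>\<rho>\<^sup>2\<close> is
  \<open>z * cnj z\<close>.\<close>

lemma cauchy_T_unit_disk:
  assumes z: "cmod z < 1"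
  shows "cauchy_T (indicator (ball 0 1)) z = - of_real pi * cnj z"
proof (cases "z = 0")
  case True
  \<comment> \<open>Rotation by \<open>pi\<close> fixes the origin but reverses the sign of the
    transform.\<close>
  have "cauchy_T (indicator (ball 0 1)) (cis pi * 0) = cis (- pi) * cauchy_T (indicator (ball 0 1)) 0"
    by (rule cauchy_T_rotate) (auto simp: indicator_def norm_mult)
  then show ?thesis using True by (simp add: cis_inverse[symmetric] cis_pi)
next
  case False
  define \<rho> where "\<rho> = cmod z"
  define u where "u = z / of_real \<rho>"
  let ?q1 = "indicator (ball 0 \<rho>) :: complex \<Rightarrow> complex"
  let ?q2 = "indicator (ball 0 1 - ball 0 \<rho>) :: complex \<Rightarrow> complex"
  have \<rho>: "0 < \<rho>" "\<rho> < 1" using False z by (auto simp: \<rho>_def)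
  have u: "cmod u = 1" "of_real \<rho> * u = z" using \<rho> by (auto simp: u_def norm_divide \<rho>_def)
  have q: "disk_bdd ?q1" "disk_bdd ?q2" using \<rho> by (auto intro!: disk_bdd_indicator)
  have "cauchy_T (indicator (ball 0 1)) z = (LINT \<zeta>|lborel. ?q1 \<zeta> / (\<zeta> - z) + ?q2 \<zeta> / (\<zeta> - z))"
    unfolding cauchy_T_def using \<rho>
    by (intro Bochner_Integration.integral_cong) (auto simp: indicator_def)
  also have "\<dots> = cauchy_T ?q1 z + cauchy_T ?q2 z"
    unfolding cauchy_T_def by (intro Bochner_Integration.integral_add cauchy_T_integrable q)
  finally have eq: "cauchy_T (indicator (ball 0 1)) z = cauchy_T ?q1 z + cauchy_T ?q2 z" .
  have "of_real \<rho> * u * cauchy_T ?q2 (of_real \<rho> * u) = of_real 0 * u * cauchy_T ?q2 (of_real 0 * u)"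
    using \<rho> u by (intro cauchy_T_radial_const q) (auto simp: indicator_def norm_mult)
  then have 2: "cauchy_T ?q2 z = 0" using False by (simp add: u)
  have "z * cauchy_T ?q1 z = - of_real (pi * \<rho>\<^sup>2)"
    using cauchy_T_indicator_ball_outside[OF \<rho> u(1)] by (simp add: u)
  also have "\<dots> = z * (- of_real pi * cnj z)"
    by (simp add: \<rho>_def complex_norm_square[symmetric] mult_ac)
  finally have "cauchy_T ?q1 z = - of_real pi * cnj z" using False by (metis mult_cancel_left)
  with eq 2 show ?thesis by simp
qed

text \<open>The constant density \<open>q z\<close> on the disk is split off; its transform is known
  explicitly and carries the whole conjugate-linear part. The remaining density vanishes to first
  order at \<open>z\<close>, so its quotient by \<open>\<zeta> - z\<close> is bounded and its
  transform is complex differentiable.\<close>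

lemma cauchy_T_has_derivative:
  assumes q: "disk_bdd q" and z: "cmod z < 1" and diff: "q differentiable (at z)"
  obtains D where "(cauchy_T q has_derivative (\<lambda>h. D * h - of_real pi * q z * cnj h)) (at z)"
proof -
  define B where "B = (\<lambda>\<zeta>. q \<zeta> - q z * indicator (ball 0 1) \<zeta>)"
  note [measurable] = disk_bdd_measurable[OF q]
  obtain M where M: "M \<ge> 0" "\<And>\<zeta>. cmod (q \<zeta>) \<le> M * indicator (ball 0 1) \<zeta>"
    using q by (rule disk_bddE) blast
  have M': "cmod (q \<zeta>) \<le> M" for \<zeta>
    using M(2)[of \<zeta>] M(1) by (cases "\<zeta> \<in> ball 0 1") auto
  have Bb: "cmod (B \<zeta>) \<le> 2 * M" for \<zeta>
  proof -
    have "cmod (B \<zeta>) \<le> cmod (q \<zeta>) + cmod (q z * indicator (ball 0 1) \<zeta>)"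
      unfolding B_def by (rule norm_triangle_ineq4)
    also have "\<dots> \<le> M + M"
      using M'[of \<zeta>] M'[of z] M(1) by (intro add_mono) (auto simp: indicator_def)
    finally show ?thesis by simp
  qed
  have Bm [measurable]: "B \<in> borel_measurable borel" unfolding B_def
    by (intro borel_measurable_diff borel_measurable_times borel_measurable_indicator) auto
  have B: "disk_bdd B"
    by (rule disk_bddI[OF Bm Bb]) (simp add: B_def disk_bdd_eq_0[OF q])
  obtain L where L: "(q has_derivative L) (at z)" using diff by (auto simp: differentiable_def)
  then obtain K where K: "K > 0" "\<And>h. norm (L h) \<le> norm h * K"
    using bounded_linear.pos_bounded has_derivative_bounded_linear by blast
  obtain d where d: "d > 0" "\<And>\<zeta>. norm (\<zeta> - z) < d \<Longrightarrow> norm (q \<zeta> - q z - L (\<zeta> - z)) \<le> 1 * norm (\<zeta> - z)"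
    using L unfolding has_derivative_at_alt by (meson zero_less_one)
  have "disk_bdd (\<lambda>\<zeta>. B \<zeta> / (\<zeta> - z))"
  proof (rule disk_bddI)
    fix \<zeta> :: complex assume \<zeta>: "\<zeta> \<in> ball 0 1"
    \<comment> \<open>Near \<open>z\<close> the derivative contributes \<open>K\<close> and the
      remainder at most 1; at distance \<open>d\<close> or more the crude bound \<open>2 * M\<close>
      for \<open>B\<close> is divided by \<open>d\<close>.\<close>
    show "cmod (B \<zeta> / (\<zeta> - z)) \<le> max (K + 1) (2 * M / d)"
    proof (cases "cmod (\<zeta> - z) < d")
      case True
      have "cmod (B \<zeta>) = norm ((q \<zeta> - q z - L (\<zeta> - z)) + L (\<zeta> - z))"
        using \<zeta> by (simp add: B_def)
      also have "\<dots> \<le> norm (\<zeta> - z) + norm (\<zeta> - z) * K"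
        using d(2)[OF True] K(2)[of "\<zeta> - z"] norm_triangle_ineq[of "q \<zeta> - q z - L (\<zeta> - z)" "L (\<zeta> - z)"] by simp
      finally have "cmod (B \<zeta>) \<le> (K + 1) * cmod (\<zeta> - z)" by (simp add: algebra_simps)
      then have "cmod (B \<zeta> / (\<zeta> - z)) \<le> K + 1"
        using K(1) by (cases "\<zeta> = z") (auto simp: norm_divide divide_le_eq)
      then show ?thesis by simp
    next
      case False
      then have "cmod (B \<zeta> / (\<zeta> - z)) \<le> 2 * M / d"
        unfolding norm_divide using d(1) Bb[of \<zeta>] M(1) by (intro frac_le) auto
      then show ?thesis by simp
    qed
  qed (auto simp: disk_bdd_eq_0[OF B])
  from cauchy_T_has_field_derivative[OF B this]
  obtain D where D: "(cauchy_T B has_field_derivative D) (at z)" by blast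
  have i1: "disk_bdd (indicator (ball 0 1))" by (intro disk_bdd_indicator) auto
  have split: "cauchy_T q y = cauchy_T B y + q z * (- of_real pi * cnj y)" if "y \<in> ball 0 1" for y
  proof -
    have "cauchy_T q y = (LINT \<zeta>|lborel. B \<zeta> / (\<zeta> - y) + q z * (indicator (ball 0 1) \<zeta> / (\<zeta> - y)))"
      unfolding cauchy_T_def B_def by (intro Bochner_Integration.integral_cong) (auto simp: add_divide_distrib[symmetric])
    also have "\<dots> = cauchy_T B y + (LINT \<zeta>|lborel. q z * (indicator (ball 0 1) \<zeta> / (\<zeta> - y)))"
      unfolding cauchy_T_def
      by (intro Bochner_Integration.integral_add integrable_mult_right cauchy_T_integrable B i1)
    also have "(LINT \<zeta>|lborel. q z * (indicator (ball 0 1) \<zeta> / (\<zeta> - y))) = q z * cauchy_T (indicator (ball 0 1)) y"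
      unfolding cauchy_T_def by (rule integral_mult_right_zero)
    finally show ?thesis using that by (simp add: cauchy_T_unit_disk)
  qed
  have "((\<lambda>y. cauchy_T B y + q z * (- of_real pi * cnj y)) has_derivative
      (\<lambda>h. D * h + q z * (- of_real pi * cnj h))) (at z)"
    by (intro has_derivative_add has_derivative_mult_right has_derivative_cnj has_derivative_ident
        D[unfolded has_field_derivative_def])
  then have "(cauchy_T q has_derivative (\<lambda>h. D * h + q z * (- of_real pi * cnj h))) (at z)"
    by (rule has_derivative_transform_within_open[where s = "ball 0 1"]) (use z split in auto)
  then show thesis by (intro that[of D]) (simp add: algebra_simps)
qed

section \<open>The function \<open>\<psi>\<close>\<close>

abbreviation on_disk :: "(complex \<Rightarrow> complex) \<Rightarrow> complex \<Rightarrow> complex" where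
  "on_disk A \<equiv> \<lambda>\<zeta>. indicator (ball 0 1) \<zeta> * A \<zeta>"

lemma on_disk_measurable:
  assumes "continuous_on (ball 0 1) f"
  shows "on_disk f \<in> borel_measurable borel"
proof -
  have "on_disk f = (\<lambda>\<zeta>. indicator (ball 0 1) \<zeta> *\<^sub>R f \<zeta>)" by (auto simp: indicator_def)
  then show ?thesis using borel_measurable_continuous_on_indicator[OF _ assms] by simp
qed

definition schwarz_kernel :: "complex \<Rightarrow> complex \<Rightarrow> complex \<Rightarrow> complex" where
  "schwarz_kernel a \<zeta> z =
     a / \<zeta> * ((\<zeta> + z) / (\<zeta> - z)) + cnj a / cnj \<zeta> * ((1 + z * cnj \<zeta>) / (1 - z * cnj \<zeta>))"

lemma psi_eq_schwarz_kernel: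
  "psi A z = - (1 / (2 * of_real pi)) * (LINT \<zeta>|lborel. schwarz_kernel (on_disk A \<zeta>) \<zeta> z)"
proof -
  have "indicator (ball 0 1) \<zeta> *\<^sub>R schwarz_kernel (A \<zeta>) \<zeta> z = schwarz_kernel (on_disk A \<zeta>) \<zeta> z" for \<zeta>
    by (simp add: schwarz_kernel_def indicator_def)
  then show ?thesis
    by (simp add: psi_def set_lebesgue_integral_def schwarz_kernel_def)
qed

lemma cnj_measurable [measurable]: "cnj \<in> borel_measurable borel"
  by (intro borel_measurable_continuous_onI continuous_intros)

lemma schwarz_kernel_measurable:
  assumes [measurable]: "q \<in> borel_measurable borel"
  shows "(\<lambda>\<zeta>. schwarz_kernel (q \<zeta>) \<zeta> z) \<in> borel_measurable borel"
proof -
  have [measurable]: "(\<lambda>\<zeta>. 1 - z * cnj \<zeta>) \<in> borel_measurable borel"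
    "(\<lambda>\<zeta>. 1 + z * cnj \<zeta>) \<in> borel_measurable borel"
    by (intro borel_measurable_continuous_onI continuous_intros)+
  show ?thesis unfolding schwarz_kernel_def by measurable
qed

text \<open>Partial fractions. Two summands carry the dependence on \<open>z\<close>, through the
  Cauchy and the reflected kernel; the other two are conjugate to each other up to sign and
  contribute only an imaginary constant.\<close>

lemma schwarz_kernel_split:
  assumes "\<zeta> \<noteq> 0" "\<zeta> \<noteq> z" "1 - z * cnj \<zeta> \<noteq> 0"
  shows "schwarz_kernel a \<zeta> z
    = 2 * (a / (\<zeta> - z)) - a / (\<zeta> - 0) + (cnj (a / (\<zeta> - 0)) + 2 * (z * (cnj a / (1 - z * cnj \<zeta>))))"
proof -
  have "a / \<zeta> * ((\<zeta> + z) / (\<zeta> - z)) = 2 * (a / (\<zeta> - z)) - a / \<zeta>"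
    using assms(1,2) by (simp add: field_simps)
  moreover have "cnj a / cnj \<zeta> * ((1 + z * cnj \<zeta>) / (1 - z * cnj \<zeta>))
      = cnj a / cnj \<zeta> + 2 * (z * (cnj a / (1 - z * cnj \<zeta>)))"
  proof -
    define s where "s = cnj \<zeta>"
    have "s \<noteq> 0" "1 - z * s \<noteq> 0" using assms by (auto simp: s_def)
    then show ?thesis unfolding s_def[symmetric] by (simp add: field_simps)
  qed
  ultimately show ?thesis by (simp add: schwarz_kernel_def)
qed

lemma disk_bdd_cnj: "disk_bdd q \<Longrightarrow> disk_bdd (\<lambda>\<zeta>. cnj (q \<zeta>))"
  unfolding disk_bdd_def by auto

text \<open>The splitting can fail only at 0 and at \<open>z\<close>, a null set, and each summand
  is integrable for \<open>cmod z = 1\<close> too. The formula therefore holds up to the circle and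
  yields continuity there.\<close>

lemma psi_eq:
  assumes q: "disk_bdd (on_disk A)" and z: "cmod z \<le> 1"
  shows "psi A z = - (1 / of_real pi) * cauchy_T (on_disk A) z
     + 1 / (2 * of_real pi) * (cauchy_T (on_disk A) 0 - cnj (cauchy_T (on_disk A) 0))
     - 1 / of_real pi * (z * cauchy_S (\<lambda>\<zeta>. cnj (on_disk A \<zeta>)) z)"
proof -
  define q where "q = on_disk A"
  have q: "disk_bdd q" using q by (simp add: q_def)
  note qm [measurable] = disk_bdd_measurable[OF q]
  define I where "I = (LINT \<zeta>|lborel. schwarz_kernel (q \<zeta>) \<zeta> z)"
  have int1: "integrable lborel (\<lambda>\<zeta>. 2 * (q \<zeta> / (\<zeta> - z)))"
    by (intro integrable_mult_right cauchy_T_integrable q)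
  have int2: "integrable lborel (\<lambda>\<zeta>. q \<zeta> / (\<zeta> - 0))"
    by (rule cauchy_T_integrable[OF q])
  have int3: "integrable lborel (\<lambda>\<zeta>. cnj (q \<zeta> / (\<zeta> - 0)))"
    by (rule integrable_cnj[OF int2])
  have int4: "integrable lborel (\<lambda>\<zeta>. 2 * (z * (cnj (q \<zeta>) / (1 - z * cnj \<zeta>))))"
    by (intro integrable_mult_right cauchy_S_integrable disk_bdd_cnj q z)
  note int = int1 int2 int3 int4
  have "I = (LINT \<zeta>|lborel. 2 * (q \<zeta> / (\<zeta> - z)) - q \<zeta> / (\<zeta> - 0)
      + (cnj (q \<zeta> / (\<zeta> - 0)) + 2 * (z * (cnj (q \<zeta>) / (1 - z * cnj \<zeta>)))))"
    unfolding I_def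
  proof (rule integral_cong_AE)
    show "AE \<zeta> in lborel. schwarz_kernel (q \<zeta>) \<zeta> z = 2 * (q \<zeta> / (\<zeta> - z)) - q \<zeta> / (\<zeta> - 0)
      + (cnj (q \<zeta> / (\<zeta> - 0)) + 2 * (z * (cnj (q \<zeta>) / (1 - z * cnj \<zeta>))))"
      using AE_lborel_singleton[of 0] AE_lborel_singleton[of z]
    proof eventually_elim
      fix \<zeta> :: complex assume "\<zeta> \<noteq> 0" "\<zeta> \<noteq> z"
      show "schwarz_kernel (q \<zeta>) \<zeta> z = 2 * (q \<zeta> / (\<zeta> - z)) - q \<zeta> / (\<zeta> - 0)
        + (cnj (q \<zeta> / (\<zeta> - 0)) + 2 * (z * (cnj (q \<zeta>) / (1 - z * cnj \<zeta>))))"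
      proof (cases "\<zeta> \<in> ball 0 1")
        case True
        then show ?thesis
          using \<open>\<zeta> \<noteq> 0\<close> \<open>\<zeta> \<noteq> z\<close> one_minus_mult_cnj_neq_0[OF z, of \<zeta>]
          by (intro schwarz_kernel_split) auto
      qed (simp add: disk_bdd_eq_0[OF q] schwarz_kernel_def)
    qed
    show "(\<lambda>\<zeta>. schwarz_kernel (q \<zeta>) \<zeta> z) \<in> borel_measurable lborel"
      using schwarz_kernel_measurable[OF qm] by simp
    show "(\<lambda>\<zeta>. 2 * (q \<zeta> / (\<zeta> - z)) - q \<zeta> / (\<zeta> - 0)
      + (cnj (q \<zeta> / (\<zeta> - 0)) + 2 * (z * (cnj (q \<zeta>) / (1 - z * cnj \<zeta>))))) \<in> borel_measurable lborel"
      by (intro borel_measurable_integrable Bochner_Integration.integrable_add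
          Bochner_Integration.integrable_diff int)
  qed
  also have "\<dots> = (LINT \<zeta>|lborel. 2 * (q \<zeta> / (\<zeta> - z))) - (LINT \<zeta>|lborel. q \<zeta> / (\<zeta> - 0))
      + ((LINT \<zeta>|lborel. cnj (q \<zeta> / (\<zeta> - 0))) + (LINT \<zeta>|lborel. 2 * (z * (cnj (q \<zeta>) / (1 - z * cnj \<zeta>)))))"
    by (simp only: Bochner_Integration.integral_add Bochner_Integration.integral_diff
        Bochner_Integration.integrable_add Bochner_Integration.integrable_diff int)
  also have "\<dots> = 2 * cauchy_T q z - cauchy_T q 0 + (cnj (cauchy_T q 0) + 2 * (z * cauchy_S (\<lambda>\<zeta>. cnj (q \<zeta>)) z))"
    unfolding cauchy_T_def cauchy_S_def
    by (simp only: integral_mult_right_zero Bochner_Integration.integral_cnj)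
  finally have I: "I = 2 * cauchy_T q z - cauchy_T q 0 + (cnj (cauchy_T q 0) + 2 * (z * cauchy_S (\<lambda>\<zeta>. cnj (q \<zeta>)) z))" .
  have "psi A z = - (1 / (2 * of_real pi)) * I"
    by (simp add: psi_eq_schwarz_kernel I_def q_def)
  also have "\<dots> = - (1 / of_real pi) * cauchy_T q z
     + 1 / (2 * of_real pi) * (cauchy_T q 0 - cnj (cauchy_T q 0))
     - 1 / of_real pi * (z * cauchy_S (\<lambda>\<zeta>. cnj (q \<zeta>)) z)"
    unfolding I by (simp add: divide_simps)
  finally show ?thesis unfolding q_def .
qed

lemma continuous_on_psi:
  assumes q: "disk_bdd (on_disk A)"
  shows "continuous_on (cball 0 1) (psi A)"
proof -
  have "continuous_on (cball 0 1) (\<lambda>z. - (1 / of_real pi) * cauchy_T (on_disk A) z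
     + 1 / (2 * of_real pi) * (cauchy_T (on_disk A) 0 - cnj (cauchy_T (on_disk A) 0))
     - 1 / of_real pi * (z * cauchy_S (\<lambda>\<zeta>. cnj (on_disk A \<zeta>)) z))"
    by (intro continuous_intros continuous_on_cauchy_T continuous_on_cauchy_S disk_bdd_cnj q)
  then show ?thesis
    by (rule continuous_on_eq) (simp add: psi_eq[OF q])
qed

text \<open>At the origin the reflected transform is multiplied by 0, and the imaginary constant in
  \<open>psi_eq\<close> cancels the imaginary part of the Cauchy transform. Hence
  \<open>exp (psi A 0)\<close> is a positive real factor, which passes through
  \<open>Im\<close>.\<close>

lemma Im_psi_0:
  assumes q: "disk_bdd (on_disk A)"
  shows "Im (psi A 0) = 0"
proof -
  have "Im (psi A 0) = Im (- (1 / of_real pi) * cauchy_T (on_disk A) 0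
     + 1 / (2 * of_real pi) * (cauchy_T (on_disk A) 0 - cnj (cauchy_T (on_disk A) 0)))"
    by (simp only: psi_eq[OF q] norm_zero zero_le_one mult_zero_left mult_zero_right diff_zero)
  also have "- (1 / of_real pi) * cauchy_T (on_disk A) 0
     + 1 / (2 * of_real pi) * (cauchy_T (on_disk A) 0 - cnj (cauchy_T (on_disk A) 0))
     = - (1 / (2 * of_real pi)) * (cauchy_T (on_disk A) 0 + cnj (cauchy_T (on_disk A) 0))"
    by (simp add: field_simps)
  also have "\<dots> = of_real (- (Re (cauchy_T (on_disk A) 0) / pi))"
    unfolding complex_add_cnj by simp
  finally show ?thesis by simp
qed

text \<open>The reflected transform is holomorphic. The conjugate-linear part comes from the Cauchy
  transform alone, with coefficient \<open>- pi * A z\<close>, and the prefactor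
  \<open>- 1 / pi\<close> turns it into \<open>A z\<close>.\<close>

lemma psi_has_derivative:
  assumes q: "disk_bdd (on_disk A)" and z: "z \<in> ball 0 1" and A: "A differentiable (at z)"
  obtains D where "(psi A has_derivative (\<lambda>h. D * h + A z * cnj h)) (at z)"
proof -
  obtain L where "(A has_derivative L) (at z)" using A by (auto simp: differentiable_def)
  then have "(on_disk A has_derivative L) (at z)"
    by (rule has_derivative_transform_within_open[where s = "ball 0 1"]) (use z in auto)
  then have "on_disk A differentiable (at z)" by (auto simp: differentiable_def)
  from cauchy_T_has_derivative[OF q _ this] z
  obtain D1 where D1: "(cauchy_T (on_disk A) has_derivative (\<lambda>h. D1 * h - of_real pi * A z * cnj h)) (at z)"
    by auto
  obtain D2 where D2: "((\<lambda>z. z * cauchy_S (\<lambda>\<zeta>. cnj (on_disk A \<zeta>)) z) has_field_derivative D2) (at z)"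
    using DERIV_mult[OF DERIV_ident cauchy_S_has_field_derivative[OF disk_bdd_cnj[OF q]]] z by auto
  define k where "k = 1 / (2 * of_real pi) * (cauchy_T (on_disk A) 0 - cnj (cauchy_T (on_disk A) 0))"
  have "((\<lambda>z. - (1 / of_real pi) * cauchy_T (on_disk A) z + k
     - 1 / of_real pi * (z * cauchy_S (\<lambda>\<zeta>. cnj (on_disk A \<zeta>)) z))
     has_derivative (\<lambda>h. - (1 / of_real pi) * (D1 * h - of_real pi * A z * cnj h) + 0 - 1 / of_real pi * (D2 * h))) (at z)"
    by (intro has_derivative_add has_derivative_diff has_derivative_mult_right D1 has_derivative_const
        D2[unfolded has_field_derivative_def])
  then have "(psi A has_derivative (\<lambda>h. - (1 / of_real pi) * (D1 * h - of_real pi * A z * cnj h) + 0 - 1 / of_real pi * (D2 * h))) (at z)"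
    by (rule has_derivative_transform_within_open[where s = "ball 0 1"]) (use z psi_eq[OF q] in \<open>auto simp: k_def\<close>)
  then show thesis
    by (intro that[of "- (1 / of_real pi) * (D1 + D2)"]) (simp add: algebra_simps add_divide_distrib)
qed

text \<open>Rotating \<open>z\<close> and \<open>\<zeta>\<close> together leaves
  \<open>(\<zeta> + z) / (\<zeta> - z)\<close> and its mirror unchanged. The factors
  \<open>1 / \<zeta>\<close> and \<open>1 / cnj \<zeta>\<close> produce a phase, conjugated in the
  second case, just as the new density is.\<close>

lemma psi_rotate:
  assumes q: "disk_bdd (on_disk A)"
  shows "psi A (cis t * z) = psi (\<lambda>\<zeta>. cis (- t) * A (cis t * \<zeta>)) z"
proof -
  have c: "cis t * cis (- t) = 1" by (simp add: cis_mult)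
  have "(LINT \<zeta>|lborel. schwarz_kernel (on_disk A \<zeta>) \<zeta> (cis t * z))
      = (LINT \<zeta>|lborel. schwarz_kernel (on_disk A (cis t * \<zeta>)) (cis t * \<zeta>) (cis t * z))"
    by (intro integral_rotation[symmetric] schwarz_kernel_measurable disk_bdd_measurable q)
  also have "\<dots> = (LINT \<zeta>|lborel. schwarz_kernel (on_disk (\<lambda>\<zeta>. cis (- t) * A (cis t * \<zeta>)) \<zeta>) \<zeta> z)"
  proof (rule Bochner_Integration.integral_cong[OF refl])
    fix \<zeta>
    have 1: "(cis t * \<zeta> + cis t * z) / (cis t * \<zeta> - cis t * z) = (\<zeta> + z) / (\<zeta> - z)"
      unfolding distrib_left[symmetric] right_diff_distrib[symmetric] by simp
    have 2: "cis t * z * cnj (cis t * \<zeta>) = z * cnj \<zeta>"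
      using c by (simp add: cis_cnj mult_ac)
    have 3: "a / (cis t * \<zeta>) = cis (- t) * a / \<zeta>" for a
      by (simp add: divide_inverse cis_inverse mult_ac)
    have 4: "cnj a / cnj (cis t * \<zeta>) = cnj (cis (- t) * a) / cnj \<zeta>" for a
      by (simp add: divide_inverse cis_inverse cis_cnj mult_ac)
    show "schwarz_kernel (on_disk A (cis t * \<zeta>)) (cis t * \<zeta>) (cis t * z)
        = schwarz_kernel (on_disk (\<lambda>\<zeta>. cis (- t) * A (cis t * \<zeta>)) \<zeta>) \<zeta> z"
      unfolding schwarz_kernel_def 1 2 3 4
      by (simp add: indicator_def norm_mult)
  qed
  finally show ?thesis by (simp add: psi_eq_schwarz_kernel)
qed

section \<open>Differentiation under the integral and angular derivatives of
  \<open>psi\<close>\<close>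

lemma norm_diff_le_vector_derivative_bound:
  fixes g :: "real \<Rightarrow> complex"
  assumes "\<And>t. (g has_vector_derivative g' t) (at t)" "\<And>t. norm (g' t) \<le> B"
  shows "norm (g s - g t) \<le> B * \<bar>s - t\<bar>"
proof -
  have "norm (g s - g t) \<le> B * norm (s - t)"
  proof (rule differentiable_bound[where f' = "\<lambda>x h. h *\<^sub>R g' x" and S = UNIV])
    show "(g has_derivative (\<lambda>h. h *\<^sub>R g' x)) (at x within UNIV)" for x
      using assms(1)[of x] by (simp add: has_vector_derivative_def)
    have "onorm (\<lambda>h. h *\<^sub>R g' x) \<le> B" for x
    proof (rule onorm_le)
      show "norm (h *\<^sub>R g' x) \<le> B * norm h" for h
        using mult_right_mono[OF assms(2)[of x] norm_ge_zero[of h]] by (simp add: mult.commute)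
    qed
    then show "onorm (\<lambda>h. h *\<^sub>R g' x) \<le> B" for x .
  qed auto
  then show ?thesis by simp
qed

lemma has_vector_derivative_integral_kernel:
  fixes q q' :: "real \<Rightarrow> complex \<Rightarrow> complex" and \<kappa> :: "complex \<Rightarrow> complex"
  assumes qm: "\<And>t. q t \<in> borel_measurable borel" and q'm: "\<And>t. q' t \<in> borel_measurable borel"
    and \<kappa>m: "\<kappa> \<in> borel_measurable borel"
    and \<kappa>: "integrable lborel (\<lambda>\<zeta>. indicator (ball 0 1) \<zeta> * \<kappa> \<zeta>)"
    and deriv: "\<And>t \<zeta>. ((\<lambda>t. q t \<zeta>) has_vector_derivative q' t \<zeta>) (at t)"
    and qb: "\<And>t \<zeta>. cmod (q t \<zeta>) \<le> M0 * indicator (ball 0 1) \<zeta>"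
    and bound: "\<And>t \<zeta>. cmod (q' t \<zeta>) \<le> M * indicator (ball 0 1) \<zeta>"
  shows "((\<lambda>t. LINT \<zeta>|lborel. q t \<zeta> * \<kappa> \<zeta>) has_vector_derivative (LINT \<zeta>|lborel. q' t \<zeta> * \<kappa> \<zeta>)) (at t)"
proof -
  have [measurable]: "\<kappa> \<in> borel_measurable borel" "\<And>t. q t \<in> borel_measurable borel"
    "\<And>t. q' t \<in> borel_measurable borel" by fact+
  have intM: "integrable lborel (\<lambda>\<zeta>. C * (indicator (ball 0 1) \<zeta> * cmod (\<kappa> \<zeta>)))" for C :: real
  proof -
    have "(\<lambda>\<zeta>. cmod (indicator (ball 0 1) \<zeta> * \<kappa> \<zeta>)) = (\<lambda>\<zeta>. indicator (ball 0 1) \<zeta> * cmod (\<kappa> \<zeta>))"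
      by (auto simp: norm_mult indicator_def)
    with integrable_norm[OF \<kappa>] show ?thesis by simp
  qed
  have int: "integrable lborel (\<lambda>\<zeta>. p \<zeta> * \<kappa> \<zeta>)"
    if [measurable]: "p \<in> borel_measurable borel" and p: "\<And>\<zeta>. cmod (p \<zeta>) \<le> C * indicator (ball 0 1) \<zeta>" for p C
  proof (rule Bochner_Integration.integrable_bound[OF intM[of C]])
    have "cmod (p \<zeta> * \<kappa> \<zeta>) \<le> \<bar>C * (indicator (ball 0 1) \<zeta> * cmod (\<kappa> \<zeta>))\<bar>" for \<zeta>
    proof -
      have "cmod (p \<zeta> * \<kappa> \<zeta>) \<le> C * indicator (ball 0 1) \<zeta> * cmod (\<kappa> \<zeta>)"
        unfolding norm_mult by (intro mult_right_mono p) simp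
      then show ?thesis by (simp add: mult.assoc)
    qed
    then show "AE \<zeta> in lborel. norm (p \<zeta> * \<kappa> \<zeta>) \<le> norm (C * (indicator (ball 0 1) \<zeta> * cmod (\<kappa> \<zeta>)))"
      by simp
  qed measurable
  have intq: "integrable lborel (\<lambda>\<zeta>. q t \<zeta> * \<kappa> \<zeta>)" "integrable lborel (\<lambda>\<zeta>. q' t \<zeta> * \<kappa> \<zeta>)" for t
    using int[OF qm qb] int[OF q'm bound] by auto
  \<comment> \<open>The first-order remainder divided by the increment. The mean value inequality
    bounds it by \<open>2 * M\<close> on the disk for all \<open>s \<noteq> t\<close>, so a multiple
    of \<open>cmod (\<kappa> \<zeta>)\<close>, cut off to the disk, dominates;
    \<open>\<kappa>\<close> itself may be singular.\<close>
  define R where "R = (\<lambda>s \<zeta>. (q s \<zeta> - (q t \<zeta> + (s - t) *\<^sub>R q' t \<zeta>)) /\<^sub>R \<bar>s - t\<bar>)"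
  have Rb: "cmod (R s \<zeta>) \<le> 2 * M * indicator (ball 0 1) \<zeta>" if "s \<noteq> t" for s \<zeta>
  proof -
    have "cmod (q s \<zeta> - q t \<zeta> - (s - t) *\<^sub>R q' t \<zeta>) \<le> cmod (q s \<zeta> - q t \<zeta>) + cmod ((s - t) *\<^sub>R q' t \<zeta>)"
      by (rule norm_triangle_ineq4)
    also have "\<dots> \<le> M * indicator (ball 0 1) \<zeta> * \<bar>s - t\<bar> + \<bar>s - t\<bar> * (M * indicator (ball 0 1) \<zeta>)"
      unfolding norm_scaleR
      by (intro add_mono mult_left_mono bound norm_diff_le_vector_derivative_bound[OF deriv bound]) auto
    finally have "cmod (q s \<zeta> - (q t \<zeta> + (s - t) *\<^sub>R q' t \<zeta>)) \<le> 2 * M * indicator (ball 0 1) \<zeta> * \<bar>s - t\<bar>"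
      by (simp add: algebra_simps)
    then show ?thesis using that by (simp add: R_def divide_simps mult.commute)
  qed
  have lim: "((\<lambda>s. LINT \<zeta>|lborel. R s \<zeta> * \<kappa> \<zeta>) \<longlongrightarrow> (LINT \<zeta>::complex|lborel. 0)) (at t)"
    unfolding tendsto_at_iff_sequentially comp_def
  proof (intro allI impI)
    fix X assume X: "\<forall>i. X i \<in> UNIV - {t}" "X \<longlonglongrightarrow> t"
    show "(\<lambda>i. LINT \<zeta>|lborel. R (X i) \<zeta> * \<kappa> \<zeta>) \<longlonglongrightarrow> (LINT \<zeta>::complex|lborel. 0 :: complex)"
    proof (rule integral_dominated_convergence[where
          w = "\<lambda>\<zeta>. 2 * M * (indicator (ball 0 1) \<zeta> * cmod (\<kappa> \<zeta>))"])
      show "(\<lambda>\<zeta>. R (X i) \<zeta> * \<kappa> \<zeta>) \<in> borel_measurable lborel" for i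
        unfolding R_def by measurable
      show "AE \<zeta> in lborel. (\<lambda>i. R (X i) \<zeta> * \<kappa> \<zeta>) \<longlonglongrightarrow> 0"
      proof (rule AE_I2)
        fix \<zeta>
        have "((\<lambda>s. R s \<zeta>) \<longlongrightarrow> 0) (at t)"
          using deriv[of \<zeta> t] unfolding has_vector_derivative_def has_derivative_within R_def
          by (simp add: divide_inverse mult.commute)
        then have "(\<lambda>i. R (X i) \<zeta>) \<longlonglongrightarrow> 0"
          using X by (simp add: tendsto_at_iff_sequentially comp_def)
        then show "(\<lambda>i. R (X i) \<zeta> * \<kappa> \<zeta>) \<longlonglongrightarrow> 0" by (rule tendsto_mult_left_zero)
      qed
      show "AE \<zeta> in lborel. norm (R (X i) \<zeta> * \<kappa> \<zeta>) \<le> 2 * M * (indicator (ball 0 1) \<zeta> * cmod (\<kappa> \<zeta>))" for i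
      proof (rule AE_I2)
        fix \<zeta>
        have "norm (R (X i) \<zeta> * \<kappa> \<zeta>) \<le> 2 * M * indicator (ball 0 1) \<zeta> * cmod (\<kappa> \<zeta>)"
          unfolding norm_mult using X by (intro mult_right_mono Rb) auto
        then show "norm (R (X i) \<zeta> * \<kappa> \<zeta>) \<le> 2 * M * (indicator (ball 0 1) \<zeta> * cmod (\<kappa> \<zeta>))"
          by (simp only: mult.assoc)
      qed
    qed (use intM in simp_all)
  qed
  define F where "F = (\<lambda>s. LINT \<zeta>|lborel. q s \<zeta> * \<kappa> \<zeta>)"
  define F' where "F' = (LINT \<zeta>|lborel. q' t \<zeta> * \<kappa> \<zeta>)"
  have eq: "(LINT \<zeta>|lborel. R s \<zeta> * \<kappa> \<zeta>) = (F s - (F t + (s - t) *\<^sub>R F')) /\<^sub>R \<bar>s - t\<bar>" for s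
  proof -
    have "(F s - (F t + (s - t) *\<^sub>R F')) /\<^sub>R \<bar>s - t\<bar>
        = (LINT \<zeta>|lborel. (q s \<zeta> * \<kappa> \<zeta> - (q t \<zeta> * \<kappa> \<zeta> + (s - t) *\<^sub>R (q' t \<zeta> * \<kappa> \<zeta>))) /\<^sub>R \<bar>s - t\<bar>)"
      unfolding F_def F'_def
      by (simp only: integral_scaleR_right Bochner_Integration.integral_add Bochner_Integration.integral_diff
        Bochner_Integration.integrable_add intq integrable_scaleR_right)
    also have "\<dots> = (LINT \<zeta>|lborel. R s \<zeta> * \<kappa> \<zeta>)"
      by (intro Bochner_Integration.integral_cong refl) (simp add: R_def scaleR_conv_of_real algebra_simps)
    finally show ?thesis by simp
  qed
  have "(F has_vector_derivative F') (at t)"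
    using lim unfolding eq has_vector_derivative_def has_derivative_within
    by (simp add: bounded_linear_scaleR_left divide_inverse mult.commute)
  then show ?thesis by (simp add: F_def F'_def)
qed

lemma integrable_cauchy_kernel:
  fixes z :: complex
  shows "integrable lborel (\<lambda>\<zeta>. indicator (ball 0 1) \<zeta> * (1 / (\<zeta> - z)))"
  using cauchy_T_integrable[OF disk_bdd_indicator[of "ball 0 1"], of z] by simp

lemma integrable_cauchy_S_kernel:
  "cmod z \<le> 1 \<Longrightarrow> integrable lborel (\<lambda>\<zeta>. indicator (ball 0 1) \<zeta> * (1 / (1 - z * cnj \<zeta>)))"
  using cauchy_S_integrable[OF disk_bdd_indicator[of "ball 0 1"], of z] by simp

text \<open>Rotating the argument of \<open>psi A\<close> amounts to rotating the density and multiplying it by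
  \<open>cis (- t)\<close>, and the density may be differentiated in \<open>t\<close>. This is valid up to
  the boundary, which is what makes \<open>psi A\<close> smooth there.\<close>

lemma psi_rotate_has_vector_derivative:
  assumes A: "continuous_on (ball 0 1) A" and MA: "\<And>z. z \<in> ball 0 1 \<Longrightarrow> cmod (A z) \<le> M0"
    and A': "continuous_on (ball 0 1) A'" and MA': "\<And>z. z \<in> ball 0 1 \<Longrightarrow> cmod (A' z) \<le> M"
    and deriv: "\<And>z t. z \<in> ball 0 1 \<Longrightarrow>
      ((\<lambda>t. cis (- t) * A (cis t * z)) has_vector_derivative cis (- t) * A' (cis t * z)) (at t)"
    and z: "cmod z \<le> 1"
  shows "((\<lambda>t. psi A (cis t * z)) has_vector_derivative psi A' (cis t * z)) (at t)"
proof -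
  define r where "r = (\<lambda>(B :: complex \<Rightarrow> complex) t \<zeta>. cis (- t) * B (cis t * \<zeta>))"
  define q where "q = (\<lambda>t. on_disk (r A t))"
  define q' where "q' = (\<lambda>t. on_disk (r A' t))"
  have contr: "continuous_on (ball 0 1) (r B t)" if "continuous_on (ball 0 1) B" for B t
    unfolding r_def by (intro continuous_intros continuous_on_compose2[OF that]) (auto simp: norm_mult)
  have qm: "q t \<in> borel_measurable borel" "q' t \<in> borel_measurable borel" for t
    unfolding q_def q'_def by (intro on_disk_measurable contr A A')+
  have qb: "cmod (q t \<zeta>) \<le> M0 * indicator (ball 0 1) \<zeta>" "cmod (q' t \<zeta>) \<le> M * indicator (ball 0 1) \<zeta>" for t \<zeta>
    using MA[of "cis t * \<zeta>"] MA'[of "cis t * \<zeta>"] by (auto simp: q_def q'_def r_def indicator_def norm_mult)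
  have qd: "((\<lambda>t. q t \<zeta>) has_vector_derivative q' t \<zeta>) (at t)" for t \<zeta>
    using deriv[of \<zeta> t] by (cases "\<zeta> \<in> ball 0 1") (auto simp: q_def q'_def r_def)
  have M0: "M0 \<ge> 0" "M \<ge> 0"
    using order_trans[OF norm_ge_zero MA[of 0]] order_trans[OF norm_ge_zero MA'[of 0]] by auto
  have bdd: "disk_bdd (q t)" "disk_bdd (q' t)" for t
    unfolding disk_bdd_def using qm qb[of t] M0 by blast+
  have T: "((\<lambda>t. cauchy_T (q t) w) has_vector_derivative cauchy_T (q' t) w) (at t)" for w t
    using has_vector_derivative_integral_kernel[OF qm _ integrable_cauchy_kernel[of w] qd qb]
    by (simp add: cauchy_T_def)
  have S: "((\<lambda>t. cauchy_S (\<lambda>\<zeta>. cnj (q t \<zeta>)) z) has_vector_derivative cauchy_S (\<lambda>\<zeta>. cnj (q' t \<zeta>)) z) (at t)" for t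
  proof -
    have 1: "(\<lambda>\<zeta>. cnj (q t \<zeta>)) \<in> borel_measurable borel" "(\<lambda>\<zeta>. cnj (q' t \<zeta>)) \<in> borel_measurable borel" for t
      using disk_bdd_measurable[OF disk_bdd_cnj[OF bdd(1)]] disk_bdd_measurable[OF disk_bdd_cnj[OF bdd(2)]] by auto
    have 2: "cmod (cnj (q t \<zeta>)) \<le> M0 * indicator (ball 0 1) \<zeta>" "cmod (cnj (q' t \<zeta>)) \<le> M * indicator (ball 0 1) \<zeta>" for t \<zeta>
      using qb[of t \<zeta>] by auto
    have 3: "((\<lambda>t. cnj (q t \<zeta>)) has_vector_derivative cnj (q' t \<zeta>)) (at t)" for t \<zeta>
      using qd by (rule has_vector_derivative_cnj)
    have 4: "(\<lambda>\<zeta>. 1 / (1 - z * cnj \<zeta>)) \<in> borel_measurable borel"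
      by (rule cauchy_S_integrand_measurable) simp
    show ?thesis
      using has_vector_derivative_integral_kernel[OF 1 4 integrable_cauchy_S_kernel[OF z] 3 2]
      by (simp add: cauchy_S_def)
  qed
  have bddA: "disk_bdd (on_disk A)" "disk_bdd (on_disk A')"
    using bdd[of 0] by (simp_all add: q_def q'_def r_def)
  have eq: "psi A (cis t * z) = - (1 / of_real pi) * cauchy_T (q t) z
     + 1 / (2 * of_real pi) * (cauchy_T (q t) 0 - cnj (cauchy_T (q t) 0))
     - 1 / of_real pi * (z * cauchy_S (\<lambda>\<zeta>. cnj (q t \<zeta>)) z)" for t
    using psi_eq[OF bdd(1)[unfolded q_def] z, of t] psi_rotate[OF bddA(1), of t z]
    by (simp add: q_def r_def)
  have eq': "psi A' (cis t * z) = - (1 / of_real pi) * cauchy_T (q' t) z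
     + 1 / (2 * of_real pi) * (cauchy_T (q' t) 0 - cnj (cauchy_T (q' t) 0))
     - 1 / of_real pi * (z * cauchy_S (\<lambda>\<zeta>. cnj (q' t \<zeta>)) z)" for t
    using psi_eq[OF bdd(2)[unfolded q'_def] z, of t] psi_rotate[OF bddA(2), of t z]
    by (simp add: q'_def r_def)
  show ?thesis unfolding eq eq'
    by (intro has_vector_derivative_add has_vector_derivative_diff has_vector_derivative_mult_right
        has_vector_derivative_cnj T S)
qed

section \<open>Families of smooth periodic functions\<close>

text \<open>\<open>csmooth k S F\<close>: the functions \<open>F p\<close> for \<open>p \<in> S\<close> are \<open>k\<close> times differentiable, with
  derivatives bounded uniformly in \<open>p\<close>.\<close>

primrec csmooth :: "nat \<Rightarrow> 'p set \<Rightarrow> ('p \<Rightarrow> real \<Rightarrow> complex) \<Rightarrow> bool" where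
  "csmooth 0 S F \<longleftrightarrow> (\<exists>B. \<forall>p\<in>S. \<forall>t. cmod (F p t) \<le> B)"
| "csmooth (Suc k) S F \<longleftrightarrow> (\<exists>B. \<forall>p\<in>S. \<forall>t. cmod (F p t) \<le> B) \<and>
     (\<exists>F'. (\<forall>p\<in>S. \<forall>t. (F p has_vector_derivative F' p t) (at t)) \<and> csmooth k S F')"

lemma csmooth_bounded: "csmooth k S F \<Longrightarrow> \<exists>B. \<forall>p\<in>S. \<forall>t. cmod (F p t) \<le> B"
  by (cases k) auto

lemma csmooth_bounded_nonneg:
  assumes "csmooth k S F"
  obtains B where "B \<ge> 0" "\<And>p t. p \<in> S \<Longrightarrow> cmod (F p t) \<le> B"
proof -
  obtain B where "\<forall>p\<in>S. \<forall>t. cmod (F p t) \<le> B" using csmooth_bounded[OF assms] by blast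
  then show thesis by (intro that[of "max B 0"]) (auto simp: le_max_iff_disj)
qed

lemma csmooth_SucI:
  assumes "csmooth 0 S F" "\<And>p t. p \<in> S \<Longrightarrow> (F p has_vector_derivative F' p t) (at t)" "csmooth k S F'"
  shows "csmooth (Suc k) S F"
  using assms by auto

lemma csmooth_SucE:
  assumes "csmooth (Suc k) S F"
  obtains F' where "\<And>p t. p \<in> S \<Longrightarrow> (F p has_vector_derivative F' p t) (at t)" "csmooth k S F'"
  using assms that unfolding csmooth.simps by blast

lemma csmooth_0: "csmooth k S F \<Longrightarrow> csmooth 0 S F"
  using csmooth_bounded by simp

lemma csmooth_Suc_imp: "csmooth (Suc k) S F \<Longrightarrow> csmooth k S F"
proof (induction k arbitrary: F)
  case 0
  then show ?case by simp
next
  case (Suc k)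
  obtain F' where F': "\<And>p t. p \<in> S \<Longrightarrow> (F p has_vector_derivative F' p t) (at t)" "csmooth (Suc k) S F'"
    using Suc.prems by (rule csmooth_SucE) blast
  show ?case
    by (rule csmooth_SucI[OF csmooth_0[OF Suc.prems] F'(1) Suc.IH[OF F'(2)]])
qed

lemma csmooth_cong:
  assumes "csmooth k S F" "\<And>p. p \<in> S \<Longrightarrow> F p = G p"
  shows "csmooth k S G"
  using assms by (cases k) auto

lemma csmooth_continuous:
  assumes "csmooth (Suc k) S F" "p \<in> S"
  shows "continuous_on A (F p)"
proof -
  obtain F' where "\<And>t. (F p has_vector_derivative F' p t) (at t)"
    using csmooth_SucE[OF assms(1)] assms(2) by metis
  then have "continuous_on UNIV (F p)"
    by (intro continuous_at_imp_continuous_on) (blast intro: has_vector_derivative_continuous)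
  then show ?thesis by (rule continuous_on_subset) simp
qed

lemma csmooth_add:
  assumes "csmooth k S F" "csmooth k S G"
  shows "csmooth k S (\<lambda>p t. F p t + G p t)"
  using assms
proof (induction k arbitrary: F G)
  case (0 F G)
  obtain B where "\<And>p t. p \<in> S \<Longrightarrow> cmod (F p t) \<le> B"
    by (rule csmooth_bounded_nonneg[OF 0(1)]) blast
  moreover obtain C where "\<And>p t. p \<in> S \<Longrightarrow> cmod (G p t) \<le> C"
    by (rule csmooth_bounded_nonneg[OF 0(2)]) blast
  ultimately show ?case
    by (auto intro!: exI[of _ "B + C"] norm_triangle_le add_mono)
next
  case (Suc k F G)
  obtain F' where F': "\<And>p t. p \<in> S \<Longrightarrow> (F p has_vector_derivative F' p t) (at t)" "csmooth k S F'"
    using Suc.prems(1) by (rule csmooth_SucE) blast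
  obtain G' where G': "\<And>p t. p \<in> S \<Longrightarrow> (G p has_vector_derivative G' p t) (at t)" "csmooth k S G'"
    using Suc.prems(2) by (rule csmooth_SucE) blast
  note d = F'(1) G'(1) F'(2) G'(2)
  show ?case
  proof (rule csmooth_SucI)
    show "csmooth 0 S (\<lambda>p t. F p t + G p t)"
      using Suc.IH[OF Suc.prems[THEN csmooth_Suc_imp]] by (rule csmooth_0)
    show "csmooth k S (\<lambda>p t. F' p t + G' p t)" by (rule Suc.IH[OF d(3,4)])
  qed (intro has_vector_derivative_add d)
qed

lemma csmooth_mult:
  assumes "csmooth k S F" "csmooth k S G"
  shows "csmooth k S (\<lambda>p t. F p t * G p t)"
  using assms
proof (induction k arbitrary: F G)
  case (0 F G)
  obtain B where "B \<ge> 0" "\<And>p t. p \<in> S \<Longrightarrow> cmod (F p t) \<le> B"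
    by (rule csmooth_bounded_nonneg[OF 0(1)]) blast
  moreover obtain C where "\<And>p t. p \<in> S \<Longrightarrow> cmod (G p t) \<le> C"
    by (rule csmooth_bounded_nonneg[OF 0(2)]) blast
  ultimately show ?case
    by (auto intro!: exI[of _ "B * C"] mult_mono simp: norm_mult)
next
  case (Suc k F G)
  obtain F' where F': "\<And>p t. p \<in> S \<Longrightarrow> (F p has_vector_derivative F' p t) (at t)" "csmooth k S F'"
    using Suc.prems(1) by (rule csmooth_SucE) blast
  obtain G' where G': "\<And>p t. p \<in> S \<Longrightarrow> (G p has_vector_derivative G' p t) (at t)" "csmooth k S G'"
    using Suc.prems(2) by (rule csmooth_SucE) blast
  note d = F'(1) G'(1) F'(2) G'(2)
  show ?case
  proof (rule csmooth_SucI)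
    show "csmooth 0 S (\<lambda>p t. F p t * G p t)"
      using Suc.IH[OF Suc.prems[THEN csmooth_Suc_imp]] by (rule csmooth_0)
    show "csmooth k S (\<lambda>p t. F p t * G' p t + F' p t * G p t)"
      by (intro csmooth_add Suc.IH d Suc.prems[THEN csmooth_Suc_imp])
  qed (intro has_vector_derivative_mult d)
qed

lemma csmooth_exp:
  assumes "csmooth k S F"
  shows "csmooth k S (\<lambda>p t. exp (F p t))"
  using assms
proof (induction k)
  case 0
  obtain B where B: "\<And>p t. p \<in> S \<Longrightarrow> cmod (F p t) \<le> B"
    by (rule csmooth_bounded_nonneg[OF 0]) blast
  have "cmod (exp (F p t)) \<le> exp B" if "p \<in> S" for p t
    unfolding norm_exp_eq_Re using B[OF that, of t] complex_Re_le_cmod[of "F p t"] by simp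
  then show ?case unfolding csmooth.simps by blast
next
  case (Suc k)
  obtain F' where d: "\<And>p t. p \<in> S \<Longrightarrow> (F p has_vector_derivative F' p t) (at t)" "csmooth k S F'"
    using Suc.prems by (rule csmooth_SucE) blast
  note IH = Suc.IH[OF Suc.prems[THEN csmooth_Suc_imp]]
  show ?case
  proof (rule csmooth_SucI)
    show "csmooth 0 S (\<lambda>p t. exp (F p t))" using IH by (rule csmooth_0)
    show "csmooth k S (\<lambda>p t. F' p t * exp (F p t))" by (rule csmooth_mult[OF d(2) IH])
    fix p t assume "p \<in> S"
    from field_vector_diff_chain_at[OF d(1)[OF this] DERIV_exp]
    show "((\<lambda>t. exp (F p t)) has_vector_derivative F' p t * exp (F p t)) (at t)"
      by (simp add: comp_def)
  qed
qed

lemma csmooth_bounded_linear: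
  assumes L: "bounded_linear L" and "csmooth k S F"
  shows "csmooth k S (\<lambda>p t. L (F p t))"
  using assms(2)
proof (induction k arbitrary: F)
  case (0 F)
  obtain B where B: "\<And>p t. p \<in> S \<Longrightarrow> cmod (F p t) \<le> B"
    by (rule csmooth_bounded_nonneg[OF 0]) blast
  obtain K where K: "K \<ge> 0" "\<And>x. norm (L x) \<le> norm x * K"
    using bounded_linear.nonneg_bounded[OF L] by blast
  have "cmod (L (F p t)) \<le> B * K" if "p \<in> S" for p t
    using K(2)[of "F p t"] mult_right_mono[OF B[OF that, of t] K(1)] by linarith
  then show ?case unfolding csmooth.simps by blast
next
  case (Suc k F)
  obtain F' where d: "\<And>p t. p \<in> S \<Longrightarrow> (F p has_vector_derivative F' p t) (at t)" "csmooth k S F'"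
    using Suc.prems by (rule csmooth_SucE) blast
  show ?case
  proof (rule csmooth_SucI)
    show "csmooth 0 S (\<lambda>p t. L (F p t))"
      using Suc.IH[OF Suc.prems[THEN csmooth_Suc_imp]] by (rule csmooth_0)
    show "csmooth k S (\<lambda>p t. L (F' p t))" by (rule Suc.IH[OF d(2)])
    show "p \<in> S \<Longrightarrow> ((\<lambda>t. L (F p t)) has_vector_derivative L (F' p t)) (at t)" for p t
      by (intro bounded_linear.has_vector_derivative[OF L] d)
  qed
qed

lemma has_vector_derivative_cis_scaled:
  "((\<lambda>t. c * cis (m * t)) has_vector_derivative (c * (\<i> * of_real m)) * cis (m * t)) (at t)"
proof -
  have "((\<lambda>t. m * t) has_vector_derivative m) (at t)"
    by (auto intro!: derivative_eq_intros simp: has_real_derivative_iff_has_vector_derivative[symmetric])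
  from vector_diff_chain_at[OF this has_vector_derivative_cis_mult[of c "m * t" UNIV]]
  show ?thesis by (simp add: comp_def scaleR_conv_of_real mult_ac)
qed

lemma csmooth_cis:
  assumes "\<And>p. p \<in> S \<Longrightarrow> cmod (c p) \<le> B"
  shows "csmooth k S (\<lambda>p t. c p * cis (m * t))"
  using assms
proof (induction k arbitrary: c B)
  case 0
  then show ?case by (auto simp: norm_mult)
next
  case (Suc k c B)
  show ?case
  proof (rule csmooth_SucI)
    show "csmooth 0 S (\<lambda>p t. c p * cis (m * t))" using Suc.prems by (auto simp: norm_mult)
    show "csmooth k S (\<lambda>p t. (c p * (\<i> * of_real m)) * cis (m * t))"
      by (rule Suc.IH[where B = "B * \<bar>m\<bar>"]) (use Suc.prems in \<open>auto simp: norm_mult intro!: mult_right_mono\<close>)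
  qed (rule has_vector_derivative_cis_scaled)
qed

lemma has_vector_derivative_periodic:
  fixes g :: "real \<Rightarrow> complex"
  assumes per: "\<And>t. g (t + a) = g t" and d: "\<And>t. (g has_vector_derivative g' t) (at t)"
  shows "g' (t + a) = g' t"
proof -
  have "((\<lambda>t. t + a) has_vector_derivative 1) (at t)"
    by (auto intro!: derivative_eq_intros simp: has_real_derivative_iff_has_vector_derivative[symmetric])
  from vector_diff_chain_at[OF this d[of "t + a"]]
  have "(g has_vector_derivative g' (t + a)) (at t)"
    by (simp add: comp_def per)
  then show ?thesis using d[of t] by (rule vector_derivative_unique_at)
qed

lemma periodic_bounded:
  fixes g :: "real \<Rightarrow> complex"
  assumes per: "\<And>t. g (t + 2 * pi) = g t" and cont: "continuous_on UNIV g"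
  shows "\<exists>B. \<forall>t. cmod (g t) \<le> B"
proof -
  have "compact (g ` {0..2 * pi})"
    by (intro compact_continuous_image continuous_on_subset[OF cont]) auto
  then obtain B where B: "\<And>t. t \<in> {0..2 * pi} \<Longrightarrow> cmod (g t) \<le> B"
    using compact_imp_bounded bounded_iff by (metis image_eqI)
  have shift: "g (t + of_int k * (2 * pi)) = g t" for t k
  proof (induction k rule: int_induct[where k = 0])
    case base then show ?case by simp
  next
    case (step1 i)
    then show ?case using per[of "t + of_int i * (2 * pi)"] by (simp add: algebra_simps)
  next
    case (step2 i)
    then show ?case using per[of "t + of_int (i - 1) * (2 * pi)"] by (simp add: algebra_simps)
  qed
  have "cmod (g t) \<le> B" for t
  proof -
    define k where "k = \<lfloor>t / (2 * pi)\<rfloor>"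
    have "of_int k \<le> t / (2 * pi)" "t / (2 * pi) \<le> of_int k + 1"
      unfolding k_def by linarith+
    then have "of_int k * (2 * pi) \<le> t" "t \<le> (of_int k + 1) * (2 * pi)"
      by (simp_all add: pos_le_divide_eq pos_divide_le_eq)
    then have "t + of_int (- k) * (2 * pi) \<in> {0..2 * pi}"
      by (simp add: algebra_simps)
    from B[OF this] show ?thesis by (simp only: shift)
  qed
  then show ?thesis by blast
qed

text \<open>All iterated derivatives are periodic and continuous, hence bounded; the family does not
  depend on its index, so uniformity is free.\<close>

lemma test_fun_imp_csmooth:
  assumes "test_fun \<phi>"
  shows "csmooth k S (\<lambda>_. \<phi>)"
proof -
  define d where "d = (\<lambda>j. ((\<lambda>g t. vector_derivative g (at t)) ^^ j) \<phi>)"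
  have d: "(d j has_vector_derivative d (Suc j) t) (at t)" for j t
    using assms unfolding test_fun_def d_def
    by (auto simp: vector_derivative_works[symmetric])
  have per: "d j (t + 2 * pi) = d j t" for j t
  proof (induction j arbitrary: t)
    case 0 then show ?case using assms by (simp add: d_def test_fun_def)
  next
    case (Suc j)
    show ?case by (rule has_vector_derivative_periodic[OF Suc.IH d])
  qed
  have bd: "csmooth 0 S (\<lambda>_. d j)" for j
  proof -
    have "continuous_on UNIV (d j)"
      by (intro continuous_at_imp_continuous_on) (blast intro: has_vector_derivative_continuous d)
    from periodic_bounded[OF per this] show ?thesis by auto
  qed
  have "csmooth k S (\<lambda>_. d j)" for j
    by (induction k arbitrary: j) (use bd in \<open>auto intro!: csmooth_SucI[OF bd d] simp del: csmooth.simps\<close>)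
  from this[of 0] show ?thesis by (simp add: d_def)
qed

lemma csmooth_imp_test_fun:
  assumes "\<And>k. csmooth k S F" "p \<in> S" "\<And>t. F p (t + 2 * pi) = F p t"
  shows "test_fun (F p)"
proof -
  have "((\<lambda>g t. vector_derivative g (at t)) ^^ j) (F p) differentiable (at t)" for j t
    using assms(1)
  proof (induction j arbitrary: F)
    case (0 F)
    have "csmooth (Suc 0) S F" by (rule 0)
    then obtain F' where "\<And>p t. p \<in> S \<Longrightarrow> (F p has_vector_derivative F' p t) (at t)"
      by (rule csmooth_SucE) blast
    then show ?case using assms(2) by (auto intro: differentiableI_vector)
  next
    case (Suc j F)
    \<comment> \<open>\<open>csmooth\<close> only asserts that some derivative family exists;
      uniqueness of derivatives identifies it with the iterated operator in
      \<open>test_fun\<close>.\<close>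
    define F' where "F' = (\<lambda>p t. vector_derivative (F p) (at t))"
    have "csmooth k S F'" for k
    proof -
      have "csmooth (Suc k) S F" by (rule Suc.prems)
      then obtain F'' where F'': "\<And>p t. p \<in> S \<Longrightarrow> (F p has_vector_derivative F'' p t) (at t)" "csmooth k S F''"
        by (rule csmooth_SucE) blast
      show ?thesis
        by (rule csmooth_cong[OF F''(2)]) (auto simp: F'_def F''(1)[THEN vector_derivative_at])
    qed
    from Suc.IH[OF this] show ?case
      by (simp add: funpow_Suc_right F'_def del: funpow.simps)
  qed
  with assms(3) show ?thesis by (simp add: test_fun_def)
qed

text \<open>Integration by parts \<open>k\<close> times: the boundary terms cancel by periodicity,
  and what remains is estimated by the uniform bound on the \<open>k\<close>-th derivatives.\<close>

lemma fourier_coeff_bound: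
  assumes "csmooth k S F" "\<And>p t. p \<in> S \<Longrightarrow> F p (t + 2 * pi) = F p t"
  shows "\<exists>B. \<forall>p\<in>S. \<forall>n. cmod (integral {0..2*pi} (\<lambda>t. F p t * cis (real n * t))) * real n ^ k \<le> B"
  using assms
proof (induction k arbitrary: F)
  case (0 F)
  obtain B where B: "B \<ge> 0" "\<And>p t. p \<in> S \<Longrightarrow> cmod (F p t) \<le> B"
    by (rule csmooth_bounded_nonneg[OF 0(1)]) blast
  \<comment> \<open>\<open>csmooth 0\<close> gives boundedness without continuity. If the integrand
    is not integrable, \<open>integral\<close> takes its default value 0 and the bound holds all the
    same.\<close>
  have "cmod (integral {0..2*pi} (\<lambda>t. F p t * cis (real n * t))) \<le> B * (2 * pi)" if "p \<in> S" for p n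
  proof (cases "(\<lambda>t. F p t * cis (real n * t)) integrable_on {0..2*pi}")
    case True
    have "cmod (integral {0..2*pi} (\<lambda>t. F p t * cis (real n * t))) \<le> B * measure lborel {0..2*pi}"
      by (rule has_integral_bound_real[OF B(1) finite.emptyI integrable_integral[OF True]])
         (use B(2)[OF that] in \<open>auto simp: norm_mult\<close>)
    then show ?thesis by simp
  qed (use B(1) in \<open>simp add: not_integrable_integral\<close>)
  then show ?case by auto
next
  case (Suc k F)
  obtain F' where d: "\<And>p t. p \<in> S \<Longrightarrow> (F p has_vector_derivative F' p t) (at t)" "csmooth k S F'"
    using Suc.prems(1) by (rule csmooth_SucE) blast
  have per': "p \<in> S \<Longrightarrow> F' p (t + 2 * pi) = F' p t" for p t
    by (rule has_vector_derivative_periodic[OF Suc.prems(2) d(1)])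
  obtain B where B: "\<And>p n. p \<in> S \<Longrightarrow> cmod (integral {0..2*pi} (\<lambda>t. F' p t * cis (real n * t))) * real n ^ k \<le> B"
    using Suc.IH[OF d(2) per'] by blast
  \<comment> \<open>The maximum with 0 serves the case \<open>n = 0\<close>, where the left-hand
    side is 0.\<close>
  have "cmod (integral {0..2*pi} (\<lambda>t. F p t * cis (real n * t))) * real n ^ Suc k \<le> max 0 B"
    if p: "p \<in> S" for p n
  proof (cases "n = 0")
    case False
    let ?I = "integral {0..2*pi} (\<lambda>t. F p t * cis (real n * t))"
    let ?J = "integral {0..2*pi} (\<lambda>t. F' p t * cis (real n * t))"
    have i1: "(\<lambda>t. \<i> * of_real (real n) * (F p t * cis (real n * t))) integrable_on {0..2*pi}"
      by (intro integrable_continuous_interval continuous_intros csmooth_continuous[OF Suc.prems(1) p])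
    have "((\<lambda>t. F p t * (\<i> * of_real (real n) * cis (real n * t)) + F' p t * cis (real n * t)) has_integral
        (F p (2*pi) * cis (real n * (2*pi)) - F p 0 * cis (real n * 0))) {0..2*pi}"
    proof (rule fundamental_theorem_of_calculus)
      fix t assume "t \<in> {0..2*pi}"
      have "((\<lambda>t. F p t * cis (real n * t)) has_vector_derivative
         F p t * (\<i> * of_real (real n) * cis (real n * t)) + F' p t * cis (real n * t)) (at t)"
        using has_vector_derivative_mult[OF d(1)[OF p] has_vector_derivative_cis_scaled[of 1 "real n"], of t]
        by simp
      then show "((\<lambda>t. F p t * cis (real n * t)) has_vector_derivative
         F p t * (\<i> * of_real (real n) * cis (real n * t)) + F' p t * cis (real n * t)) (at t within {0..2*pi})"
        by (rule has_vector_derivative_at_within)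
    qed simp
    moreover have "F p (2*pi) = F p 0" using Suc.prems(2)[OF p, of 0] by simp
    moreover have "cis (real n * (2 * pi)) = 1"
      using cis_multiple_2pi[of "real n"] by (simp add: mult_ac)
    ultimately have tot: "((\<lambda>t. \<i> * of_real (real n) * (F p t * cis (real n * t)) + F' p t * cis (real n * t))
        has_integral 0) {0..2*pi}"
      by (simp add: mult_ac)
    have i2: "(\<lambda>t. F' p t * cis (real n * t)) integrable_on {0..2*pi}"
      using integrable_diff[OF has_integral_integrable[OF tot] i1] by simp
    have "\<i> * of_real (real n) * ?I + ?J = 0"
      using integral_add[OF i1 i2] integral_unique[OF tot] by simp
    then have "?J = - (\<i> * of_real (real n) * ?I)" by (simp add: eq_neg_iff_add_eq_0 add.commute)
    then have "cmod ?J = real n * cmod ?I" by (simp add: norm_mult)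
    then have "cmod ?I * real n ^ Suc k = cmod ?J * real n ^ k" by simp
    also have "\<dots> \<le> max 0 B" using B[OF p, of n] by simp
    finally show ?thesis .
  qed simp
  then show ?case by blast
qed

section \<open>Taylor coefficients and boundary values\<close>

lemma integral_cis_multiple:
  fixes m :: int
  assumes "m \<noteq> 0"
  shows "integral {0..2*pi} (\<lambda>t. cis (real_of_int m * t)) = 0"
proof -
  define \<mu> where "\<mu> = real_of_int m"
  define k where "k = 1 / (\<i> * complex_of_real \<mu>)"
  have \<mu>: "\<mu> \<noteq> 0" using assms by (simp add: \<mu>_def)
  have k: "k * (\<i> * complex_of_real \<mu>) = 1" using \<mu> by (simp add: k_def)
  have "((\<lambda>t. k * cis (\<mu> * t)) has_vector_derivative cis (\<mu> * t)) (at t within {0..2*pi})" for t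
    using has_vector_derivative_at_within[OF has_vector_derivative_cis_scaled[of k \<mu> t]]
    by (simp only: k mult_1_left)
  then have "((\<lambda>t. cis (\<mu> * t)) has_integral (k * cis (\<mu> * (2*pi)) - k * cis (\<mu> * 0))) {0..2*pi}"
    by (intro fundamental_theorem_of_calculus[where f = "\<lambda>t. k * cis (\<mu> * t)"]) simp_all
  moreover have "cis (\<mu> * (2 * pi)) = 1"
    using cis_multiple_2pi[of \<mu>] by (simp add: \<mu>_def mult_ac)
  ultimately show ?thesis by (simp add: integral_unique \<mu>_def)
qed

lemma integral_series_sums:
  fixes f :: "nat \<Rightarrow> real \<Rightarrow> complex"
  assumes bound: "\<And>n t. t \<in> {a..b} \<Longrightarrow> cmod (f n t) \<le> M n" and M: "summable M"
    and cont: "\<And>n. continuous_on {a..b} (f n)"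
  shows "(\<lambda>n. integral {a..b} (f n)) sums integral {a..b} (\<lambda>t. \<Sum>n. f n t)"
proof -
  have "uniform_limit {a..b} (\<lambda>n t. \<Sum>i<n. f i t) (\<lambda>t. \<Sum>i. f i t) sequentially"
    by (rule Weierstrass_m_test[OF bound M])
  then obtain I J where IJ: "\<And>n. ((\<lambda>t. \<Sum>i<n. f i t) has_integral I n) {a..b}"
    "((\<lambda>t. \<Sum>i. f i t) has_integral J) {a..b}" "I \<longlonglongrightarrow> J"
    by (rule uniform_limit_integral) (auto intro!: continuous_on_sum cont)
  have "integral {a..b} (\<lambda>t. \<Sum>i<n. f i t) = (\<Sum>i<n. integral {a..b} (f i))" for n
    by (intro integral_sum) (auto intro: integrable_continuous_interval cont)
  then have "I = (\<lambda>n. \<Sum>i<n. integral {a..b} (f i))"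
    using IJ(1)[THEN integral_unique] by auto
  then show ?thesis using IJ(3) integral_unique[OF IJ(2)] by (simp add: sums_def)
qed

definition taylor0 :: "(complex \<Rightarrow> complex) \<Rightarrow> nat \<Rightarrow> complex" where
  "taylor0 h n = (deriv ^^ n) h 0 / fact n"

lemma taylor0_sums:
  assumes "h holomorphic_on ball 0 1" "cmod z < 1"
  shows "(\<lambda>n. taylor0 h n * z ^ n) sums h z"
  using holomorphic_power_series[OF assms(1), of z] assms(2) by (simp add: taylor0_def)

lemma taylor0_abs_summable:
  assumes "h holomorphic_on ball 0 1" "0 \<le> r" "r < 1"
  shows "summable (\<lambda>n. cmod (taylor0 h n) * r ^ n)"
proof -
  have "summable (\<lambda>n. norm (taylor0 h n * of_real r ^ n))"
  proof (rule powser_insidea)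
    show "summable (\<lambda>n. taylor0 h n * of_real ((1 + r) / 2) ^ n)"
      by (rule sums_summable, rule taylor0_sums[OF assms(1)], unfold norm_of_real) (use assms(2,3) in simp)
    show "norm (complex_of_real r) < norm (complex_of_real ((1 + r) / 2))"
      unfolding norm_of_real using assms(2,3) by simp
  qed
  then show ?thesis using assms(2) by (simp add: norm_mult norm_power)
qed

text \<open>On a circle of radius below 1 the Taylor series converges uniformly and may be
  integrated term by term. A pairing thus sees \<open>\<phi>\<close> only through its integrals
  against \<open>cis (real n * t)\<close> with \<open>n \<ge> 0\<close>.\<close>

lemma circle_pairing_sums:
  assumes h: "h holomorphic_on ball 0 1" and r: "0 \<le> r" "r < 1"
    and cont: "continuous_on {0..2*pi} \<phi>"
  shows "(\<lambda>n. taylor0 h n * of_real r ^ n * integral {0..2*pi} (\<lambda>t. \<phi> t * cis (real n * t)))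
      sums integral {0..2*pi} (\<lambda>t. h (of_real r * cis t) * \<phi> t)"
proof -
  have "compact (\<phi> ` {0..2 * pi})" by (intro compact_continuous_image cont) auto
  then obtain B where B: "\<And>t. t \<in> {0..2 * pi} \<Longrightarrow> cmod (\<phi> t) \<le> B"
    using compact_imp_bounded bounded_iff by (metis image_eqI)
  define f where "f = (\<lambda>n t. taylor0 h n * of_real r ^ n * (\<phi> t * cis (real n * t)))"
  have "(\<lambda>n. integral {0..2*pi} (f n)) sums integral {0..2*pi} (\<lambda>t. \<Sum>n. f n t)"
  proof (rule integral_series_sums)
    fix n t assume "t \<in> {0..2*pi}"
    then show "cmod (f n t) \<le> cmod (taylor0 h n) * r ^ n * B"
      unfolding f_def norm_mult norm_power using r B[of t] by (auto intro!: mult_left_mono)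
  next
    show "continuous_on {0..2*pi} (f n)" for n unfolding f_def
      by (intro continuous_intros cont)
  qed (intro summable_mult2 taylor0_abs_summable h r)
  moreover have "(\<Sum>n. f n t) = h (of_real r * cis t) * \<phi> t" for t
  proof -
    have "(\<lambda>n. taylor0 h n * (of_real r * cis t) ^ n * \<phi> t) sums (h (of_real r * cis t) * \<phi> t)"
      using r by (intro sums_mult2 taylor0_sums h) (simp add: norm_mult)
    then have "f' = (\<lambda>n. f n t) \<Longrightarrow> f' sums (h (of_real r * cis t) * \<phi> t)" for f'
      by (simp add: f_def power_mult_distrib Complex.DeMoivre mult_ac)
    then show ?thesis by (intro sums_unique[symmetric]) simp
  qed
  ultimately show ?thesis by (simp add: f_def)
qed

section \<open>Fourier series with rapidly decreasing coefficients\<close>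

definition rapidly_decreasing :: "(nat \<Rightarrow> complex) \<Rightarrow> bool" where
  "rapidly_decreasing b \<longleftrightarrow> (\<forall>k. \<exists>C. \<forall>n. cmod (b n) * real n ^ k \<le> C)"

lemma rapidly_decreasing_summable:
  assumes "rapidly_decreasing b"
  shows "summable (\<lambda>n. cmod (b n))"
proof -
  obtain C where C: "\<And>n. cmod (b n) * real n ^ 2 \<le> C"
    using assms unfolding rapidly_decreasing_def by blast
  show ?thesis
  proof (rule summable_comparison_test_ev)
  show "\<forall>\<^sub>F n in sequentially. norm (cmod (b n)) \<le> C * (1 / real n ^ 2)"
    using eventually_gt_at_top[of 0]
  proof eventually_elim
    case (elim n)
    then show ?case using C[of n] by (simp add: field_simps)
  qed
  show "summable (\<lambda>n. C * (1 / real n ^ 2))"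
    using inverse_power_summable[of 2, where 'a = real] by (intro summable_mult) (simp add: inverse_eq_divide)
  qed
qed

text \<open>The factor is the one that differentiating \<open>cis (- real n * t)\<close> brings
  down, so the class is closed under termwise differentiation.\<close>

lemma rapidly_decreasing_mult_nat:
  assumes b: "rapidly_decreasing b"
  shows "rapidly_decreasing (\<lambda>n. b n * (\<i> * of_real (- real n)))"
  unfolding rapidly_decreasing_def
proof
  fix k
  obtain C where "\<And>n. cmod (b n) * real n ^ Suc k \<le> C"
    using b unfolding rapidly_decreasing_def by blast
  then show "\<exists>C. \<forall>n. cmod (b n * (\<i> * of_real (- real n))) * real n ^ k \<le> C"
    by (auto intro!: exI[of _ C] simp: norm_mult mult_ac)
qed

text \<open>The frequencies are negative because pairing with a Taylor series integrates against
  \<open>cis (real n * t)\<close>, which picks out exactly these. Uniform convergence of the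
  differentiated series justifies the termwise derivative.\<close>

lemma fourier_series_has_vector_derivative:
  assumes b: "rapidly_decreasing b"
  shows "((\<lambda>t. \<Sum>n. b n * cis (- real n * t)) has_vector_derivative
    (\<Sum>n. b n * (\<i> * of_real (- real n)) * cis (- real n * t))) (at t)"
proof -
  define f where "f = (\<lambda>n t. b n * cis (- real n * t))"
  define f' where "f' = (\<lambda>n t. b n * (\<i> * of_real (- real n)) * cis (- real n * t))"
  note b' = rapidly_decreasing_mult_nat[OF b]
  have unif: "uniform_limit UNIV (\<lambda>n t. \<Sum>i<n. f' i t) (\<lambda>t. \<Sum>i. f' i t) sequentially"
    by (rule Weierstrass_m_test[OF _ rapidly_decreasing_summable[OF b']]) (simp add: f'_def norm_mult)
  have "\<exists>g. \<forall>x\<in>UNIV. (\<lambda>n. f n x) sums (g x) \<and>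
      (g has_derivative (\<lambda>h. h *\<^sub>R (\<Sum>i. f' i x))) (at x within UNIV)"
  proof (rule has_derivative_series)
    show "(f n has_derivative (\<lambda>h. h *\<^sub>R f' n x)) (at x within UNIV)" for n x
      using has_vector_derivative_cis_scaled[of "b n" "- real n" x]
      by (simp add: has_vector_derivative_def f_def f'_def)
    show "\<forall>\<^sub>F n in sequentially. \<forall>x\<in>UNIV. \<forall>h. norm ((\<Sum>i<n. h *\<^sub>R f' i x) - h *\<^sub>R (\<Sum>i. f' i x)) \<le> e * norm h"
      if "e > 0" for e
      using uniform_limitD[OF unif that]
    proof eventually_elim
      case (elim n)
      show ?case
      proof (intro ballI allI)
        fix x h :: real
        have "norm ((\<Sum>i<n. h *\<^sub>R f' i x) - h *\<^sub>R (\<Sum>i. f' i x))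
            = \<bar>h\<bar> * norm ((\<Sum>i<n. f' i x) - (\<Sum>i. f' i x))"
          by (simp only: scaleR_sum_right[symmetric] scaleR_diff_right[symmetric] norm_scaleR)
        also have "\<dots> \<le> \<bar>h\<bar> * e"
          using elim[rule_format, of x] by (intro mult_left_mono) (auto simp: dist_norm)
        finally show "norm ((\<Sum>i<n. h *\<^sub>R f' i x) - h *\<^sub>R (\<Sum>i. f' i x)) \<le> e * norm h"
          by (simp add: mult.commute)
      qed
    qed
    show "(\<lambda>n. f n 0) sums (\<Sum>n. f n 0)"
      using rapidly_decreasing_summable[OF b]
      by (intro summable_sums summable_norm_cancel[of "\<lambda>n. f n 0"]) (simp add: f_def norm_mult)
  qed auto
  then obtain g where g: "\<And>x. (\<lambda>n. f n x) sums (g x)"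
      "\<And>x. (g has_vector_derivative (\<Sum>i. f' i x)) (at x)"
    by (auto simp: has_vector_derivative_def)
  have "g = (\<lambda>x. \<Sum>n. f n x)" using g(1) by (auto simp: sums_iff)
  then show ?thesis using g(2)[of t] by (simp add: f_def f'_def)
qed

lemma csmooth_fourier_series:
  fixes S :: "'p set"
  assumes "rapidly_decreasing b"
  shows "csmooth k S (\<lambda>_ t. \<Sum>n. b n * cis (- real n * t))"
proof -
  have bounded: "csmooth 0 S (\<lambda>_ t. \<Sum>n. b n * cis (- real n * t))" if b: "rapidly_decreasing b" for b
  proof -
    have "cmod (\<Sum>n. b n * cis (- real n * t)) \<le> (\<Sum>n. cmod (b n))" for t
    proof -
      have "cmod (\<Sum>n. b n * cis (- real n * t)) \<le> (\<Sum>n. cmod (b n * cis (- real n * t)))"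
        using rapidly_decreasing_summable[OF b] by (intro summable_norm) (simp add: norm_mult)
      then show ?thesis by (simp add: norm_mult)
    qed
    then show ?thesis by auto
  qed
  show ?thesis using assms
  proof (induction k arbitrary: b)
    case 0
    then show ?case by (rule bounded)
  next
    case (Suc k b)
    show ?case
    proof (rule csmooth_SucI)
      show "csmooth k S (\<lambda>_ t. \<Sum>n. b n * (\<i> * of_real (- real n)) * cis (- real n * t))"
        by (rule Suc.IH) (rule rapidly_decreasing_mult_nat[OF Suc.prems])
    qed (rule bounded fourier_series_has_vector_derivative, rule Suc.prems)+
  qed
qed

text \<open>Orthogonality of the exponentials. Negative \<open>m\<close> is included for the
  conjugate half of the Poisson kernel.\<close>

lemma fourier_series_coeff_int:
  fixes m :: int
  assumes b: "rapidly_decreasing b"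
  shows "integral {0..2*pi} (\<lambda>t. (\<Sum>n. b n * cis (- real n * t)) * cis (real_of_int m * t))
    = (if m \<ge> 0 then 2 * of_real pi * b (nat m) else 0)"
proof -
  define f where "f = (\<lambda>n t. b n * cis (- real n * t) * cis (real_of_int m * t))"
  have "(\<lambda>n. integral {0..2*pi} (f n)) sums integral {0..2*pi} (\<lambda>t. \<Sum>n. f n t)"
    by (rule integral_series_sums[OF _ rapidly_decreasing_summable[OF b]])
       (auto simp: f_def norm_mult intro!: continuous_intros)
  moreover have "integral {0..2*pi} (f n) = (if int n = m then 2 * of_real pi * b n else 0)" for n
  proof -
    have "f n = (\<lambda>t. b n * cis (real_of_int (m - int n) * t))"
      by (auto simp: f_def mult.assoc cis_mult algebra_simps)
    then have "integral {0..2*pi} (f n) = b n * integral {0..2*pi} (\<lambda>t. cis (real_of_int (m - int n) * t))"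
      by (simp only: integral_mult_right)
    also have "\<dots> = (if int n = m then 2 * of_real pi * b n else 0)"
      using integral_cis_multiple[of "m - int n"] by (auto simp: scaleR_conv_of_real)
    finally show ?thesis .
  qed
  moreover have "(\<lambda>n. if int n = m then 2 * of_real pi * b n else 0) sums
      (if m \<ge> 0 then 2 * of_real pi * b (nat m) else 0)"
  proof (cases "m \<ge> 0")
    case True
    then have "(\<lambda>n. if int n = m then 2 * of_real pi * b n else 0)
        = (\<lambda>n. if n = nat m then 2 * of_real pi * b n else 0)" by (intro ext) auto
    then show ?thesis using sums_single[of "nat m" "\<lambda>n. 2 * of_real pi * b n"] True by simp
  next
    case False
    then have "(\<lambda>n. if int n = m then 2 * of_real pi * b n else 0) = (\<lambda>n. 0)" by (intro ext) auto
    then show ?thesis using False by simp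
  qed
  moreover have "(\<Sum>n. f n t) = (\<Sum>n. b n * cis (- real n * t)) * cis (real_of_int m * t)" for t
    unfolding f_def using rapidly_decreasing_summable[OF b]
    by (intro suminf_mult2[symmetric] summable_norm_cancel[of "\<lambda>n. b n * cis (- real n * t)"]) (simp add: norm_mult)
  ultimately show ?thesis by (simp add: sums_iff)
qed

lemma fourier_series_coeff:
  assumes b: "rapidly_decreasing b"
  shows "integral {0..2*pi} (\<lambda>t. (\<Sum>n. b n * cis (- real n * t)) * cis (real m * t)) = 2 * of_real pi * b m"
  using fourier_series_coeff_int[OF b, of "int m"] by simp

lemma cis_periodic_nat: "cis (- real n * (t + 2 * pi)) = cis (- real n * t)"
proof -
  have eq: "- real n * (t + 2 * pi) = - real n * t + 2 * pi * of_int (- int n)"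
    by (simp add: algebra_simps)
  have "cis (2 * pi * of_int (- int n)) = 1" by (rule cis_multiple_2pi) (rule Ints_of_int)
  then show ?thesis unfolding eq cis_mult[symmetric] by (simp only: mult_1_right)
qed

text \<open>If the Taylor coefficients grew faster than every power along a sequence, the lacunary
  Fourier series with the reciprocal coefficients would be a test function on which the pairing diverges.\<close>

lemma Hb_coeff_growth:
  assumes h: "h \<in> Hb"
  obtains N C where "\<And>n. cmod (taylor0 h n) \<le> C * (real n + 1) ^ N"
proof -
  define a where "a = taylor0 h"
  have hol: "h holomorphic_on ball 0 1" and bv: "has_bv h" using h by (auto simp: Hb_def)
  have "\<exists>N m. \<forall>n\<ge>m. cmod (a n) \<le> real n ^ N"
  proof (rule ccontr)
    assume "\<not> ?thesis"
    then have big: "\<exists>n\<ge>m. cmod (a n) > real n ^ N" for N m by (meson not_le)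
    \<comment> \<open>A single subsequence defeats all exponents: the coefficient at its
      \<open>j\<close>-th index beats the power \<open>j\<close>. Indices are at least 1, so that
      higher powers are not smaller.\<close>
    have "\<exists>\<nu>. \<forall>j. (\<nu> j \<ge> 1 \<and> cmod (a (\<nu> j)) > real (\<nu> j) ^ j) \<and> \<nu> j < \<nu> (Suc j)"
    proof (rule dependent_nat_choice)
      show "\<exists>x\<ge>1. cmod (a x) > real x ^ 0" using big by blast
      show "\<exists>y. (y \<ge> 1 \<and> cmod (a y) > real y ^ Suc n) \<and> x < y" for x n
      proof -
        obtain y where "y \<ge> Suc x" "cmod (a y) > real y ^ Suc n" using big by blast
        then show ?thesis by (intro exI[of _ y]) auto
      qed
    qed
    then obtain \<nu> where \<nu>: "\<And>j. \<nu> j \<ge> 1" "\<And>j. cmod (a (\<nu> j)) > real (\<nu> j) ^ j" "\<And>j. \<nu> j < \<nu> (Suc j)"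
      by blast
    have inj: "strict_mono \<nu>" using \<nu>(3) by (simp add: strict_mono_Suc_iff)
    \<comment> \<open>With reciprocal coefficients each selected term of the pairing at radius
      \<open>r\<close> equals \<open>2 * pi * r ^ n\<close>, so nothing can cancel.\<close>
    define b where "b = (\<lambda>n. if n \<in> range \<nu> then 1 / a n else 0)"
    have rapid: "rapidly_decreasing b" unfolding rapidly_decreasing_def
    proof
      fix k
      \<comment> \<open>For \<open>j \<ge> k\<close> the growth of \<open>a (\<nu> j)\<close> bounds
        the product by 1; the finitely many earlier indices are collected in the sum.\<close>
      define C where "C = 1 + (\<Sum>j<k. cmod (b (\<nu> j)) * real (\<nu> j) ^ k)"
      have Cge: "C \<ge> 1" by (simp add: C_def sum_nonneg)
      have "cmod (b n) * real n ^ k \<le> C" for n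
      proof (cases "n \<in> range \<nu>")
        case False then show ?thesis using Cge by (simp add: b_def)
      next
        case True
        then obtain j where j: "n = \<nu> j" by blast
        show ?thesis
        proof (cases "j < k")
          case True
          have "cmod (b (\<nu> j)) * real (\<nu> j) ^ k \<le> (\<Sum>j<k. cmod (b (\<nu> j)) * real (\<nu> j) ^ k)"
            using True by (intro member_le_sum) auto
          then show ?thesis by (simp add: C_def j)
        next
          case False
          have "real n ^ k \<le> real n ^ j" using False \<nu>(1)[of j] j by (intro power_increasing) auto
          also have "\<dots> \<le> cmod (a n)" using \<nu>(2)[of j] j by simp
          finally have "real n ^ k \<le> cmod (a n)" .
          moreover have "0 < cmod (a n)" using \<nu>(2)[of j] j le_less_trans[of 0 "real n ^ j" "cmod (a n)"] by simp
          ultimately have "cmod (b n) * real n ^ k \<le> 1"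
            using True by (simp add: b_def norm_divide)
          then show ?thesis using Cge by linarith
        qed
      qed
      then show "\<exists>C. \<forall>n. cmod (b n) * real n ^ k \<le> C" by blast
    qed
    define \<phi> where "\<phi> = (\<lambda>t. \<Sum>n. b n * cis (- real n * t))"
    have per: "\<phi> (t + 2 * pi) = \<phi> t" for t unfolding \<phi>_def cis_periodic_nat ..
    have sm: "csmooth k (UNIV :: unit set) (\<lambda>_. \<phi>)" for k
      unfolding \<phi>_def by (rule csmooth_fourier_series[OF rapid])
    have test: "test_fun \<phi>"
      by (rule csmooth_imp_test_fun[where F = "\<lambda>_::unit. \<phi>" and S = UNIV and p = "()", OF sm _ per]) simp
    obtain L where L: "(circle_pairing h \<phi> \<longlongrightarrow> L) (at_left 1)"
      using bv test unfolding has_bv_def by blast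
    have cont: "continuous_on {0..2*pi} \<phi>"
      by (rule csmooth_continuous[OF sm, of "()"]) simp
    define ind where "ind = (\<lambda>n. if n \<in> range \<nu> then 1 else 0 :: real)"
    have ab: "a n * b n = of_real (ind n)" for n
    proof (cases "n \<in> range \<nu>")
      case True
      then obtain j where "n = \<nu> j" by blast
      then have "a n \<noteq> 0" using \<nu>(2)[of j] by (auto simp: not_less)
      then show ?thesis using True by (simp add: b_def ind_def)
    qed (simp add: b_def ind_def)
    have sums: "(\<lambda>n. 2 * pi * (ind n * r ^ n)) sums Re (circle_pairing h \<phi> r)" if r: "0 \<le> r" "r < 1" for r
    proof -
      have "(\<lambda>n. a n * of_real r ^ n * (2 * of_real pi * b n)) sums circle_pairing h \<phi> r"
        using circle_pairing_sums[OF hol r cont] unfolding a_def circle_pairing_def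
        by (simp only: \<phi>_def fourier_series_coeff[OF rapid])
      also have "(\<lambda>n. a n * of_real r ^ n * (2 * of_real pi * b n)) = (\<lambda>n. of_real (2 * pi * (ind n * r ^ n)))"
        using ab by (auto simp: mult_ac fun_eq_iff)
      finally show ?thesis using sums_Re by fastforce
    qed
    \<comment> \<open>Since the terms are nonnegative, every partial sum is bounded by the whole
      pairing and hence, as \<open>r\<close> tends to 1, by \<open>Re L\<close>, although the number
      of selected indices is unbounded.\<close>
    have part: "2 * pi * (\<Sum>n<K. ind n) \<le> Re L" for K
    proof (rule tendsto_le)
      show "((\<lambda>r. Re (circle_pairing h \<phi> r)) \<longlongrightarrow> Re L) (at_left 1)" by (intro tendsto_Re L)
      have "((\<lambda>r. \<Sum>n<K. 2 * pi * (ind n * r ^ n)) \<longlongrightarrow> (\<Sum>n<K. 2 * pi * (ind n * 1 ^ n))) (at_left 1)"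
        by (intro tendsto_intros)
      then show "((\<lambda>r. \<Sum>n<K. 2 * pi * (ind n * r ^ n)) \<longlongrightarrow> 2 * pi * (\<Sum>n<K. ind n)) (at_left 1)"
        by (simp add: sum_distrib_left)
      show "\<forall>\<^sub>F r in at_left 1. (\<Sum>n<K. 2 * pi * (ind n * r ^ n)) \<le> Re (circle_pairing h \<phi> r)"
        using eventually_at_left_real[of 0 "1::real", OF zero_less_one]
      proof eventually_elim
        case (elim r)
        then have r: "0 \<le> r" "r < 1" by auto
        show ?case
          unfolding sums_unique[OF sums[OF r]]
          by (rule sum_le_suminf[OF sums_summable[OF sums[OF r]]]) (use r in \<open>auto simp: ind_def\<close>)
      qed
    qed simp
    have count: "real J \<le> (\<Sum>n<\<nu> J. ind n)" for J
    proof -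
      have sub: "\<nu> ` {..<J} \<subseteq> {..<\<nu> J}" using inj by (auto simp: strict_mono_less)
      have "real J = (\<Sum>n\<in>\<nu> ` {..<J}. ind n)"
        using strict_mono_imp_inj_on[OF inj] by (subst sum.reindex) (auto simp: ind_def inj_on_def)
      also have "\<dots> \<le> (\<Sum>n<\<nu> J. ind n)"
        by (rule sum_mono2[OF _ sub]) (auto simp: ind_def)
      finally show ?thesis .
    qed
    obtain J where J: "Re L / (2 * pi) < real J" using reals_Archimedean2 by blast
    have "2 * pi * real J \<le> 2 * pi * (\<Sum>n<\<nu> J. ind n)" by (intro mult_left_mono count) simp
    also have "\<dots> \<le> Re L" by (rule part)
    finally show False using J by (simp add: field_simps)
  qed
  then obtain N m where Nm: "\<And>n. n \<ge> m \<Longrightarrow> cmod (a n) \<le> real n ^ N" by blast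
  \<comment> \<open>The finitely many indices below \<open>m\<close> are absorbed into
    \<open>C\<close>; the shift to \<open>real n + 1\<close> keeps the power at least 1 even at
    index 0.\<close>
  define C where "C = 1 + (\<Sum>j<m. cmod (a j))"
  have C1: "C \<ge> 1" by (simp add: C_def sum_nonneg)
  have "cmod (a n) \<le> C * (real n + 1) ^ N" for n
  proof (cases "n < m")
    case True
    have "cmod (a n) \<le> (\<Sum>j<m. cmod (a j))" using True by (intro member_le_sum) auto
    then have "cmod (a n) \<le> C * 1" by (simp add: C_def)
    also have "\<dots> \<le> C * (real n + 1) ^ N" using C1 by (intro mult_left_mono) auto
    finally show ?thesis .
  next
    case False
    then have "cmod (a n) \<le> 1 * real n ^ N" using Nm[of n] by simp
    also have "\<dots> \<le> C * (real n + 1) ^ N" using C1 by (intro mult_mono power_mono) auto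
    finally show ?thesis .
  qed
  then show thesis by (intro that[of C N]) (simp add: a_def)
qed

section \<open>Boundary values tested against smooth families\<close>

text \<open>Uniform bounds are required of angular derivatives only. In the radius pointwise
  convergence at 1 suffices, because the limit is taken coefficient by coefficient. The value at
  radius 1 is the test function that the boundary distribution receives.\<close>

definition smooth_family :: "(real \<Rightarrow> real \<Rightarrow> complex) \<Rightarrow> bool" where
  "smooth_family G \<longleftrightarrow> (\<forall>k. csmooth k {0..1} G) \<and> (\<forall>r\<in>{0..1}. \<forall>t. G r (t + 2 * pi) = G r t) \<and>
     (\<forall>t. ((\<lambda>r. G r t) \<longlongrightarrow> G 1 t) (at_left 1))"

lemma smooth_familyD:
  assumes "smooth_family G"
  shows "csmooth k {0..1} G" "\<And>r t. r \<in> {0..1} \<Longrightarrow> G r (t + 2 * pi) = G r t"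
    "((\<lambda>r. G r t) \<longlongrightarrow> G 1 t) (at_left 1)"
  using assms by (auto simp: smooth_family_def)

lemma smooth_family_continuous: "smooth_family G \<Longrightarrow> r \<in> {0..1} \<Longrightarrow> continuous_on S (G r)"
  by (rule csmooth_continuous[OF smooth_familyD(1)[of G "Suc 0"]])

lemma smooth_family_const:
  assumes "test_fun \<phi>"
  shows "smooth_family (\<lambda>_. \<phi>)"
  unfolding smooth_family_def using test_fun_imp_csmooth[OF assms] assms by (auto simp: test_fun_def)

lemma smooth_family_test_fun: "smooth_family G \<Longrightarrow> test_fun (G 1)"
  by (rule csmooth_imp_test_fun[where S = "{0..1}"]) (auto simp: smooth_familyD)

lemma smooth_family_mult:
  "smooth_family F \<Longrightarrow> smooth_family G \<Longrightarrow> smooth_family (\<lambda>r t. F r t * G r t)"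
  unfolding smooth_family_def by (auto intro!: csmooth_mult tendsto_mult)

lemma smooth_family_exp: "smooth_family F \<Longrightarrow> smooth_family (\<lambda>r t. exp (F r t))"
  unfolding smooth_family_def by (auto intro!: csmooth_exp tendsto_exp)

text \<open>This is \<open>cnj z ^ l\<close> on the circle of radius \<open>r\<close>, as it enters
  the recursion for \<open>f\<close>.\<close>

lemma smooth_family_cis: "smooth_family (\<lambda>r t. of_real r ^ l * cis (- real l * t))"
  unfolding smooth_family_def
proof (intro conjI allI ballI)
  show "csmooth k {0..1} (\<lambda>r t. of_real r ^ l * cis (- real l * t))" for k
    by (rule csmooth_cis[where B = 1]) (auto simp: norm_power power_le_one)
  show "((\<lambda>r. complex_of_real r ^ l * cis (- real l * t)) \<longlongrightarrow> complex_of_real 1 ^ l * cis (- real l * t)) (at_left 1)" for t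
    by (intro tendsto_intros)
qed (simp only: cis_periodic_nat)

lemma smooth_family_coeff_tendsto:
  assumes G: "smooth_family G"
  shows "((\<lambda>r. integral {0..2*pi} (\<lambda>t. G r t * cis (real n * t))) \<longlongrightarrow>
    integral {0..2*pi} (\<lambda>t. G 1 t * cis (real n * t))) (at_left 1)"
proof -
  have eq: "at_left 1 = at (1::real) within {0..1}"
    by (rule at_within_Icc_at_left[symmetric]) simp
  obtain B where B: "\<And>r t. r \<in> {0..1} \<Longrightarrow> cmod (G r t) \<le> B"
    by (rule csmooth_bounded_nonneg[OF smooth_familyD(1)[OF G, of 0]]) blast
  show ?thesis unfolding eq tendsto_at_iff_sequentially comp_def
  proof (intro allI impI)
    fix X assume X: "\<forall>i. X i \<in> {0..1} - {1::real}" "X \<longlonglongrightarrow> 1"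
    have Xr: "X i \<in> {0..1}" for i using X(1)[rule_format, of i] by auto
    show "(\<lambda>i. integral {0..2*pi} (\<lambda>t. G (X i) t * cis (real n * t))) \<longlonglongrightarrow>
      integral {0..2*pi} (\<lambda>t. G 1 t * cis (real n * t))"
    proof (rule dominated_convergence(2))
      show "(\<lambda>t. G (X i) t * cis (real n * t)) integrable_on {0..2*pi}" for i
        by (intro integrable_continuous_interval continuous_intros smooth_family_continuous[OF G Xr])
      show "(\<lambda>t. B) integrable_on {0..2*pi}" by (rule integrable_const_ivl)
      show "norm (G (X i) t * cis (real n * t)) \<le> B" for i t
        using B[OF Xr] by (simp add: norm_mult)
      show "(\<lambda>i. G (X i) t * cis (real n * t)) \<longlonglongrightarrow> G 1 t * cis (real n * t)" for t
      proof -
        have "(\<lambda>i. G (X i) t) \<longlonglongrightarrow> G 1 t"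
          using smooth_familyD(3)[OF G, of t] X unfolding eq tendsto_at_iff_sequentially comp_def by blast
        then show ?thesis by (intro tendsto_intros)
      qed
    qed
  qed
qed

lemma eventually_at_left_1: "\<forall>\<^sub>F r in at_left 1. 0 < r \<and> r < (1::real)"
  using eventually_at_left_real[of 0 "1::real"] by (auto elim: eventually_mono)

lemma Hb_pairing_tendsto_series:
  assumes h: "h \<in> Hb" and G: "smooth_family G"
  shows "((\<lambda>r. integral {0..2*pi} (\<lambda>t. h (of_real r * cis t) * G r t)) \<longlongrightarrow>
     (\<Sum>n. taylor0 h n * integral {0..2*pi} (\<lambda>t. G 1 t * cis (real n * t)))) (at_left 1)"
proof -
  have hol: "h holomorphic_on ball 0 1" using h by (simp add: Hb_def)
  define c where "c = (\<lambda>r n. integral {0..2*pi} (\<lambda>t. G r t * cis (real n * t)))"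
  define a where "a = (\<lambda>n r. taylor0 h n * of_real r ^ n * c r n)"
  obtain N C where C: "\<And>n. cmod (taylor0 h n) \<le> C * (real n + 1) ^ N"
    using Hb_coeff_growth[OF h] by blast
  have C0: "C \<ge> 0" using order_trans[OF norm_ge_zero C[of 0]] by simp
  \<comment> \<open>Two powers more than the growth exponent: what remains of the product is of
    order \<open>1 / real n ^ 2\<close>, uniformly in \<open>r\<close>.\<close>
  obtain B where B: "\<And>r n. r \<in> {0..1} \<Longrightarrow> cmod (c r n) * real n ^ (N + 2) \<le> B"
    using fourier_coeff_bound[OF smooth_familyD(1,2)[OF G], of "N + 2"] unfolding c_def by blast
  \<comment> \<open>\<open>2 ^ N\<close> comes from \<open>real n + 1 \<le> 2 * real n\<close>,
    valid for \<open>n \<ge> 1\<close>. At \<open>n = 0\<close> nothing is claimed; Tannery's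
    theorem asks for the bound only eventually.\<close>
  define M where "M = (\<lambda>n. C * 2 ^ N * B * (1 / real n ^ 2))"
  have bound: "norm (a n r) \<le> M n" if n: "n \<ge> 1" and r: "0 < r" "r < 1" for n r
  proof -
    have cb: "cmod (c r n) \<le> B / real n ^ (N + 2)"
      using B[of r n] n r by (simp add: field_simps)
    have B0: "0 \<le> B / real n ^ (N + 2)" using order_trans[OF norm_ge_zero cb] .
    have "norm (a n r) = cmod (taylor0 h n) * r ^ n * cmod (c r n)"
      using r by (simp add: a_def norm_mult norm_power)
    also have "\<dots> \<le> (C * (real n + 1) ^ N) * 1 * (B / real n ^ (N + 2))"
      using r C0 B0 by (intro mult_mono C cb power_le_one mult_nonneg_nonneg) auto
    also have "\<dots> \<le> (C * (2 * real n) ^ N) * 1 * (B / real n ^ (N + 2))"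
      using n C0 B0 by (intro mult_right_mono mult_left_mono power_mono) auto
    also have "\<dots> = M n" using n by (simp add: M_def power_mult_distrib power_add power2_eq_square)
    finally show ?thesis .
  qed
  have "((\<lambda>r. suminf (\<lambda>n. a n r)) \<longlongrightarrow> suminf (\<lambda>n. taylor0 h n * c 1 n)) (at_left 1)"
  proof (rule tannerys_theorem[THEN conjunct2, THEN conjunct2])
    show "((\<lambda>r. a n r) \<longlongrightarrow> taylor0 h n * c 1 n) (at_left 1)" for n
    proof -
      have "((\<lambda>r. a n r) \<longlongrightarrow> taylor0 h n * of_real 1 ^ n * c 1 n) (at_left 1)"
        unfolding a_def c_def by (intro tendsto_intros smooth_family_coeff_tendsto G)
      then show ?thesis by simp
    qed
    show "\<forall>\<^sub>F (n, r) in sequentially \<times>\<^sub>F at_left 1. norm (a n r) \<le> M n"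
      using eventually_prodI[OF eventually_ge_at_top[of 1] eventually_at_left_1]
      by eventually_elim (auto intro: bound)
    show "summable M" unfolding M_def
      using inverse_power_summable[of 2, where 'a = real] by (intro summable_mult) (simp add: inverse_eq_divide)
  qed simp
  then show ?thesis unfolding c_def
  proof (rule Lim_transform_eventually)
    show "\<forall>\<^sub>F r in at_left 1. (\<Sum>n. a n r) = integral {0..2*pi} (\<lambda>t. h (of_real r * cis t) * G r t)"
      using eventually_at_left_1
    proof eventually_elim
      case (elim r)
      then have "(\<lambda>n. a n r) sums integral {0..2*pi} (\<lambda>t. h (of_real r * cis t) * G r t)"
        unfolding a_def c_def by (intro circle_pairing_sums hol smooth_family_continuous[OF G]) auto
      then show ?case by (simp add: sums_iff)
    qed
  qed
qed

text \<open>The series limit involves \<open>G\<close> only through \<open>G 1\<close>. Applied to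
  the constant family it computes \<open>bv h (G 1)\<close>; applied to \<open>G\<close> it gives
  the limit sought.\<close>

lemma Hb_pairing_tendsto:
  assumes h: "h \<in> Hb" and G: "smooth_family G"
  shows "((\<lambda>r. integral {0..2*pi} (\<lambda>t. h (of_real r * cis t) * G r t)) \<longlongrightarrow> bv h (G 1)) (at_left 1)"
proof -
  have "(circle_pairing h (G 1) \<longlongrightarrow> (\<Sum>n. taylor0 h n * integral {0..2*pi} (\<lambda>t. G 1 t * cis (real n * t)))) (at_left 1)"
    using Hb_pairing_tendsto_series[OF h smooth_family_const[OF smooth_family_test_fun[OF G]]]
    by (simp add: circle_pairing_def[abs_def])
  then have "bv h (G 1) = (\<Sum>n. taylor0 h n * integral {0..2*pi} (\<lambda>t. G 1 t * cis (real n * t)))"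
    unfolding bv_def by (intro tendsto_Lim) simp_all
  then show ?thesis using Hb_pairing_tendsto_series[OF h G] by simp
qed

text \<open>Boundary values tested against functions that vary smoothly with the radius; unlike plain
  distributional boundary values these are stable under multiplication by functions
  that are smooth up to the boundary.\<close>

definition has_bv_dist :: "(complex \<Rightarrow> complex) \<Rightarrow> circle_dist \<Rightarrow> bool" where
  "has_bv_dist f u \<longleftrightarrow> continuous_on (ball 0 1) f \<and>
     (\<forall>G. smooth_family G \<longrightarrow>
       ((\<lambda>r. integral {0..2*pi} (\<lambda>t. f (of_real r * cis t) * G r t)) \<longlongrightarrow> u (G 1)) (at_left 1))"

lemma has_bv_distD:
  assumes "has_bv_dist f u"
  shows "continuous_on (ball 0 1) f"
    "smooth_family G \<Longrightarrow> ((\<lambda>r. integral {0..2*pi} (\<lambda>t. f (of_real r * cis t) * G r t)) \<longlongrightarrow> u (G 1)) (at_left 1)"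
  using assms by (auto simp: has_bv_dist_def)

lemma continuous_on_circle:
  assumes "continuous_on (ball 0 1) f" "0 < r" "r < 1"
  shows "continuous_on S (\<lambda>t. f (of_real r * cis t))"
  by (rule continuous_on_compose2[OF assms(1)]) (use assms(2,3) in \<open>auto intro!: continuous_intros simp: norm_mult\<close>)

lemma has_bv_dist_circle_pairing:
  assumes "has_bv_dist f u" "test_fun \<phi>"
  shows "(circle_pairing f \<phi> \<longlongrightarrow> u \<phi>) (at_left 1)"
  using has_bv_distD(2)[OF assms(1) smooth_family_const[OF assms(2)]] by (simp add: circle_pairing_def[abs_def])

lemma has_bv_dist_bv:
  assumes "has_bv_dist f u" "test_fun \<phi>"
  shows "bv f \<phi> = u \<phi>"
  unfolding bv_def by (intro tendsto_Lim has_bv_dist_circle_pairing assms) simp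

lemma has_bv_dist_imp_has_bv:
  assumes "has_bv_dist f u"
  shows "has_bv f"
  unfolding has_bv_def
proof (intro allI impI conjI)
  fix \<phi> assume \<phi>: "test_fun \<phi>"
  show "\<forall>\<^sub>F r in at_left 1. (\<lambda>\<theta>. f (of_real r * cis \<theta>) * \<phi> \<theta>) absolutely_integrable_on {0..2*pi}"
    using eventually_at_left_1
  proof eventually_elim
    case (elim r)
    then show ?case
      using smooth_family_continuous[OF smooth_family_const[OF \<phi>], of 0]
      by (intro absolutely_integrable_continuous_real continuous_on_mult
          continuous_on_circle has_bv_distD(1)[OF assms]) auto
  qed
qed (use has_bv_dist_circle_pairing[OF assms] in blast)

lemma has_bv_dist_Hb: "h \<in> Hb \<Longrightarrow> has_bv_dist h (bv h)"
  unfolding has_bv_dist_def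
  by (auto simp: Hb_def intro: holomorphic_on_imp_continuous_on intro!: Hb_pairing_tendsto)

lemma has_bv_dist_transfer:
  assumes "has_bv_dist f u" "\<And>z. z \<in> ball 0 1 \<Longrightarrow> g z = f z" "\<And>\<phi>. test_fun \<phi> \<Longrightarrow> v \<phi> = u \<phi>"
  shows "has_bv_dist g v"
  unfolding has_bv_dist_def
proof (intro conjI allI impI)
  show "continuous_on (ball 0 1) g"
    by (rule continuous_on_eq[OF has_bv_distD(1)[OF assms(1)]]) (simp add: assms(2))
  fix G assume G: "smooth_family G"
  show "((\<lambda>r. integral {0..2*pi} (\<lambda>t. g (of_real r * cis t) * G r t)) \<longlongrightarrow> v (G 1)) (at_left 1)"
    unfolding assms(3)[OF smooth_family_test_fun[OF G]]
  proof (rule Lim_transform_eventually[OF has_bv_distD(2)[OF assms(1) G]])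
    show "\<forall>\<^sub>F r in at_left 1. integral {0..2*pi} (\<lambda>t. f (of_real r * cis t) * G r t)
        = integral {0..2*pi} (\<lambda>t. g (of_real r * cis t) * G r t)"
      using eventually_at_left_1
      by eventually_elim (auto intro!: integral_cong simp: assms(2) norm_mult)
  qed
qed

lemma has_bv_dist_add:
  assumes f: "has_bv_dist f u" and g: "has_bv_dist g v"
  shows "has_bv_dist (\<lambda>z. f z + g z) (\<lambda>\<phi>. u \<phi> + v \<phi>)"
  unfolding has_bv_dist_def
proof (intro conjI allI impI)
  show "continuous_on (ball 0 1) (\<lambda>z. f z + g z)"
    by (intro continuous_intros has_bv_distD(1)[OF f] has_bv_distD(1)[OF g])
  fix G assume G: "smooth_family G"
  show "((\<lambda>r. integral {0..2*pi} (\<lambda>t. (f (of_real r * cis t) + g (of_real r * cis t)) * G r t))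
      \<longlongrightarrow> u (G 1) + v (G 1)) (at_left 1)"
  proof (rule Lim_transform_eventually[OF tendsto_add[OF has_bv_distD(2)[OF f G] has_bv_distD(2)[OF g G]]])
    show "\<forall>\<^sub>F r in at_left 1. integral {0..2*pi} (\<lambda>t. f (of_real r * cis t) * G r t)
        + integral {0..2*pi} (\<lambda>t. g (of_real r * cis t) * G r t)
        = integral {0..2*pi} (\<lambda>t. (f (of_real r * cis t) + g (of_real r * cis t)) * G r t)"
      using eventually_at_left_1
    proof eventually_elim
      case (elim r)
      then have c: "continuous_on {0..2*pi} (\<lambda>t. k (of_real r * cis t) * G r t)"
        if "continuous_on (ball 0 1) k" for k
        using that by (intro continuous_on_mult continuous_on_circle smooth_family_continuous[OF G]) auto
      show ?case unfolding distrib_right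
        by (intro integral_add[symmetric] integrable_continuous_interval c has_bv_distD(1)[OF f] has_bv_distD(1)[OF g])
    qed
  qed
qed

lemma has_bv_dist_cmult:
  assumes f: "has_bv_dist f u"
  shows "has_bv_dist (\<lambda>z. a * f z) (\<lambda>\<phi>. a * u \<phi>)"
  unfolding has_bv_dist_def
proof (intro conjI allI impI)
  show "continuous_on (ball 0 1) (\<lambda>z. a * f z)"
    by (intro continuous_intros has_bv_distD(1)[OF f])
  show "((\<lambda>r. integral {0..2*pi} (\<lambda>t. a * f (of_real r * cis t) * G r t)) \<longlongrightarrow> a * u (G 1)) (at_left 1)"
    if "smooth_family G" for G
    unfolding mult.assoc integral_mult_right by (intro tendsto_mult_left has_bv_distD(2)[OF f that])
qed

lemma has_bv_dist_const: "has_bv_dist (\<lambda>_. a) (dist_const a)"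
proof -
  have pair: "circle_pairing (\<lambda>_. a) \<phi> r = dist_const a \<phi>" for \<phi> r
    by (simp add: circle_pairing_def dist_const_def)
  have "(\<lambda>_. a) \<in> Hb" unfolding Hb_def has_bv_def
  proof (intro CollectI conjI allI impI)
    fix \<phi> assume \<phi>: "test_fun \<phi>"
    show "\<forall>\<^sub>F r in at_left 1. (\<lambda>\<theta>. a * \<phi> \<theta>) absolutely_integrable_on {0..2 * pi}"
      using smooth_family_continuous[OF smooth_family_const[OF \<phi>], of 0]
      by (intro always_eventually allI absolutely_integrable_continuous_real continuous_intros) auto
    show "\<exists>L. (circle_pairing (\<lambda>_. a) \<phi> \<longlongrightarrow> L) (at_left 1)"
      unfolding pair[abs_def] by (blast intro: tendsto_const)
  qed simp
  moreover have "dist_const a \<phi> = bv (\<lambda>_. a) \<phi>" for \<phi>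
    unfolding bv_def pair[abs_def] by (intro tendsto_Lim[symmetric] tendsto_const) simp
  ultimately show ?thesis
    by (blast intro: has_bv_dist_transfer[OF has_bv_dist_Hb])
qed

lemma has_bv_dist_sum:
  assumes "finite S" "\<And>l. l \<in> S \<Longrightarrow> has_bv_dist (f l) (u l)"
  shows "has_bv_dist (\<lambda>z. \<Sum>l\<in>S. f l z) (\<lambda>\<phi>. \<Sum>l\<in>S. u l \<phi>)"
  using assms
proof (induction S rule: finite_induct)
  case empty
  have "has_bv_dist (\<lambda>_. 0) (dist_const 0)" by (rule has_bv_dist_const)
  then show ?case by (simp add: dist_const_def)
next
  case (insert l S)
  then show ?case by (simp add: has_bv_dist_add)
qed

text \<open>The multiplier moves into the test family, and smooth families are closed under
  products. \<open>M\<close> is tied to \<open>m\<close> inside the disk only; its value at radius 1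
  supplies the boundary multiplier.\<close>

lemma has_bv_dist_mult:
  assumes f: "has_bv_dist f u" and m: "continuous_on (ball 0 1) m" and M: "smooth_family M"
    and eq: "\<And>r t. 0 < r \<Longrightarrow> r < 1 \<Longrightarrow> M r t = m (of_real r * cis t)"
  shows "has_bv_dist (\<lambda>z. m z * f z) (\<lambda>\<phi>. u (\<lambda>t. M 1 t * \<phi> t))"
  unfolding has_bv_dist_def
proof (intro conjI allI impI)
  show "continuous_on (ball 0 1) (\<lambda>z. m z * f z)"
    by (intro continuous_intros m has_bv_distD(1)[OF f])
  fix G assume G: "smooth_family G"
  show "((\<lambda>r. integral {0..2*pi} (\<lambda>t. m (of_real r * cis t) * f (of_real r * cis t) * G r t))
      \<longlongrightarrow> u (\<lambda>t. M 1 t * G 1 t)) (at_left 1)"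
  proof (rule Lim_transform_eventually[OF has_bv_distD(2)[OF f smooth_family_mult[OF M G]]])
    show "\<forall>\<^sub>F r in at_left 1. integral {0..2*pi} (\<lambda>t. f (of_real r * cis t) * (M r t * G r t))
        = integral {0..2*pi} (\<lambda>t. m (of_real r * cis t) * f (of_real r * cis t) * G r t)"
      using eventually_at_left_1 by eventually_elim (simp add: eq mult_ac)
  qed
qed

lemma has_bv_dist_cnj_power:
  assumes f: "has_bv_dist f u"
  shows "has_bv_dist (\<lambda>z. cnj z ^ l * f z) (dist_mult (\<lambda>\<theta>. exp (- \<i> * of_nat l * of_real \<theta>)) u)"
proof -
  have e: "cis (- real l * t) = exp (- \<i> * of_nat l * of_real t)" for t
    by (simp add: cis_conv_exp mult_ac)
  have "has_bv_dist (\<lambda>z. cnj z ^ l * f z) (\<lambda>\<phi>. u (\<lambda>t. of_real 1 ^ l * cis (- real l * t) * \<phi> t))"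
  proof (rule has_bv_dist_mult[OF f _ smooth_family_cis])
    show "of_real r ^ l * cis (- real l * t) = cnj (of_real r * cis t) ^ l" for r t
      by (simp add: power_mult_distrib cis_cnj Complex.DeMoivre)
  qed (intro continuous_intros)
  then show ?thesis
    by (rule has_bv_dist_transfer) (simp_all only: dist_mult_def e of_real_1 power_one mult_1_left)
qed

section \<open>The Poisson integral\<close>

text \<open>Termwise differentiation raises the power of \<open>n\<close> by one and preserves
  convergence inside the unit interval; multiplying by \<open>y\<close> restores the exponent up to
  an index shift.\<close>

lemma summable_power_times_nat_power:
  assumes "0 \<le> x" "x < (1::real)"
  shows "summable (\<lambda>n. real n ^ m * x ^ n)"
proof -
  have "summable (\<lambda>n. real n ^ m * y ^ n)" if "norm y < 1" for y :: real
    using that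
  proof (induction m arbitrary: y)
    case 0
    then show ?case by (simp add: summable_geometric)
  next
    case (Suc m y)
    have "summable (\<lambda>n. diffs (\<lambda>n. real n ^ m) n * y ^ n)"
      using Suc by (intro termdiff_converges[where K = 1]) auto
    then have "summable (\<lambda>n. y * (diffs (\<lambda>n. real n ^ m) n * y ^ n))" by (rule summable_mult)
    also have "(\<lambda>n. y * (diffs (\<lambda>n. real n ^ m) n * y ^ n)) = (\<lambda>n. real (Suc n) ^ Suc m * y ^ Suc n)"
      by (auto simp: diffs_def mult_ac)
    finally show ?case by (subst (asm) summable_Suc_iff)
  qed
  then show ?thesis using assms by simp
qed

lemma rapidly_decreasing_power:
  assumes "cmod z < 1"
  shows "rapidly_decreasing (\<lambda>n. z ^ n)"
  unfolding rapidly_decreasing_def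
proof
  fix k
  have "(\<lambda>n. real n ^ k * cmod z ^ n) \<longlonglongrightarrow> 0"
    using assms by (intro summable_LIMSEQ_zero summable_power_times_nat_power) auto
  then have "Bseq (\<lambda>n. real n ^ k * cmod z ^ n)" by (intro convergent_imp_Bseq convergentI)
  then obtain C where C: "\<And>n. norm (real n ^ k * cmod z ^ n) \<le> C" by (rule BseqE) blast
  have "cmod (z ^ n) * real n ^ k \<le> C" for n
    using C[of n] by (simp add: norm_power mult.commute)
  then show "\<exists>C. \<forall>n. cmod (z ^ n) * real n ^ k \<le> C" by blast
qed

text \<open>With \<open>w = z * cis (- t)\<close> both halves are geometric series, and \<open>1 /
  (1 - w) + 1 / (1 - cnj w) - 1 = (1 - w * cnj w) / ((1 - w) * (1 - cnj w))\<close>; the law of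
  cosines evaluates the denominator.\<close>

lemma poisson_series:
  assumes z: "cmod z < 1"
  defines "g \<equiv> \<lambda>t. \<Sum>n. z ^ n * cis (- real n * t)"
  shows "complex_of_real (poisson (cmod z) (Arg z - t)) = g t + cnj (g t) - 1"
proof -
  define w where "w = z * cis (- t)"
  have w: "cmod w < 1" using z by (simp add: w_def norm_mult)
  then have w1: "1 - w \<noteq> 0" by auto
  have "z ^ n * cis (- real n * t) = w ^ n" for n
    by (simp add: w_def power_mult_distrib Complex.DeMoivre)
  then have g: "g t = 1 / (1 - w)"
    unfolding g_def using suminf_geometric[OF w] by simp
  have wrc: "w = rcis (cmod z) (Arg z - t)"
    using rcis_cmod_Arg[of z] by (simp add: w_def rcis_def mult.assoc[symmetric] cis_divide[symmetric])
      (metis cis_inverse cis_mult divide_inverse mult.assoc rcis_def uminus_add_conv_diff add.commute)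
  have sq: "(cmod (1 - w))\<^sup>2 = 1 - 2 * cmod z * cos (Arg z - t) + (cmod z)\<^sup>2"
  proof -
    have "(cmod (1 - w))\<^sup>2 = (1 - cmod z * cos (Arg z - t))\<^sup>2 + (cmod z * sin (Arg z - t))\<^sup>2"
      by (simp add: cmod_power2 wrc)
    also have "\<dots> = 1 - 2 * cmod z * cos (Arg z - t)
        + (cmod z)\<^sup>2 * ((cos (Arg z - t))\<^sup>2 + (sin (Arg z - t))\<^sup>2)"
      by algebra
    finally show ?thesis by (simp only: sin_cos_squared_add2 mult_1_right)
  qed
  have ww: "w * cnj w = of_real ((cmod z)\<^sup>2)"
    unfolding complex_norm_square[symmetric] by (simp add: w_def norm_mult)
  have c1: "1 - cnj w \<noteq> 0" using w1 by (metis complex_cnj_cancel_iff complex_cnj_diff complex_cnj_one complex_cnj_zero)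
  have "g t + cnj (g t) - 1 = 1 / (1 - w) + 1 / (1 - cnj w) - 1"
    by (simp add: g)
  also have "\<dots> = (1 - w * cnj w) / ((1 - w) * (1 - cnj w))"
    using w1 c1 by (simp add: divide_simps; simp add: algebra_simps)
  also have "(1 - w) * (1 - cnj w) = of_real ((cmod (1 - w))\<^sup>2)"
    unfolding complex_norm_square by simp
  finally show ?thesis unfolding ww sq poisson_def by simp
qed

text \<open>The power series in \<open>z\<close> yields the claimed value. The conjugate half
  contributes at \<open>n = 0\<close> alone, where the summand \<open>- 1\<close> cancels
  it.\<close>

lemma poisson_fourier_coeff:
  assumes z: "cmod z < 1"
  shows "integral {0..2*pi} (\<lambda>t. complex_of_real (poisson (cmod z) (Arg z - t)) * cis (real n * t))
    = 2 * of_real pi * z ^ n"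
proof -
  define g where "g = (\<lambda>t. \<Sum>n. z ^ n * cis (- real n * t))"
  note rd = rapidly_decreasing_power[OF z]
  have gc: "continuous_on {0..2*pi} g"
    using csmooth_continuous[OF csmooth_fourier_series[OF rd, of "Suc 0" "UNIV :: unit set"], of "()"]
    by (simp add: g_def)
  have i1: "integral {0..2*pi} (\<lambda>t. g t * cis (real n * t)) = 2 * of_real pi * z ^ n"
    unfolding g_def by (rule fourier_series_coeff[OF rd])
  have i2: "integral {0..2*pi} (\<lambda>t. cnj (g t) * cis (real n * t)) = (if n = 0 then 2 * of_real pi else 0)"
  proof -
    have "(\<lambda>t. cnj (g t) * cis (real n * t)) = (\<lambda>t. cnj (g t * cis (real_of_int (- int n) * t)))"
      by (simp add: cis_cnj)
    then have "integral {0..2*pi} (\<lambda>t. cnj (g t) * cis (real n * t))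
        = cnj (integral {0..2*pi} (\<lambda>t. g t * cis (real_of_int (- int n) * t)))"
      by (simp only: Henstock_Kurzweil_Integration.integral_cnj)
    also have "integral {0..2*pi} (\<lambda>t. g t * cis (real_of_int (- int n) * t)) = (if n = 0 then 2 * of_real pi else 0)"
      unfolding g_def fourier_series_coeff_int[OF rd] by simp
    finally show ?thesis by simp
  qed
  have i3: "integral {0..2*pi} (\<lambda>t. cis (real n * t)) = (if n = 0 then 2 * of_real pi else 0)"
    using integral_cis_multiple[of "int n"] by (auto simp: scaleR_conv_of_real)
  have P: "complex_of_real (poisson (cmod z) (Arg z - t)) = g t + cnj (g t) - 1" for t
    unfolding g_def by (rule poisson_series[OF z])
  have "integral {0..2*pi} (\<lambda>t. complex_of_real (poisson (cmod z) (Arg z - t)) * cis (real n * t))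
      = integral {0..2*pi} (\<lambda>t. g t * cis (real n * t) + cnj (g t) * cis (real n * t) - cis (real n * t))"
    by (simp only: P left_diff_distrib distrib_right mult_1_left)
  also have "\<dots> = integral {0..2*pi} (\<lambda>t. g t * cis (real n * t))
      + integral {0..2*pi} (\<lambda>t. cnj (g t) * cis (real n * t)) - integral {0..2*pi} (\<lambda>t. cis (real n * t))"
    by (subst Henstock_Kurzweil_Integration.integral_diff Henstock_Kurzweil_Integration.integral_add;
        (intro refl integrable_continuous_interval continuous_intros gc)?)+
  finally show ?thesis unfolding i1 i2 i3 by simp
qed

text \<open>On the circle of radius \<open>r\<close> the pairing is exactly
  \<open>2 * of_real pi * h (of_real r * z)\<close>, by comparison of Taylor series; then
  \<open>r\<close> tends to 1.\<close>

lemma poisson_pairing_bv: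
  assumes h: "h holomorphic_on ball 0 1" and z: "z \<in> ball 0 1"
  shows "poisson_pairing (bv h) z = 2 * of_real pi * h z"
proof -
  have cz: "cmod z < 1" using z by simp
  define \<phi> where "\<phi> = (\<lambda>t. complex_of_real (poisson (cmod z) (Arg z - t)))"
  have cont: "continuous_on {0..2*pi} \<phi>"
  proof -
    have g: "continuous_on {0..2*pi} (\<lambda>t. \<Sum>n. z ^ n * cis (- real n * t))"
      using csmooth_continuous[OF csmooth_fourier_series[OF rapidly_decreasing_power[OF cz], of "Suc 0" "UNIV :: unit set"], of "()"]
      by simp
    show ?thesis unfolding \<phi>_def poisson_series[OF cz] by (intro continuous_intros g)
  qed
  have pair: "circle_pairing h \<phi> r = 2 * of_real pi * h (of_real r * z)" if r: "0 < r" "r < 1" for r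
  proof -
    have "(\<lambda>n. taylor0 h n * of_real r ^ n * (2 * of_real pi * z ^ n)) sums circle_pairing h \<phi> r"
      using circle_pairing_sums[OF h _ r(2) cont] r(1)
      by (simp add: circle_pairing_def \<phi>_def poisson_fourier_coeff[OF cz])
    moreover have "(\<lambda>n. 2 * of_real pi * (taylor0 h n * (of_real r * z) ^ n)) sums (2 * of_real pi * h (of_real r * z))"
    proof (intro sums_mult taylor0_sums h)
      have "r * cmod z < 1 * 1" using r cz by (intro mult_strict_mono) auto
      then show "cmod (of_real r * z) < 1" using r by (simp add: norm_mult)
    qed
    ultimately show ?thesis
      by (intro sums_unique2[of "\<lambda>n. taylor0 h n * of_real r ^ n * (2 * of_real pi * z ^ n)"])
         (simp_all add: power_mult_distrib mult_ac)
  qed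
  have "((\<lambda>r. 2 * of_real pi * h (of_real r * z)) \<longlongrightarrow> 2 * of_real pi * h z) (at_left 1)"
  proof -
    have "isCont h z"
      using holomorphic_on_imp_continuous_on[OF h] z by (simp add: continuous_on_eq_continuous_at)
    then have "((\<lambda>r. h (of_real r * z)) \<longlongrightarrow> h z) (at_left 1)"
    proof (rule isCont_tendsto_compose)
      have "((\<lambda>r. of_real r * z) \<longlongrightarrow> of_real 1 * z) (at_left 1)" by (intro tendsto_intros)
      then show "((\<lambda>r. of_real r * z) \<longlongrightarrow> z) (at_left 1)" by simp
    qed
    then show ?thesis by (intro tendsto_intros)
  qed
  then have "(circle_pairing h \<phi> \<longlongrightarrow> 2 * of_real pi * h z) (at_left 1)"
    by (rule Lim_transform_eventually) (use eventually_at_left_1 in eventually_elim, simp add: pair)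
  then have "bv h \<phi> = 2 * of_real pi * h z" unfolding bv_def by (intro tendsto_Lim) simp_all
  then show ?thesis by (simp add: poisson_pairing_def \<phi>_def)
qed

text \<open>At the origin the Poisson kernel is the constant 1, so this is the mean value property.
  Subtracting the constant strips \<open>h\<close> of its imaginary part at 0 and leaves
  \<open>c\<close> to prescribe it.\<close>

lemma I_const_bv:
  assumes "h holomorphic_on ball 0 1"
  shows "I_const (bv h) = \<i> * of_real (Im (h 0))"
proof -
  have 1: "bv h (\<lambda>_. 1) = 2 * of_real pi * h 0"
    using poisson_pairing_bv[OF assms, of 0] by (simp add: poisson_pairing_def poisson_def)
  \<comment> \<open>\<open>dist_Im\<close> also evaluates its argument at the imaginary part of the
    constant 1, the zero function.\<close>
  have 0: "bv h (\<lambda>_. 0) = 0"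
    unfolding bv_def circle_pairing_def by (intro tendsto_Lim) auto
  show ?thesis
    by (simp add: I_const_def dist_Im_def 0 1)
qed

section \<open>Smoothness of \<open>psi\<close> along circles up to the boundary\<close>

text \<open>A class of functions that contains \<open>A\<close>, is closed under the angular derivative
  \<open>x \<partial>/\<partial>y - y \<partial>/\<partial>x\<close>, and consists of functions bounded on the disk.\<close>

inductive angular :: "(complex \<Rightarrow> complex) \<Rightarrow> (complex \<Rightarrow> complex) \<Rightarrow> bool" for A where
  base: "set vs \<subseteq> {1, \<i>} \<Longrightarrow> angular A (dir_derivs vs A)"
| add: "angular A f \<Longrightarrow> angular A g \<Longrightarrow> angular A (\<lambda>z. f z + g z)"
| cmult: "angular A f \<Longrightarrow> angular A (\<lambda>z. c * f z)"
| Re: "angular A f \<Longrightarrow> angular A (\<lambda>z. of_real (Re z) * f z)"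
| Im: "angular A f \<Longrightarrow> angular A (\<lambda>z. of_real (Im z) * f z)"

lemma angular_bounded:
  assumes A: "smooth_closed_disk A" and "angular A f"
  shows "\<exists>M. \<forall>z\<in>ball 0 1. cmod (f z) \<le> M"
  using assms(2)
proof induction
  case (base vs)
  then obtain g where g: "continuous_on (cball 0 1) g" "\<forall>z\<in>ball 0 1. g z = dir_derivs vs A z"
    using A unfolding smooth_closed_disk_def by blast
  have "compact (g ` cball 0 1)" by (intro compact_continuous_image g) auto
  then obtain M where M: "\<And>z. z \<in> cball 0 1 \<Longrightarrow> cmod (g z) \<le> M"
    using compact_imp_bounded bounded_iff by (metis image_eqI)
  have "cmod (dir_derivs vs A z) \<le> M" if "z \<in> ball 0 1" for z
    using M[of z] g(2)[rule_format, OF that] that by simp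
  then show ?case by blast
next
  case (add f g)
  then obtain M N where "\<forall>z\<in>ball 0 1. cmod (f z) \<le> M" "\<forall>z\<in>ball 0 1. cmod (g z) \<le> N" by blast
  then show ?case by (intro exI[of _ "M + N"]) (auto intro!: norm_triangle_le add_mono)
next
  case (cmult f c)
  then obtain M where "\<forall>z\<in>ball 0 1. cmod (f z) \<le> M" by blast
  then show ?case by (intro exI[of _ "cmod c * M"]) (auto simp: norm_mult intro!: mult_left_mono)
next
  case (Re f)
  then obtain M where M: "\<And>z. z \<in> ball 0 1 \<Longrightarrow> cmod (f z) \<le> M" by blast
  have "cmod (of_real (Re z) * f z) \<le> 1 * M" if "z \<in> ball 0 1" for z
    unfolding norm_mult using that abs_Re_le_cmod[of z] by (intro mult_mono M) auto
  then show ?case by blast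
next
  case (Im f)
  then obtain M where M: "\<And>z. z \<in> ball 0 1 \<Longrightarrow> cmod (f z) \<le> M" by blast
  have "cmod (of_real (Im z) * f z) \<le> 1 * M" if "z \<in> ball 0 1" for z
    unfolding norm_mult using that abs_Im_le_cmod[of z] by (intro mult_mono M) auto
  then show ?case by blast
qed

text \<open>\<open>L (\<i> * z)\<close> is the derivative along the field that generates rotations.
  On an iterated partial derivative it yields two of the next order with coefficients
  \<open>Re z\<close> and \<open>- Im z\<close>; the coordinates themselves it exchanges up to sign,
  so the class is closed.\<close>

lemma angular_derivative:
  assumes A: "smooth_closed_disk A" and "angular A f"
  shows "\<exists>g. angular A g \<and> (\<forall>z\<in>ball 0 1. \<exists>L. (f has_derivative L) (at z) \<and> L (\<i> * z) = g z)"
  using assms(2)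
proof induction
  case (base vs)
  let ?g = "\<lambda>z. of_real (Re z) * dir_derivs (\<i> # vs) A z + (-1) * (of_real (Im z) * dir_derivs (1 # vs) A z)"
  have ang: "angular A ?g"
    using base by (intro angular.intros) auto
  have "\<exists>L. (dir_derivs vs A has_derivative L) (at z) \<and> L (\<i> * z) = ?g z" if z: "z \<in> ball 0 1" for z
  proof -
    define L where "L = frechet_derivative (dir_derivs vs A) (at z)"
    have L: "(dir_derivs vs A has_derivative L) (at z)"
      using A base z unfolding smooth_closed_disk_def L_def frechet_derivative_works[symmetric] by blast
    then have lin: "linear L" by (rule has_derivative_linear)
    have "\<i> * z = Re z *\<^sub>R \<i> + (- Im z) *\<^sub>R 1" by (simp add: complex_eq_iff)
    then have "L (\<i> * z) = Re z *\<^sub>R L \<i> + (- Im z) *\<^sub>R L 1"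
      by (simp only: linear_add[OF lin] linear_cmul[OF lin])
    then have "L (\<i> * z) = ?g z" by (simp add: L_def scaleR_conv_of_real)
    with L show ?thesis by blast
  qed
  with ang show ?case by blast
next
  case (add f1 f2)
  then obtain g1 g2 where g: "angular A g1" "angular A g2"
    "\<And>z. z \<in> ball 0 1 \<Longrightarrow> \<exists>L. (f1 has_derivative L) (at z) \<and> L (\<i> * z) = g1 z"
    "\<And>z. z \<in> ball 0 1 \<Longrightarrow> \<exists>L. (f2 has_derivative L) (at z) \<and> L (\<i> * z) = g2 z"
    by blast
  show ?case
  proof (rule exI[of _ "\<lambda>z. g1 z + g2 z"], intro conjI ballI angular.add g(1,2))
    fix z :: complex assume z: "z \<in> ball 0 1"
    obtain L1 L2 where "(f1 has_derivative L1) (at z)" "L1 (\<i> * z) = g1 z"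
      "(f2 has_derivative L2) (at z)" "L2 (\<i> * z) = g2 z" using g(3,4)[OF z] by blast
    then show "\<exists>L. ((\<lambda>z. f1 z + f2 z) has_derivative L) (at z) \<and> L (\<i> * z) = g1 z + g2 z"
      by (intro exI[of _ "\<lambda>h. L1 h + L2 h"]) (auto intro: has_derivative_add)
  qed
next
  case (cmult f c)
  then obtain g where g: "angular A g"
    "\<And>z. z \<in> ball 0 1 \<Longrightarrow> \<exists>L. (f has_derivative L) (at z) \<and> L (\<i> * z) = g z" by blast
  show ?case
  proof (rule exI[of _ "\<lambda>z. c * g z"], intro conjI ballI angular.cmult g(1))
    fix z :: complex assume z: "z \<in> ball 0 1"
    obtain L where "(f has_derivative L) (at z)" "L (\<i> * z) = g z" using g(2)[OF z] by blast
    then show "\<exists>L. ((\<lambda>z. c * f z) has_derivative L) (at z) \<and> L (\<i> * z) = c * g z"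
      by (intro exI[of _ "\<lambda>h. c * L h"]) (auto intro: has_derivative_mult_right)
  qed
next
  case (Re f)
  then obtain g where g: "angular A g"
    "\<And>z. z \<in> ball 0 1 \<Longrightarrow> \<exists>L. (f has_derivative L) (at z) \<and> L (\<i> * z) = g z" by blast
  show ?case
  proof (rule exI[of _ "\<lambda>z. of_real (Re z) * g z + (-1) * (of_real (Im z) * f z)"], intro conjI ballI)
    show "angular A (\<lambda>z. of_real (Re z) * g z + (-1) * (of_real (Im z) * f z))"
      by (intro angular.intros g Re)
    fix z :: complex assume z: "z \<in> ball 0 1"
    obtain L where L: "(f has_derivative L) (at z)" "L (\<i> * z) = g z" using g(2)[OF z] by blast
    have "((\<lambda>z. of_real (Re z) * f z) has_derivative (\<lambda>h. of_real (Re z) * L h + of_real (Re h) * f z)) (at z)"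
      by (intro has_derivative_mult L has_derivative_of_real bounded_linear_imp_has_derivative bounded_linear_Re)
    then show "\<exists>L. ((\<lambda>z. of_real (Re z) * f z) has_derivative L) (at z) \<and>
        L (\<i> * z) = of_real (Re z) * g z + (-1) * (of_real (Im z) * f z)"
      using L(2) by (intro exI conjI) (assumption, simp)
  qed
next
  case (Im f)
  then obtain g where g: "angular A g"
    "\<And>z. z \<in> ball 0 1 \<Longrightarrow> \<exists>L. (f has_derivative L) (at z) \<and> L (\<i> * z) = g z" by blast
  show ?case
  proof (rule exI[of _ "\<lambda>z. of_real (Im z) * g z + of_real (Re z) * f z"], intro conjI ballI)
    show "angular A (\<lambda>z. of_real (Im z) * g z + of_real (Re z) * f z)"
      by (intro angular.intros g Im)
    fix z :: complex assume z: "z \<in> ball 0 1"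
    obtain L where L: "(f has_derivative L) (at z)" "L (\<i> * z) = g z" using g(2)[OF z] by blast
    have "((\<lambda>z. of_real (Im z) * f z) has_derivative (\<lambda>h. of_real (Im z) * L h + of_real (Im h) * f z)) (at z)"
      by (intro has_derivative_mult L has_derivative_of_real bounded_linear_imp_has_derivative bounded_linear_Im)
    then show "\<exists>L. ((\<lambda>z. of_real (Im z) * f z) has_derivative L) (at z) \<and>
        L (\<i> * z) = of_real (Im z) * g z + of_real (Re z) * f z"
      using L(2) by (intro exI conjI) (assumption, simp)
  qed
qed

text \<open>The phase is the one from \<open>psi_rotate\<close>; differentiating it adds
  \<open>- \<i> * f\<close> to the angular derivative of \<open>f\<close>.\<close>

lemma angular_rotate_derivative:
  assumes A: "smooth_closed_disk A" and f: "angular A f"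
  shows "\<exists>g. angular A g \<and> (\<forall>z\<in>ball 0 1. \<forall>t.
    ((\<lambda>t. cis (- t) * f (cis t * z)) has_vector_derivative cis (- t) * g (cis t * z)) (at t))"
proof -
  obtain g where g: "angular A g"
    "\<And>z. z \<in> ball 0 1 \<Longrightarrow> \<exists>L. (f has_derivative L) (at z) \<and> L (\<i> * z) = g z"
    using angular_derivative[OF A f] by blast
  show ?thesis
  proof (rule exI[of _ "\<lambda>z. g z + (- \<i>) * f z"], intro conjI ballI allI angular.intros g(1) f)
    fix z :: complex and t :: real assume "z \<in> ball 0 1"
    then have "cis t * z \<in> ball 0 1" by (simp add: norm_mult)
    from g(2)[OF this] obtain L where L: "(f has_derivative L) (at (cis t * z))"
      "L (\<i> * (cis t * z)) = g (cis t * z)" by blast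
    have "((\<lambda>t. f (cis t * z)) has_derivative (\<lambda>h. L (h *\<^sub>R (\<i> * cis t * z)))) (at t)"
      using diff_chain_at[OF has_vector_derivative_cis_mult[of z t UNIV, unfolded has_vector_derivative_def] L(1)]
      by (simp add: comp_def)
    moreover have "L (h *\<^sub>R (\<i> * cis t * z)) = h *\<^sub>R g (cis t * z)" for h
      using linear_cmul[OF has_derivative_linear[OF L(1)]] L(2) by (simp only: mult.assoc)
    ultimately have 1: "((\<lambda>t. f (cis t * z)) has_vector_derivative g (cis t * z)) (at t)"
      by (simp add: has_vector_derivative_def)
    have 2: "((\<lambda>t. cis (- t)) has_vector_derivative - \<i> * cis (- t)) (at t)"
      using has_vector_derivative_cis_scaled[of 1 "-1" t] by simp
    show "((\<lambda>t. cis (- t) * f (cis t * z)) has_vector_derivative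
        cis (- t) * (g (cis t * z) + (- \<i>) * f (cis t * z))) (at t)"
      using has_vector_derivative_mult[OF 2 1] by (simp add: algebra_simps)
  qed
qed

lemma angular_continuous_on:
  assumes A: "smooth_closed_disk A" and f: "angular A f"
  shows "continuous_on (ball 0 1) f"
  using angular_derivative[OF A f]
  by (intro continuous_at_imp_continuous_on) (blast intro: has_derivative_continuous)

lemma disk_bdd_on_disk:
  assumes f: "continuous_on (ball 0 1) f" and M: "\<And>z. z \<in> ball 0 1 \<Longrightarrow> cmod (f z) \<le> M"
  shows "disk_bdd (on_disk f)"
proof (rule disk_bddI)
  show "on_disk f \<in> borel_measurable borel" by (rule on_disk_measurable[OF f])
qed (use M in auto)

lemma angular_disk_bdd:
  assumes "smooth_closed_disk A" "angular A f"
  shows "disk_bdd (on_disk f)"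
  using angular_bounded[OF assms] angular_continuous_on[OF assms] disk_bdd_on_disk by blast

text \<open>The derivative of \<open>psi f\<close> along circles is \<open>psi g\<close> for another
  density \<open>g\<close> of the class, so the induction runs over all densities at once. Each
  order is bounded because \<open>psi\<close> of such a density is continuous on the closed
  disk.\<close>

lemma csmooth_psi:
  assumes A: "smooth_closed_disk A" and "angular A f"
  shows "csmooth k {0..1} (\<lambda>r t. psi f (of_real r * cis t))"
  using assms(2)
proof (induction k arbitrary: f)
  have bounded: "csmooth 0 {0..1} (\<lambda>r t. psi f (of_real r * cis t))" if "angular A f" for f
  proof -
    have "compact (psi f ` cball 0 1)"
      by (intro compact_continuous_image continuous_on_psi angular_disk_bdd[OF A that]) auto
    then obtain M where M: "\<And>z. z \<in> cball 0 1 \<Longrightarrow> cmod (psi f z) \<le> M"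
      using compact_imp_bounded bounded_iff by (metis image_eqI)
    have "cmod (psi f (of_real r * cis t)) \<le> M" if "r \<in> {0..1}" for r t
      using that by (intro M) (auto simp: norm_mult)
    then show ?thesis unfolding csmooth.simps by blast
  qed
  {
    case (0 f)
    then show ?case by (rule bounded)
  next
    case (Suc k f)
    obtain g where g: "angular A g" "\<And>z t. z \<in> ball 0 1 \<Longrightarrow>
      ((\<lambda>t. cis (- t) * f (cis t * z)) has_vector_derivative cis (- t) * g (cis t * z)) (at t)"
      using angular_rotate_derivative[OF A Suc.prems] by blast
    obtain M0 M1 where M: "\<And>z. z \<in> ball 0 1 \<Longrightarrow> cmod (f z) \<le> M0" "\<And>z. z \<in> ball 0 1 \<Longrightarrow> cmod (g z) \<le> M1"
      using angular_bounded[OF A Suc.prems] angular_bounded[OF A g(1)] by blast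
    show ?case
    proof (rule csmooth_SucI[OF bounded[OF Suc.prems] _ Suc.IH[OF g(1)]])
      fix r t :: real assume "r \<in> {0..1}"
      then have "cmod (of_real r) \<le> 1" by simp
      from psi_rotate_has_vector_derivative[OF angular_continuous_on[OF A Suc.prems] M(1)
          angular_continuous_on[OF A g(1)] M(2) g(2) this, of t]
      show "((\<lambda>t. psi f (of_real r * cis t)) has_vector_derivative psi g (of_real r * cis t)) (at t)"
        by (simp add: mult.commute)
    qed
  }
qed

lemma angular_self: "angular A A"
  using angular.base[of "[]" A] by simp

lemma smooth_family_psi:
  assumes A: "smooth_closed_disk A"
  shows "smooth_family (\<lambda>r t. psi A (of_real r * cis t))"
  unfolding smooth_family_def
proof (intro conjI allI ballI)
  show "csmooth k {0..1} (\<lambda>r t. psi A (of_real r * cis t))" for k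
    by (rule csmooth_psi[OF A angular_self])
  show "psi A (of_real r * cis (t + 2 * pi)) = psi A (of_real r * cis t)" for r t
    by (simp add: cis_mult[symmetric])
  fix t
  have "continuous_on {0..1::real} (\<lambda>r. psi A (of_real r * cis t))"
    by (rule continuous_on_compose2[OF continuous_on_psi[OF angular_disk_bdd[OF A angular_self]]])
       (auto intro!: continuous_intros simp: norm_mult)
  then show "((\<lambda>r. psi A (of_real r * cis t)) \<longlongrightarrow> psi A (of_real 1 * cis t)) (at_left 1)"
    by (rule continuous_on_Icc_at_leftD) simp
qed

lemma disk_ext_eq:
  assumes "continuous_on (cball 0 1) f" "z \<in> cball 0 1"
  shows "disk_ext f z = f z"
proof (cases "z \<in> ball 0 1")
  case False
  have "(f \<longlongrightarrow> f z) (at z within cball 0 1)" using assms by (auto simp: continuous_on)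
  then have "(f \<longlongrightarrow> f z) (at z within ball 0 1)" by (rule tendsto_within_subset) auto
  moreover have "at z within ball 0 1 \<noteq> bot"
    using assms(2) by (simp add: trivial_limit_within islimpt_ball)
  ultimately show ?thesis using False by (simp add: disk_ext_def tendsto_Lim)
qed (simp add: disk_ext_def)

section \<open>The Schwarz problem\<close>

text \<open>Every real-linear map on the complex plane has the form \<open>h \<mapsto> D h + d h\<^sup>*\<close>, so this
  says that \<open>w\<close> is real differentiable at \<open>z\<close> with \<open>\<partial>w/\<partial>z\<^sup>* = d\<close>.\<close>

definition dbar_at :: "(complex \<Rightarrow> complex) \<Rightarrow> complex \<Rightarrow> complex \<Rightarrow> bool" where
  "dbar_at w z d \<longleftrightarrow> (\<exists>D. (w has_derivative (\<lambda>h. D * h + d * cnj h)) (at z))"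

lemma dbar_at_imp:
  assumes "dbar_at w z d"
  shows "w differentiable (at z)" "dbar w z = d"
proof -
  obtain D where D: "(w has_derivative (\<lambda>h. D * h + d * cnj h)) (at z)"
    using assms by (auto simp: dbar_at_def)
  then show "w differentiable (at z)" by (auto simp: differentiable_def)
  have "frechet_derivative w (at z) = (\<lambda>h. D * h + d * cnj h)"
    using frechet_derivative_at[OF D] by simp
  then show "dbar w z = d" by (simp add: dbar_def algebra_simps)
qed

lemma dbar_at_transform:
  assumes "dbar_at f z d" "z \<in> ball 0 1" "\<And>z. z \<in> ball 0 1 \<Longrightarrow> g z = f z"
  shows "dbar_at g z d"
proof -
  obtain D where D: "(f has_derivative (\<lambda>h. D * h + d * cnj h)) (at z)"
    using assms(1) by (auto simp: dbar_at_def)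
  have "(g has_derivative (\<lambda>h. D * h + d * cnj h)) (at z)"
    by (rule has_derivative_transform_within_open[OF D, where s = "ball 0 1"]) (use assms in auto)
  then show ?thesis by (auto simp: dbar_at_def)
qed

lemma dbar_at_holomorphic: "(f has_field_derivative D) (at z) \<Longrightarrow> dbar_at f z 0"
  unfolding dbar_at_def has_field_derivative_def by (intro exI[of _ D]) simp

lemma dbar_at_add:
  assumes "dbar_at f z d" "dbar_at g z e"
  shows "dbar_at (\<lambda>z. f z + g z) z (d + e)"
proof -
  obtain D E where "(f has_derivative (\<lambda>h. D * h + d * cnj h)) (at z)"
    "(g has_derivative (\<lambda>h. E * h + e * cnj h)) (at z)"
    using assms by (auto simp: dbar_at_def)
  from has_derivative_add[OF this] show ?thesis
    unfolding dbar_at_def by (intro exI[of _ "D + E"]) (simp add: algebra_simps)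
qed

lemma dbar_at_mult:
  assumes "dbar_at f z d" "dbar_at g z e"
  shows "dbar_at (\<lambda>z. f z * g z) z (f z * e + d * g z)"
proof -
  obtain D E where "(f has_derivative (\<lambda>h. D * h + d * cnj h)) (at z)"
    "(g has_derivative (\<lambda>h. E * h + e * cnj h)) (at z)"
    using assms by (auto simp: dbar_at_def)
  from has_derivative_mult[OF this] show ?thesis
    unfolding dbar_at_def by (intro exI[of _ "f z * E + D * g z"]) (simp add: algebra_simps)
qed

lemma dbar_at_cmult: "dbar_at f z d \<Longrightarrow> dbar_at (\<lambda>z. c * f z) z (c * d)"
  using dbar_at_mult[OF dbar_at_holomorphic[OF DERIV_const[of c]], of f z d] by simp

lemma dbar_at_sum:
  assumes "finite S" "\<And>l. l \<in> S \<Longrightarrow> dbar_at (f l) z (d l)"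
  shows "dbar_at (\<lambda>z. \<Sum>l\<in>S. f l z) z (\<Sum>l\<in>S. d l)"
  using assms
proof (induction S rule: finite_induct)
  case empty
  then show ?case using dbar_at_holomorphic[OF DERIV_const[of 0]] by simp
qed (simp add: dbar_at_add)

lemma dbar_at_cnj_power: "dbar_at (\<lambda>z. cnj z ^ l) z (of_nat l * cnj z ^ (l - 1))"
proof -
  have "((\<lambda>z. cnj z ^ l) has_derivative (\<lambda>h. of_nat l * cnj h * cnj z ^ (l - 1))) (at z)"
    by (intro has_derivative_power has_derivative_cnj has_derivative_ident)
  then show ?thesis unfolding dbar_at_def by (intro exI[of _ 0]) (simp add: mult_ac)
qed

lemma dbar_at_exp:
  assumes "dbar_at f z d"
  shows "dbar_at (\<lambda>z. exp (f z)) z (exp (f z) * d)"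
proof -
  obtain D where D: "(f has_derivative (\<lambda>h. D * h + d * cnj h)) (at z)"
    using assms by (auto simp: dbar_at_def)
  from diff_chain_at[OF this DERIV_exp[of "f z", unfolded has_field_derivative_def]] show ?thesis
    unfolding dbar_at_def comp_def by (intro exI[of _ "exp (f z) * D"]) (simp add: algebra_simps)
qed

text \<open>After an index shift the two sums produced by the product rule telescope.\<close>

lemma dbar_at_poly_analytic_recursion:
  assumes hol: "\<And>j. j < n \<Longrightarrow> g j holomorphic_on ball 0 1"
    and f0: "\<And>z. z \<in> ball 0 1 \<Longrightarrow> f 0 z = 0"
    and rec: "\<And>j z. j < n \<Longrightarrow> z \<in> ball 0 1 \<Longrightarrow>
      f (Suc j) z = g j z - (\<Sum>l = 1..j. (-1) ^ l / fact l * cnj z ^ l * f (Suc j - l) z)"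
    and "j < n" "z \<in> ball 0 1"
  shows "dbar_at (f (Suc j)) z (f j z)"
  using \<open>j < n\<close>
proof (induction j rule: less_induct)
  case (less j)
  \<comment> \<open>\<open>a m\<close> is the \<open>m\<close>-th summand with \<open>j\<close> in
    place of \<open>Suc j\<close>. Since \<open>l / fact l\<close> is
    \<open>1 / fact (l - 1)\<close> and the sign alternates, the \<open>l\<close>-th summand has
    derivative \<open>a l - a (l - 1)\<close>. At the ends, \<open>a 0\<close> is
    \<open>f j z\<close>, while \<open>a j\<close> contains \<open>f 0\<close> and vanishes.\<close>
  define a where "a = (\<lambda>m. (-1) ^ m / fact m * cnj z ^ m * f (j - m) z)"
  have "dbar_at (\<lambda>z. (-1) ^ l / fact l * (cnj z ^ l * f (Suc j - l) z)) z (a l - a (l - 1))"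
    if l: "l \<in> {1..j}" for l
  proof -
    obtain m where m: "l = Suc m" "m < j" using l by (cases l) auto
    have "dbar_at (f (Suc (j - l))) z (f (j - l) z)" using l less by auto
    then have "dbar_at (f (j - m)) z (f (j - l) z)" using m by (simp add: Suc_diff_Suc)
    from dbar_at_cmult[OF dbar_at_mult[OF dbar_at_cnj_power this], of "(-1) ^ l / fact l" l]
    have "dbar_at (\<lambda>z. (-1) ^ l / fact l * (cnj z ^ l * f (j - m) z)) z
      ((-1) ^ l / fact l * (cnj z ^ l * f (j - l) z + of_nat l * cnj z ^ (l - 1) * f (j - m) z))" .
    moreover have "(-1) ^ l / fact l * (cnj z ^ l * f (j - l) z + of_nat l * cnj z ^ (l - 1) * f (j - m) z)
        = a l - a (l - 1)"
    proof -
      have "(-1) ^ l / fact l * of_nat l = - ((-1) ^ m / fact m :: complex)"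
        using of_nat_neq_0[of m, where 'a = complex] by (simp add: m(1) divide_simps)
      then have "(-1) ^ l / fact l * (of_nat l * cnj z ^ (l - 1) * f (j - m) z) = - a (l - 1)"
        unfolding a_def m(1) by (simp only: mult.assoc[symmetric] diff_Suc_1) (simp add: mult.assoc)
      then show ?thesis by (simp add: distrib_left a_def mult.assoc)
    qed
    ultimately show ?thesis using m by simp
  qed
  then have "dbar_at (\<lambda>z. \<Sum>l = 1..j. (-1) ^ l / fact l * (cnj z ^ l * f (Suc j - l) z)) z
      (\<Sum>l = 1..j. a l - a (l - 1))"
    by (intro dbar_at_sum) auto
  also have "(\<Sum>l = 1..j. a l - a (l - 1)) = a j - a 0"
    using sum_telescope''[of 0 j a] by simp
  also have "\<dots> = - f j z" using f0[OF \<open>z \<in> ball 0 1\<close>] by (simp add: a_def)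
  finally have S: "dbar_at (\<lambda>z. \<Sum>l = 1..j. (-1) ^ l / fact l * (cnj z ^ l * f (Suc j - l) z)) z (- f j z)" .
  have "g j field_differentiable (at z)"
    using hol[OF \<open>j < n\<close>] \<open>z \<in> ball 0 1\<close> holomorphic_on_imp_differentiable_at by blast
  then obtain D where "(g j has_field_derivative D) (at z)" by (auto simp: field_differentiable_def)
  from dbar_at_add[OF dbar_at_holomorphic[OF this] dbar_at_cmult[OF S, of "-1"]]
  have "dbar_at (\<lambda>z. g j z + - 1 * (\<Sum>l = 1..j. (-1) ^ l / fact l * (cnj z ^ l * f (Suc j - l) z))) z (f j z)"
    by simp
  then show ?case
    by (rule dbar_at_transform[OF _ \<open>z \<in> ball 0 1\<close>]) (simp add: rec[OF \<open>j < n\<close>] mult.assoc)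
qed

lemma test_fun_bounded_linear:
  assumes "bounded_linear L" "test_fun \<phi>"
  shows "test_fun (\<lambda>t. L (\<phi> t))"
proof (rule csmooth_imp_test_fun[where F = "\<lambda>_::unit. \<lambda>t. L (\<phi> t)" and S = UNIV and p = "()"])
  show "csmooth k UNIV (\<lambda>_::unit. \<lambda>t. L (\<phi> t))" for k
    by (rule csmooth_bounded_linear[OF assms(1) test_fun_imp_csmooth[OF assms(2)]])
qed (use assms(2) in \<open>auto simp: test_fun_def\<close>)

text \<open>\<open>dist_Re\<close> evaluates its argument only at the real and imaginary parts of a
  test function, and these are again real-valued test functions.\<close>

lemma dist_Re_eqI:
  assumes "\<And>\<phi>. test_fun \<phi> \<Longrightarrow> (\<And>t. Im (\<phi> t) = 0) \<Longrightarrow> Re (u \<phi>) = Re (v \<phi>)"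
  shows "dist_eq (dist_Re u) (dist_Re v)"
proof -
  have "bounded_linear (\<lambda>x. complex_of_real (Re x))" "bounded_linear (\<lambda>x. complex_of_real (Im x))"
    by (intro bounded_linear_compose[OF bounded_linear_of_real] bounded_linear_Re bounded_linear_Im)+
  note test = this[THEN test_fun_bounded_linear]
  show ?thesis unfolding dist_eq_def
  proof (intro allI impI)
    fix \<phi> assume "test_fun \<phi>"
    from assms[OF test(1)[OF this]] assms[OF test(2)[OF this]]
    show "dist_Re u \<phi> = dist_Re v \<phi>" by (simp add: dist_Re_def)
  qed
qed

lemma integral_real_valued:
  fixes \<phi> :: "real \<Rightarrow> complex"
  assumes "\<And>t. Im (\<phi> t) = 0"
  shows "Im (integral S \<phi>) = 0"
proof -
  have "cnj (integral S \<phi>) = integral S (\<lambda>t. cnj (\<phi> t))"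
    by (rule Henstock_Kurzweil_Integration.integral_cnj)
  also have "(\<lambda>t. cnj (\<phi> t)) = \<phi>" using assms by (auto simp: complex_eq_iff)
  finally show ?thesis by (metis Reals_cnj_iff complex_is_Real_iff)
qed

text \<open>The clauses on the extension of \<open>psi A\<close>, on its exponential as a test
  function and on differentiability of the iterates ensure that the boundary multiplier is a smooth
  function and that no default value of \<open>Lim\<close> or \<open>frechet_derivative\<close>
  enters.\<close>

theorem theorem4p4:
  fixes n :: nat and A :: "complex \<Rightarrow> complex"
    and h :: "nat \<Rightarrow> complex \<Rightarrow> complex" and c :: "nat \<Rightarrow> real"
    and f :: "nat \<Rightarrow> complex \<Rightarrow> complex" and w :: "complex \<Rightarrow> complex"
  assumes "n \<ge> 1"
    and "smooth_closed_disk A"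
    and "\<And>k. 1 \<le> k \<Longrightarrow> k \<le> n \<Longrightarrow> h (k - 1) \<in> Hb"
    and "\<And>z. z \<in> ball 0 1 \<Longrightarrow> f 0 z = 0"
    and "\<And>k z. 1 \<le> k \<Longrightarrow> k \<le> n \<Longrightarrow> z \<in> ball 0 1 \<Longrightarrow>
           f k z = \<i> * of_real (c (k - 1)) - I_const (bv (h (k - 1)))
             + 1 / (2 * of_real pi) * poisson_pairing (bv (h (k - 1))) z
             - (\<Sum>l = 1..k - 1. (-1) ^ l / fact l * cnj z ^ l * f (k - l) z)"
    and "\<And>z. z \<in> ball 0 1 \<Longrightarrow>
           w z = exp (psi A z) *
             (\<i> * of_real (c (n - 1)) - I_const (bv (h (n - 1)))
               + 1 / (2 * of_real pi) * poisson_pairing (bv (h (n - 1))) z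
               - (\<Sum>l = 1..n - 1. (-1) ^ l / fact l * cnj z ^ l * f (n - l) z))"
  shows
    "(\<forall>k. 1 \<le> k \<and> k \<le> n \<longrightarrow>
        (\<forall>z\<in>ball 0 1. f k differentiable (at z) \<and> dbar (f k) z = f (k - 1) z) \<and>
        has_bv (f k) \<and>
        dist_eq (dist_Re (bv (f k)))
          (dist_Re (\<lambda>\<phi>. bv (h (k - 1)) \<phi>
             - (\<Sum>l = 1..k - 1. (-1) ^ l / fact l *
                  dist_mult (\<lambda>\<theta>. exp (- \<i> * of_nat l * of_real \<theta>)) (bv (f (k - l))) \<phi>))) \<and>
        Im (f k 0) = c (k - 1))
     \<and> continuous_on (cball 0 1) (disk_ext (psi A))
     \<and> test_fun (\<lambda>\<theta>. exp (disk_ext (psi A) (cis \<theta>)))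
     \<and> (\<forall>k<n. \<forall>z\<in>ball 0 1. (dbar_minus A ^^ k) w differentiable (at z))
     \<and> (\<forall>z\<in>ball 0 1. (dbar_minus A ^^ n) w z = 0)
     \<and> (\<forall>k. k \<le> n - 1 \<longrightarrow>
          has_bv ((dbar_minus A ^^ k) w) \<and>
          dist_eq (dist_Re (bv ((dbar_minus A ^^ k) w)))
            (dist_Re (dist_mult (\<lambda>\<theta>. exp (disk_ext (psi A) (cis \<theta>)))
               (\<lambda>\<phi>. dist_const (\<i> * of_real (c (n - 1 - k)) - I_const (bv (h (n - 1 - k)))) \<phi>
                  + bv (h (n - 1 - k)) \<phi>
                  - (\<Sum>l = 1..n - k - 1. (-1) ^ l / fact l *
                       dist_mult (\<lambda>\<theta>. exp (- \<i> * of_nat l * of_real \<theta>)) (bv (f (n - k - l))) \<phi>)))) \<and>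
          complex_of_real (Im ((dbar_minus A ^^ k) w 0))
            = exp (psi A 0) * of_real (c (n - 1 - k)))"
proof -
  define \<kappa> where "\<kappa> = (\<lambda>j. \<i> * of_real (c j) - I_const (bv (h j)))"
  define W where "W = (\<lambda>j \<phi>. dist_const (\<kappa> j) \<phi> + bv (h j) \<phi>
    - (\<Sum>l = 1..j. (-1) ^ l / fact l *
         dist_mult (\<lambda>\<theta>. exp (- \<i> * of_nat l * of_real \<theta>)) (bv (f (Suc j - l))) \<phi>))"
  define E where "E = (\<lambda>z. exp (psi A z))"
  define Eb where "Eb = (\<lambda>\<theta>. exp (disk_ext (psi A) (cis \<theta>)))"
  note A = assms(2)
  have hHb: "h j \<in> Hb" if "j < n" for j using assms(3)[of "Suc j"] that by simp
  then have hhol: "h j holomorphic_on ball 0 1" if "j < n" for j using that by (simp add: Hb_def)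
  \<comment> \<open>Purely imaginary, by the mean value property: adding it moves the imaginary part
    of \<open>h j\<close> at 0 to \<open>c j\<close> and leaves real parts untouched.\<close>
  have \<kappa>: "\<kappa> j = \<i> * of_real (c j - Im (h j 0))" if "j < n" for j
    by (simp add: \<kappa>_def I_const_bv[OF hhol[OF that]] algebra_simps)
  have rec: "f (Suc j) z = (\<kappa> j + h j z) - (\<Sum>l = 1..j. (-1) ^ l / fact l * cnj z ^ l * f (Suc j - l) z)"
    if "j < n" "z \<in> ball 0 1" for j z
    using assms(5)[of "Suc j" z] that
    by (simp add: \<kappa>_def poisson_pairing_bv[OF hhol[OF that(1)] that(2)])
  \<comment> \<open>The bracket in \<open>w\<close> is the defining formula of
    \<open>f n\<close>.\<close>
  have wE: "w z = E z * f n z" if "z \<in> ball 0 1" for z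
    using assms(6)[OF that] assms(5)[OF \<open>n \<ge> 1\<close> order_refl that] by (simp add: E_def)
  have dbar_f: "dbar_at (f (Suc j)) z (f j z)" if "j < n" "z \<in> ball 0 1" for j z
    by (rule dbar_at_poly_analytic_recursion[where g = "\<lambda>j z. \<kappa> j + h j z" and n = n])
       (use that rec assms(4) hhol in \<open>auto intro!: holomorphic_intros\<close>)
  have bvW: "has_bv_dist (f (Suc j)) (W j)" if "j < n" for j
    using that
  proof (induction j rule: less_induct)
    case (less j)
    \<comment> \<open>The earlier functions already have a boundary distribution in the strong
      sense; by uniqueness of limits it agrees with their \<open>bv\<close>, the form in which it
      occurs in \<open>W j\<close>.\<close>
    have bvf: "has_bv_dist (f (Suc j - l)) (bv (f (Suc j - l)))" if l: "l \<in> {1..j}" for l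
    proof -
      have "Suc j - l = Suc (j - l)" using l by auto
      moreover have "has_bv_dist (f (Suc (j - l))) (W (j - l))" using less l by auto
      ultimately show ?thesis
        by (metis has_bv_dist_transfer has_bv_dist_bv)
    qed
    have "has_bv_dist (\<lambda>z. \<Sum>l = 1..j. (-1) ^ l / fact l * (cnj z ^ l * f (Suc j - l) z))
      (\<lambda>\<phi>. \<Sum>l = 1..j. (-1) ^ l / fact l *
         dist_mult (\<lambda>\<theta>. exp (- \<i> * of_nat l * of_real \<theta>)) (bv (f (Suc j - l))) \<phi>)"
      by (intro has_bv_dist_sum has_bv_dist_cmult has_bv_dist_cnj_power bvf) auto
    from has_bv_dist_add[OF has_bv_dist_add[OF has_bv_dist_const[of "\<kappa> j"] has_bv_dist_Hb[OF hHb[OF less.prems]]]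
        has_bv_dist_cmult[OF this, of "-1"]]
    show ?case
      by (rule has_bv_dist_transfer) (simp_all add: rec[OF less.prems] W_def mult.assoc)
  qed
  have bvf: "bv (f (Suc j)) \<phi> = W j \<phi>" if "j < n" "test_fun \<phi>" for j \<phi>
    using has_bv_dist_bv[OF bvW] that by blast
  have Im0: "Im (f (Suc j) 0) = c j" if "j < n" for j
  proof -
    have "(\<Sum>l = 1..j. (-1) ^ l / fact l * cnj 0 ^ l * f (Suc j - l) 0) = 0"
      by (intro sum.neutral) auto
    with rec[OF that, of 0] show ?thesis by (simp add: \<kappa>[OF that])
  qed
  have psi_cont: "continuous_on (cball 0 1) (psi A)"
    by (intro continuous_on_psi angular_disk_bdd[OF A] angular_self)
  have ext: "disk_ext (psi A) z = psi A z" if "z \<in> cball 0 1" for z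
    by (rule disk_ext_eq[OF psi_cont that])
  have ext_cont: "continuous_on (cball 0 1) (disk_ext (psi A))"
    by (rule continuous_on_eq[OF psi_cont]) (simp add: ext)
  have famE: "smooth_family (\<lambda>r t. E (of_real r * cis t))"
    unfolding E_def by (intro smooth_family_exp smooth_family_psi A)
  have Eb: "Eb t = E (of_real 1 * cis t)" for t by (simp add: Eb_def E_def ext)
  have test_Eb: "test_fun Eb"
    using smooth_family_test_fun[OF famE] by (simp add: Eb[abs_def])
  have dbar_E: "dbar_at E z (E z * A z)" if z: "z \<in> ball 0 1" for z
  proof -
    have "A differentiable (at z)"
      using A z unfolding smooth_closed_disk_def by (metis dir_derivs.simps(1) empty_subsetI list.set(1))
    from psi_has_derivative[OF angular_disk_bdd[OF A angular_self] z this]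
    have "dbar_at (psi A) z (A z)" unfolding dbar_at_def by blast
    then show ?thesis unfolding E_def by (rule dbar_at_exp)
  qed
  have dbar_Ef: "dbar_at (\<lambda>z. E z * f (Suc j) z) z (E z * f j z + E z * A z * f (Suc j) z)"
    if "j < n" "z \<in> ball 0 1" for j z
    by (rule dbar_at_mult[OF dbar_E[OF that(2)] dbar_f[OF that]])
  \<comment> \<open>Since \<open>E\<close> is annihilated by \<open>dbar_minus A\<close> on the
    disk, each application acts on the factor \<open>f\<close> alone and lowers its index. At
    \<open>k = n\<close> the factor is \<open>f 0\<close>, which is the differential
    equation.\<close>
  have iter: "(dbar_minus A ^^ k) w z = E z * f (n - k) z" if "k \<le> n" "z \<in> ball 0 1" for k z
    using that
  proof (induction k arbitrary: z)
    case 0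
    then show ?case by (simp add: wE)
  next
    case (Suc k z)
    have n: "n - k = Suc (n - Suc k)" using Suc.prems by simp
    \<comment> \<open>The derivative at \<open>z\<close> needs the formula for the previous iterate
      on a neighbourhood; hence the induction over all points of the disk.\<close>
    have "dbar_at ((dbar_minus A ^^ k) w) z (E z * f (n - Suc k) z + E z * A z * f (n - k) z)"
      unfolding n by (rule dbar_at_transform[OF dbar_Ef]) (use Suc n in auto)
    note dbar = dbar_at_imp(2)[OF this]
    have "(dbar_minus A ^^ Suc k) w z = dbar ((dbar_minus A ^^ k) w) z - A z * (dbar_minus A ^^ k) w z"
      by (simp add: dbar_minus_def[of A "(dbar_minus A ^^ k) w"])
    then show ?case using Suc dbar by simp
  qed
  have diff: "(dbar_minus A ^^ k) w differentiable (at z)" if "k < n" "z \<in> ball 0 1" for k z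
  proof -
    have n: "n - k = Suc (n - Suc k)" using that by simp
    have "dbar_at ((dbar_minus A ^^ k) w) z (E z * f (n - Suc k) z + E z * A z * f (n - k) z)"
      unfolding n by (rule dbar_at_transform[OF dbar_Ef]) (use that n iter in auto)
    then show ?thesis by (rule dbar_at_imp)
  qed
  have bv_iter: "has_bv_dist ((dbar_minus A ^^ k) w) (\<lambda>\<phi>. W (n - 1 - k) (\<lambda>t. Eb t * \<phi> t))"
    if k: "k \<le> n - 1" for k
  proof -
    have n: "n - k = Suc (n - 1 - k)" using k \<open>n \<ge> 1\<close> by simp
    have j: "n - 1 - k < n" using \<open>n \<ge> 1\<close> by simp
    have "continuous_on (ball 0 1) E" unfolding E_def
      by (intro continuous_intros continuous_on_subset[OF psi_cont]) auto
    from has_bv_dist_mult[OF bvW[OF j] this famE]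
    show ?thesis
    proof (rule has_bv_dist_transfer)
      show "(dbar_minus A ^^ k) w z = E z * f (Suc (n - 1 - k)) z" if "z \<in> ball 0 1" for z
        unfolding n[symmetric] using k that by (intro iter) auto
      have "(\<lambda>t. Eb t * \<phi> t) = (\<lambda>t. E (of_real 1 * cis t) * \<phi> t)" for \<phi>
        by (simp only: Eb)
      then show "W (n - 1 - k) (\<lambda>t. Eb t * \<phi> t) = W (n - 1 - k) (\<lambda>t. E (of_real 1 * cis t) * \<phi> t)" for \<phi>
        by (rule arg_cong)
    qed simp
  qed
  have part1: "(\<forall>z\<in>ball 0 1. f k differentiable (at z) \<and> dbar (f k) z = f (k - 1) z) \<and>
        has_bv (f k) \<and>
        dist_eq (dist_Re (bv (f k)))
          (dist_Re (\<lambda>\<phi>. bv (h (k - 1)) \<phi>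
             - (\<Sum>l = 1..k - 1. (-1) ^ l / fact l *
                  dist_mult (\<lambda>\<theta>. exp (- \<i> * of_nat l * of_real \<theta>)) (bv (f (k - l))) \<phi>))) \<and>
        Im (f k 0) = c (k - 1)" if k: "1 \<le> k \<and> k \<le> n" for k
  proof -
    obtain j where j: "k = Suc j" "j < n" using k by (cases k) auto
    have "dist_eq (dist_Re (bv (f (Suc j))))
          (dist_Re (\<lambda>\<phi>. bv (h j) \<phi>
             - (\<Sum>l = 1..j. (-1) ^ l / fact l *
                  dist_mult (\<lambda>\<theta>. exp (- \<i> * of_nat l * of_real \<theta>)) (bv (f (Suc j - l))) \<phi>)))"
    proof (rule dist_Re_eqI)
      fix \<phi> assume \<phi>: "test_fun \<phi>" "\<And>t. Im (\<phi> t) = 0"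
      \<comment> \<open>The constant is imaginary and the test function real, so it drops out. After
        multiplication by the complex factor \<open>Eb\<close> it need not, which is why the
        conditions on \<open>w\<close> retain it.\<close>
      have "Re (dist_const (\<kappa> j) \<phi>) = 0"
        using integral_real_valued[OF \<phi>(2)] by (simp add: dist_const_def \<kappa>[OF j(2)])
      then show "Re (bv (f (Suc j)) \<phi>) = Re (bv (h j) \<phi>
             - (\<Sum>l = 1..j. (-1) ^ l / fact l *
                  dist_mult (\<lambda>\<theta>. exp (- \<i> * of_nat l * of_real \<theta>)) (bv (f (Suc j - l))) \<phi>))"
        unfolding bvf[OF j(2) \<phi>(1)] W_def by simp
    qed
    then show ?thesis
      using dbar_at_imp[OF dbar_f[OF j(2)]] has_bv_dist_imp_has_bv[OF bvW[OF j(2)]] Im0[OF j(2)]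
      by (simp add: j(1))
  qed
  have part2: "has_bv ((dbar_minus A ^^ k) w) \<and>
          dist_eq (dist_Re (bv ((dbar_minus A ^^ k) w)))
            (dist_Re (dist_mult (\<lambda>\<theta>. exp (disk_ext (psi A) (cis \<theta>)))
               (\<lambda>\<phi>. dist_const (\<i> * of_real (c (n - 1 - k)) - I_const (bv (h (n - 1 - k)))) \<phi>
                  + bv (h (n - 1 - k)) \<phi>
                  - (\<Sum>l = 1..n - k - 1. (-1) ^ l / fact l *
                       dist_mult (\<lambda>\<theta>. exp (- \<i> * of_nat l * of_real \<theta>)) (bv (f (n - k - l))) \<phi>)))) \<and>
          complex_of_real (Im ((dbar_minus A ^^ k) w 0))
            = exp (psi A 0) * of_real (c (n - 1 - k))" if k: "k \<le> n - 1" for k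
  proof -
    define j where "j = n - 1 - k"
    have n: "n - 1 - k = j" "n - k = Suc j" "n - k - 1 = j" "j < n"
      using k \<open>n \<ge> 1\<close> by (auto simp: j_def)
    have bv_eq: "bv ((dbar_minus A ^^ k) w) \<phi> = dist_mult Eb (W j) \<phi>" if "test_fun \<phi>" for \<phi>
      using has_bv_dist_bv[OF bv_iter[OF k] that] by (simp add: dist_mult_def j_def)
    have "dist_eq (dist_Re (bv ((dbar_minus A ^^ k) w))) (dist_Re (dist_mult Eb (W j)))"
      by (rule dist_Re_eqI) (simp add: bv_eq)
    moreover have "complex_of_real (Im ((dbar_minus A ^^ k) w 0)) = exp (psi A 0) * of_real (c j)"
    proof -
      have "psi A 0 = of_real (Re (psi A 0))"
        using Im_psi_0[OF angular_disk_bdd[OF A angular_self]] by (simp add: complex_eq_iff)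
      then have E0: "E 0 = of_real (exp (Re (psi A 0)))" unfolding E_def by (metis exp_of_real)
      have "Im ((dbar_minus A ^^ k) w 0) = exp (Re (psi A 0)) * c j"
        using iter[of k 0] k by (simp add: n E0 Im0[OF n(4)])
      then show ?thesis using E0 by (simp add: E_def)
    qed
    ultimately show ?thesis
      using has_bv_dist_imp_has_bv[OF bv_iter[OF k]]
      unfolding n W_def Eb_def \<kappa>_def diff_Suc_1 by blast
  qed
  show ?thesis
  proof (intro conjI)
    show "\<forall>z\<in>ball 0 1. (dbar_minus A ^^ n) w z = 0"
      using iter[of n] assms(4) by simp
  qed (use part1 part2 ext_cont test_Eb diff in \<open>simp_all add: Eb_def\<close>)
qed

end
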